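(* Let $G$ be a connected linear Lie group. Then $G$ is weakly exponential if and only if the map $P_2:G\to G$, $g\mapsto g^2$, has dense image.
   Context: Lie groups are real and finite-dimensional. A Lie group is linear if it admits a faithful finite-dimensional representation, i.e. is isomorphic to a Lie subgroup of some $\mathrm{GL}(n,\mathbb R)$. A connected Lie group $G$ with Lie algebra $\mathfrak g$ is weakly exponential if $\exp(\mathfrak g)$ is dense in $G$. *)

theory Defs
  imports "HOL-Analysis.Analysis" "HOL-Algebra.Group"
begin

section \<open>Smooth maps between open subsets of finite-dimensional normed spaces\<close>

text \<open>
  \<open>Ck_on k S f\<close> is meant for open \<open>S\<close> and a finite-dimensional domain: \<open>f\<close> is \<open>C\<^sup>k\<close> iff it is
  differentiable and all its directional derivatives are \<open>C\<^sup>k\<^sup>-\<^sup>1\<close>.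
\<close>

primrec Ck_on :: "nat \<Rightarrow> 'a::real_normed_vector set \<Rightarrow> ('a \<Rightarrow> 'b::real_normed_vector) \<Rightarrow> bool" where
  "Ck_on 0 S f \<longleftrightarrow> continuous_on S f"
| "Ck_on (Suc k) S f \<longleftrightarrow>
     (\<exists>f'. (\<forall>x\<in>S. (f has_derivative f' x) (at x)) \<and> (\<forall>v. Ck_on k S (\<lambda>x. f' x v)))"

definition smooth_on :: "'a::real_normed_vector set \<Rightarrow> ('a \<Rightarrow> 'b::real_normed_vector) \<Rightarrow> bool" where
  "smooth_on S f \<longleftrightarrow> (\<forall>k. Ck_on k S f)"


section \<open>Smooth manifolds\<close>

text \<open>
  A chart is a pair \<open>(U, \<phi>)\<close>, where only the values of \<open>\<phi>\<close> on \<open>U\<close> matter. The model space is a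
  finite-dimensional real normed space \<open>'e\<close>; unlike the class \<open>euclidean_space\<close>, this does not
  exclude dimension 0. Atlases need not be maximal.
\<close>

type_synonym ('g, 'e) atlas = "('g set \<times> ('g \<Rightarrow> 'e)) set"

definition smooth_chart :: "'g topology \<Rightarrow> 'g set \<times> ('g \<Rightarrow> 'e::real_normed_vector) \<Rightarrow> bool" where
  "smooth_chart T = (\<lambda>(U, \<phi>). openin T U \<and> open (\<phi> ` U) \<and>
     homeomorphic_map (subtopology T U) (top_of_set (\<phi> ` U)) \<phi>)"

definition smooth_manifold :: "'g topology \<Rightarrow> ('g, 'e::real_normed_vector) atlas \<Rightarrow> bool" where
  "smooth_manifold T A \<longleftrightarrow>
     (\<exists>B :: 'e set. finite B \<and> span B = UNIV) \<and>
     Hausdorff_space T \<and> second_countable T \<and>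
     (\<forall>c\<in>A. smooth_chart T c) \<and> (\<Union>(U, \<phi>)\<in>A. U) = topspace T \<and>
     (\<forall>(U, \<phi>)\<in>A. \<forall>(V, \<psi>)\<in>A. smooth_on (\<phi> ` (U \<inter> V)) (\<psi> \<circ> inv_into U \<phi>))"

definition smooth_map ::
  "'g topology \<Rightarrow> ('g, 'e::real_normed_vector) atlas \<Rightarrow>
   'h topology \<Rightarrow> ('h, 'f::real_normed_vector) atlas \<Rightarrow> ('g \<Rightarrow> 'h) \<Rightarrow> bool" where
  "smooth_map T A T' A' f \<longleftrightarrow> continuous_map T T' f \<and>
     (\<forall>(U, \<phi>)\<in>A. \<forall>(V, \<psi>)\<in>A'. smooth_on (\<phi> ` (U \<inter> f -` V)) (\<psi> \<circ> f \<circ> inv_into U \<phi>))"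

definition prod_atlas :: "('g, 'e) atlas \<Rightarrow> ('h, 'f) atlas \<Rightarrow> ('g \<times> 'h, 'e \<times> 'f) atlas" where
  "prod_atlas A A' = {(U \<times> V, map_prod \<phi> \<psi>) | U \<phi> V \<psi>. (U, \<phi>) \<in> A \<and> (V, \<psi>) \<in> A'}"


section \<open>Lie groups\<close>

record ('g, 'e) lie_struct = "'g monoid" +
  topo :: "'g topology"
  atlas :: "('g, 'e) atlas"

definition lie_group :: "('g, 'e::real_normed_vector) lie_struct \<Rightarrow> bool" where
  "lie_group G \<longleftrightarrow> group G \<and> topspace (topo G) = carrier G \<and>
     smooth_manifold (topo G) (atlas G) \<and>
     smooth_map (prod_topology (topo G) (topo G)) (prod_atlas (atlas G) (atlas G))
       (topo G) (atlas G) (\<lambda>(x, y). x \<otimes>\<^bsub>G\<^esub> y) \<and>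
     smooth_map (topo G) (atlas G) (topo G) (atlas G) (\<lambda>x. inv\<^bsub>G\<^esub> x)"

definition connected_lie_group :: "('g, 'e::real_normed_vector) lie_struct \<Rightarrow> bool" where
  "connected_lie_group G \<longleftrightarrow> lie_group G \<and> connected_space (topo G)"

definition lie_hom ::
  "('g, 'e::real_normed_vector) lie_struct \<Rightarrow> ('h, 'f::real_normed_vector) lie_struct \<Rightarrow>
   ('g \<Rightarrow> 'h) set" where
  "lie_hom G H = {f \<in> hom G H. smooth_map (topo G) (atlas G) (topo H) (atlas H) f}"

definition real_lie :: "(real, real) lie_struct" where
  "real_lie = \<lparr>carrier = UNIV, mult = (+), one = 0, topo = euclidean, atlas = {(UNIV, id)}\<rparr>"

definition GL :: "(real^'n^'n, real^'n^'n) lie_struct" where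
  "GL = \<lparr>carrier = {M. invertible M}, mult = (**), one = mat 1,
         topo = top_of_set {M. invertible M}, atlas = {({M. invertible M}, id)}\<rparr>"

text \<open>
  Existence of a faithful representation of dimension \<open>CARD('n)\<close>. The dimension is a type, so it cannot be
  quantified here; a hypothesis \<open>linear_lie_group TYPE('n) G\<close> with \<open>'n\<close> free and
  not occurring in the conclusion amounts to existential quantification over the dimension.
  (Dimension 0 is no loss: a group embedding in \<open>GL(0)\<close> is trivial and embeds in \<open>GL(1)\<close>.)
\<close>

definition linear_lie_group :: "'n::finite itself \<Rightarrow> ('g, 'e::real_normed_vector) lie_struct \<Rightarrow> bool" where
  "linear_lie_group _ G \<longleftrightarrow>
     (\<exists>\<rho> \<in> lie_hom G (GL :: (real^'n^'n, real^'n^'n) lie_struct). inj_on \<rho> (carrier G))"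


section \<open>Lie algebra and exponential map\<close>

definition smooth_functions :: "('g, 'e::real_normed_vector) lie_struct \<Rightarrow> ('g \<Rightarrow> real) set" where
  "smooth_functions G =
     {f. smooth_map (topo G) (atlas G) (topo real_lie) (atlas real_lie) f}"

text \<open>
  The underlying vector space of the Lie algebra (the bracket plays no role here): the tangent
  space at the identity, as the derivations at the identity of the algebra of smooth functions.
  The last conjunct fixes the irrelevant values outside that algebra.
\<close>

definition lie_algebra :: "('g, 'e::real_normed_vector) lie_struct \<Rightarrow> (('g \<Rightarrow> real) \<Rightarrow> real) set" where
  "lie_algebra G = {X.
     (\<forall>f\<in>smooth_functions G. \<forall>h\<in>smooth_functions G. \<forall>a b.
        X (\<lambda>x. a * f x + b * h x) = a * X f + b * X h) \<and>
     (\<forall>f\<in>smooth_functions G. \<forall>h\<in>smooth_functions G.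
        X (\<lambda>x. f x * h x) = f \<one>\<^bsub>G\<^esub> * X h + h \<one>\<^bsub>G\<^esub> * X f) \<and>
     (\<forall>f. f \<notin> smooth_functions G \<longrightarrow> X f = 0)}"

definition initial_velocity ::
  "('g, 'e::real_normed_vector) lie_struct \<Rightarrow> (real \<Rightarrow> 'g) \<Rightarrow> (('g \<Rightarrow> real) \<Rightarrow> real) \<Rightarrow> bool" where
  "initial_velocity G \<gamma> X \<longleftrightarrow>
     (\<forall>f\<in>smooth_functions G. ((\<lambda>t. f (\<gamma> t)) has_real_derivative X f) (at 0))"

text \<open>
  The graph of the exponential map: \<open>exp X = \<gamma> 1\<close>, where \<open>\<gamma>\<close> is the one-parameter subgroup with
  \<open>\<gamma>'(0) = X\<close>.
\<close>

definition is_lie_exp ::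
  "('g, 'e::real_normed_vector) lie_struct \<Rightarrow> (('g \<Rightarrow> real) \<Rightarrow> real) \<Rightarrow> 'g \<Rightarrow> bool" where
  "is_lie_exp G X g \<longleftrightarrow> (\<exists>\<gamma>\<in>lie_hom real_lie G. initial_velocity G \<gamma> X \<and> g = \<gamma> 1)"

definition exp_image :: "('g, 'e::real_normed_vector) lie_struct \<Rightarrow> 'g set" where
  "exp_image G = {g. \<exists>X\<in>lie_algebra G. is_lie_exp G X g}"

definition dense_in :: "'g topology \<Rightarrow> 'g set \<Rightarrow> bool" where
  "dense_in T S \<longleftrightarrow> T closure_of S = topspace T"

definition weakly_exponential :: "('g, 'e::real_normed_vector) lie_struct \<Rightarrow> bool" where
  "weakly_exponential G \<longleftrightarrow> dense_in (topo G) (exp_image G)"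

definition power_map :: "('g, 'e::real_normed_vector) lie_struct \<Rightarrow> nat \<Rightarrow> 'g \<Rightarrow> 'g" where
  "power_map G k g = g [^]\<^bsub>G\<^esub> k"

end

theory Submission
  imports Defs "HOL-Complex_Analysis.Complex_Analysis" "HOL-Computational_Algebra.Fundamental_Theorem_Algebra"
begin

text \<open>
  For \<open>\<gamma>\<close> a one-parameter subgroup, \<open>\<gamma> 1\<close> is the square of \<open>\<gamma> (1/2)\<close>, so the point is that every
  square in \<open>G\<close> is a limit of exponentials. By connectedness an element of \<open>G \<subseteq> GL(n, \<real>)\<close> is \<open>h 1\<close>, where
  \<open>h t = exp (t X\<^sub>1) \<cdots> exp (t X\<^sub>k)\<close> with \<open>X\<^sub>i\<close> in the Lie algebra. This \<open>h\<close> is entire in \<open>t\<close>, so outside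
  a countable set its eigenvalues are locally holomorphic with constant multiplicities. There the
  logarithm of \<open>h t\<close> near \<open>t = 0\<close> continues analytically (along paths) as a polynomial in \<open>h t\<close>. It remains in
  the complexified Lie algebra, this being a linear condition. For real \<open>t\<close> such a logarithm \<open>Z\<close> commutes
  with its conjugate, which is a logarithm of \<open>h t\<close> too. So \<open>(h t)\<^sup>2 = exp (Z + cnj Z)\<close>, and \<open>Z + cnj Z\<close>
  is in the real Lie algebra. Let \<open>t\<close> tend to 1.
\<close>

section \<open>The exponential in Banach algebras\<close>

text \<open>A square cannot be avoided by this route: the complex logarithm \<open>Z\<close> is only
  known to lie in the complexified Lie algebra, and passing to twice its real part doubles the
  exponent. That \<open>Z\<close> commutes with its conjugate rests on its being a polynomial in
  \<open>h t\<close>; with repeated eigenvalues other logarithms exist. So \<open>Z\<close> is built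
  by interpolation at the eigenvalues, whose coefficients have poles where eigenvalues collide.
  These collisions lie among the zeros of one entire function, hence leave a connected part of the
  plane, whereas a real path could not go round them. Continuation may be multivalued; therefore
  only the existence of a germ is propagated, never a branch. The other obstacle lies in
  \<open>G\<close>: \<open>\<rho>\<close> is just an injective smooth homomorphism, its image may
  fail to be closed, and its differential is not known to be injective. Exponentials are therefore
  first produced inside a chart of \<open>G\<close>, as limits of powers. The injectivity of the
  differential and the one-parameter subgroups of \<open>G\<close> are deduced from them.\<close>

lemma norm_power_diff_le:
  fixes a b :: "'a::real_normed_algebra_1"
  assumes "norm a \<le> M" "norm b \<le> M"
  shows "norm (a ^ k - b ^ k) \<le> real k * M ^ (k - 1) * norm (a - b)"
proof (induction k)
  case (Suc k)
  have M: "0 \<le> M"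
    using assms(1) norm_ge_zero order_trans by blast
  have "a ^ Suc k - b ^ Suc k = a * (a ^ k - b ^ k) + (a - b) * b ^ k"
    by (simp add: algebra_simps)
  then have "norm (a ^ Suc k - b ^ Suc k) \<le> norm a * norm (a ^ k - b ^ k) + norm (a - b) * norm (b ^ k)"
    by (metis (no_types) norm_triangle_mono norm_mult_ineq)
  also have "\<dots> \<le> M * (real k * M ^ (k - 1) * norm (a - b)) + norm (a - b) * M ^ k"
    using Suc assms M norm_power_ineq[of b k] power_mono[OF assms(2) norm_ge_zero, of k]
    by (intro add_mono mult_mono) auto
  also have "\<dots> = real (Suc k) * M ^ (Suc k - 1) * norm (a - b)"
    by (cases k) (auto simp: algebra_simps)
  finally show ?case .
qed auto

text \<open>In degrees 0 and 1 the series cancels; in degree \<open>k\<close> the preceding bound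
  contributes \<open>R ^ (k - 1) / fact (k - 1)\<close> times \<open>norm (P - Q)\<close>, and these
  factors add up to \<open>exp R - 1\<close>. So near 0 the map \<open>exp\<close> differs from the
  identity by a Lipschitz map with small constant.\<close>

lemma norm_exp_diff_le:
  fixes P Q :: "'a::{real_normed_algebra_1,banach}"
  assumes "norm P \<le> R" "norm Q \<le> R"
  shows "norm (exp P - exp Q - (P - Q)) \<le> (exp R - 1) * norm (P - Q)"
proof -
  define t where "t = (\<lambda>k. (P ^ k - Q ^ k) /\<^sub>R fact k)"
  define u where "u = (\<lambda>k. R ^ k /\<^sub>R fact k)"
  have "t sums (exp P - exp Q)"
    unfolding t_def scaleR_diff_right exp_def by (intro sums_diff summable_sums summable_exp_generic)
  then have t2: "(\<lambda>k. t (k + 2)) sums (exp P - exp Q - (P - Q))"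
    using sums_iff_shift'[of t 2] by (simp add: t_def numeral_2_eq_2)
  have "u sums exp R"
    unfolding u_def exp_def by (intro summable_sums summable_exp_generic)
  then have u1: "(\<lambda>k. u (k + 1) * norm (P - Q)) sums ((exp R - 1) * norm (P - Q))"
    using sums_iff_shift'[of u 1] by (intro sums_mult2) (simp add: u_def)
  have "norm (t (k + 2)) \<le> u (k + 1) * norm (P - Q)" for k
  proof -
    have "norm (t (k + 2)) = norm (P ^ (k + 2) - Q ^ (k + 2)) / fact (k + 2)"
      by (simp add: t_def divide_inverse mult.commute)
    also have "\<dots> \<le> (real (k + 2) * R ^ (k + 2 - 1) * norm (P - Q)) / fact (k + 2)"
      by (intro divide_right_mono norm_power_diff_le assms) auto
    also have "\<dots> = u (k + 1) * norm (P - Q)"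
      unfolding u_def by (simp add: divide_simps del: of_nat_Suc)
    finally show ?thesis .
  qed
  then show ?thesis
    using t2 u1 suminf_le summable_norm
    by (metis (no_types, lifting) norm_suminf_le sums_iff)
qed

lemma norm_exp_minus_one_le:
  fixes D :: "'a::{real_normed_algebra_1,banach}"
  shows "norm (exp D - 1 - D) \<le> (exp (norm D) - 1) * norm D"
  using norm_exp_diff_le[of D "norm D" 0] by simp

text \<open>Here \<open>exp D - 1 - D\<close> is \<open>- D\<close>, while its norm is at most
  \<open>exp (1/2) - 1 < 1\<close> times that of \<open>D\<close>. This makes commuting logarithms
  locally unique.\<close>

lemma exp_eq_one_small:
  fixes D :: "'a::{real_normed_algebra_1,banach}"
  assumes "exp D = 1" "norm D \<le> 1/2"
  shows "D = 0"
proof (rule ccontr)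
  assume "D \<noteq> 0"
  have "exp (norm D) - 1 < (1::real)"
  proof -
    have "exp (norm D) \<le> exp (1/2::real)"
      using assms by simp
    also have "exp (1/2::real) < 2"
      using exp_bound_half[of "1/2::real"] exp_bound[of "1/2::real"] by (simp add: power2_eq_square)
    finally show ?thesis by simp
  qed
  then have "(exp (norm D) - 1) * norm D < norm D"
    using \<open>D \<noteq> 0\<close> by simp
  with norm_exp_minus_one_le[of D] assms(1) show False by simp
qed

text \<open>With \<open>k\<close> the nilpotency index, multiplying \<open>exp D = 1\<close> by
  \<open>D ^ (k - 2)\<close> leaves only two terms of the series and yields
  \<open>D ^ (k - 1) = 0\<close>.\<close>

lemma exp_eq_one_nilpotent:
  fixes D :: "'a::{real_normed_algebra_1,banach}"
  assumes "exp D = 1" "D ^ m = 0"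
  shows "D = 0"
proof (rule ccontr)
  assume D: "D \<noteq> 0"
  define k where "k = (LEAST k. D ^ k = 0)"
  have k0: "D ^ k = 0"
    unfolding k_def using assms(2) by (rule LeastI)
  have min: "D ^ j \<noteq> 0" if "j < k" for j
    using not_less_Least that unfolding k_def by blast
  have "k \<noteq> 0" "k \<noteq> 1"
    using k0 D by (metis power_0 zero_neq_one, metis power_one_right)
  then obtain j where j: "k = j + 2"
    by (metis One_nat_def add_2_eq_Suc' not0_implies_Suc)
  have z: "D ^ j * (D ^ i /\<^sub>R fact i) = 0" if "i \<ge> 2" for i
  proof -
    have "j + i = k + (i - 2)"
      using that j by simp
    then have "D ^ j * D ^ i = D ^ k * D ^ (i - 2)"
      by (metis power_add)
    then show ?thesis using k0 by simp
  qed
  have "(\<lambda>i. D ^ j * (D ^ i /\<^sub>R fact i)) sums (D ^ j * exp D)"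
    unfolding exp_def by (intro sums_mult summable_sums summable_exp_generic)
  moreover have "(\<lambda>i. D ^ j * (D ^ i /\<^sub>R fact i)) sums (\<Sum>i<2. D ^ j * (D ^ i /\<^sub>R fact i))"
    using z by (intro sums_finite) auto
  ultimately have "D ^ j * exp D = (\<Sum>i<2. D ^ j * (D ^ i /\<^sub>R fact i))"
    by (rule sums_unique2)
  also have "\<dots> = D ^ j + D ^ Suc j"
    by (simp add: numeral_2_eq_2 power_commutes)
  finally show False
    using assms(1) min[of "Suc j"] j by simp
qed

lemma exp_commute:
  fixes A B :: "'a::{real_normed_algebra_1,banach}"
  assumes "A * B = B * A"
  shows "exp A * B = B * exp A"
proof -
  have c: "A ^ k * B = B * A ^ k" for k
    by (induction k) (auto simp: mult.assoc assms, metis assms mult.assoc)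
  have "(\<lambda>k. (A ^ k /\<^sub>R fact k) * B) sums (exp A * B)"
    unfolding exp_def by (intro sums_mult2 summable_sums summable_exp_generic)
  moreover have "(\<lambda>k. B * (A ^ k /\<^sub>R fact k)) sums (B * exp A)"
    unfolding exp_def by (intro sums_mult summable_sums summable_exp_generic)
  ultimately show ?thesis
    by (simp add: c sums_unique2)
qed

lemma exp_minus_right:
  fixes D :: "'a::{real_normed_algebra_1,banach}"
  shows "exp D * exp (- D) = 1"
  using exp_add_commuting[of D "- D"] by simp

lemma exp_diff_eq_one:
  fixes A B :: "'a::{real_normed_algebra_1,banach}"
  assumes "A * B = B * A" "exp A = exp B"
  shows "exp (A - B) = 1"
  using exp_add_commuting[of A "- B"] exp_minus_right[of B] assms by simp

lemma exp_commuting_has_vector_derivative: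
  fixes g :: "real \<Rightarrow> 'a::{real_normed_algebra_1,banach}"
  assumes "(g has_vector_derivative g') (at s)" and comm: "\<And>x y. g x * g y = g y * g x"
  shows "((\<lambda>s. exp (g s)) has_vector_derivative exp (g s) * g') (at s)"
proof -
  \<comment> \<open>The derivative at 0 suffices, as commuting values allow \<open>exp (g t)\<close>
    to be factored as \<open>exp (g s) * exp (g t - g s)\<close>.\<close>
  have d0: "((\<lambda>h. exp h) has_derivative (\<lambda>h. h)) (at (0::'a))"
    unfolding has_derivative_at_within
  proof (intro conjI, simp)
    have lim: "((\<lambda>y::'a. exp (norm y) - 1) \<longlongrightarrow> 0) (at 0)"
      by (rule tendsto_eq_intros refl | simp)+
    show "((\<lambda>y. ((exp y - exp 0) - (y - 0)) /\<^sub>R norm (y - 0)) \<longlongrightarrow> 0) (at (0::'a))"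
    proof (rule Lim_null_comparison[OF _ lim])
      have "norm ((exp y - exp 0 - (y - 0)) /\<^sub>R norm (y - 0)) \<le> exp (norm y) - 1" if "y \<noteq> 0" for y :: 'a
      proof -
        have "norm ((exp y - exp 0 - (y - 0)) /\<^sub>R norm (y - 0)) = norm (exp y - 1 - y) / norm y"
          by (simp add: divide_inverse mult.commute)
        also have "\<dots> \<le> (exp (norm y) - 1) * norm y / norm y"
          by (intro divide_right_mono norm_exp_minus_one_le) auto
        finally show ?thesis using that by simp
      qed
      then show "\<forall>\<^sub>F y in at (0::'a). norm ((exp y - exp 0 - (y - 0)) /\<^sub>R norm (y - 0)) \<le> exp (norm y) - 1"
        by (intro eventually_at_topological[THEN iffD2] exI[of _ UNIV]) auto
    qed
  qed
  have "((\<lambda>t. g t - g s) has_derivative (\<lambda>h. h *\<^sub>R g')) (at s)"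
    using assms(1) unfolding has_vector_derivative_def by (auto intro!: derivative_eq_intros)
  then have "((\<lambda>t. exp (g t - g s)) has_derivative (\<lambda>h. h *\<^sub>R g')) (at s)"
    using has_derivative_compose[of "\<lambda>t. g t - g s" _ s UNIV exp "\<lambda>h. h"] d0 by simp
  then have "((\<lambda>t. exp (g s) * exp (g t - g s)) has_vector_derivative exp (g s) * g') (at s)"
    unfolding has_vector_derivative_def by (auto intro!: derivative_eq_intros)
  moreover have "exp (g s) * exp (g t - g s) = exp (g t)" for t
    using exp_add_commuting[of "g s" "g t - g s"] comm by (simp add: algebra_simps)
  ultimately show ?thesis by simp
qed

lemma exp_scaleR_nat:
  fixes X :: "'a::{real_normed_algebra_1,banach}"
  shows "exp (real k *\<^sub>R X) = exp X ^ k"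
proof (induction k)
  case (Suc k)
  have "exp (X + real k *\<^sub>R X) = exp X * exp (real k *\<^sub>R X)"
    by (rule exp_add_commuting) simp
  with Suc show ?case by (simp add: algebra_simps)
qed simp

text \<open>\<open>a k\<close> is compared with \<open>exp (X /\<^sub>R real k)\<close>, whose k-th
  power is \<open>exp X\<close>. Both have norm at most \<open>exp (K / real k)\<close>, so taking
  k-th powers multiplies their distance, which is o(1/k), by at most
  \<open>real k * exp K\<close>.\<close>

lemma power_tendsto_exp:
  fixes a :: "nat \<Rightarrow> 'a::{real_normed_algebra_1,banach}"
  assumes "(\<lambda>k. real k *\<^sub>R (a k - 1)) \<longlonglongrightarrow> X"
  shows "(\<lambda>k. a k ^ k) \<longlonglongrightarrow> exp X"
proof -
  obtain C where C: "C > 0" "\<And>k. norm (real k *\<^sub>R (a k - 1)) \<le> C"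
    using convergent_imp_Bseq[OF convergentI[OF assms]] by (auto simp: Bseq_def)
  define K where "K = max C (norm X)"
  have a: "norm (a k) \<le> exp (K / real k)" if "k > 0" for k
  proof -
    have "norm (a k) \<le> 1 + norm (a k - 1)"
      by (metis diff_add_cancel add.commute norm_one norm_triangle_ineq)
    also have "norm (a k - 1) \<le> K / real k"
    proof -
      have "real k * norm (a k - 1) \<le> K"
        using C(2)[of k] unfolding K_def by (metis norm_scaleR abs_of_nat max.coboundedI1)
      then show ?thesis using that by (simp add: field_simps)
    qed
    finally show ?thesis
      using exp_ge_add_one_self[of "K / real k"] by linarith
  qed
  have b: "norm (exp (X /\<^sub>R real k)) \<le> exp (K / real k)" if "k > 0" for k
  proof -
    have "norm (exp (X /\<^sub>R real k)) \<le> exp (norm (X /\<^sub>R real k))"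
      by (rule norm_exp)
    also have "\<dots> \<le> exp (K / real k)"
      using that by (simp add: K_def field_simps)
    finally show ?thesis .
  qed
  have "(\<lambda>k. a k ^ k - exp X) \<longlonglongrightarrow> 0"
  proof (rule Lim_null_comparison)
    show "\<forall>\<^sub>F k in sequentially. norm (a k ^ k - exp X)
        \<le> exp K * (norm (real k *\<^sub>R (a k - 1) - X) + (exp (norm X / real k) - 1) * norm X)"
      using eventually_gt_at_top[of 0]
    proof eventually_elim
      fix k :: nat assume k: "k > 0"
      have "exp X = exp (X /\<^sub>R real k) ^ k"
        using exp_scaleR_nat[of k "X /\<^sub>R real k"] k by simp
      then have "norm (a k ^ k - exp X) \<le> real k * exp (K / real k) ^ (k - 1) * norm (a k - exp (X /\<^sub>R real k))"
        using norm_power_diff_le[OF a[OF k] b[OF k]] by simp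
      also have "\<dots> \<le> real k * exp K * norm (a k - exp (X /\<^sub>R real k))"
      proof -
        have "exp (K / real k) ^ (k - 1) \<le> exp (K / real k) ^ k"
          using C(1) by (intro power_increasing) (auto simp: K_def)
        also have "\<dots> = exp K"
          using k by (simp flip: exp_of_nat_mult)
        finally show ?thesis
          by (intro mult_right_mono mult_left_mono) auto
      qed
      also have "real k * exp K * norm (a k - exp (X /\<^sub>R real k)) =
          exp K * norm (real k *\<^sub>R (a k - 1) - X - real k *\<^sub>R (exp (X /\<^sub>R real k) - 1 - X /\<^sub>R real k))"
      proof -
        have "real k *\<^sub>R (a k - 1) - X - real k *\<^sub>R (exp (X /\<^sub>R real k) - 1 - X /\<^sub>R real k)
            = real k *\<^sub>R (a k - exp (X /\<^sub>R real k))"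
          using k by (simp add: algebra_simps)
        then show ?thesis by simp
      qed
      also have "\<dots> \<le> exp K * (norm (real k *\<^sub>R (a k - 1) - X) + (exp (norm X / real k) - 1) * norm X)"
      proof (intro mult_left_mono order_trans[OF norm_triangle_ineq4] add_left_mono)
        have "norm (exp (X /\<^sub>R real k) - 1 - X /\<^sub>R real k) \<le> (exp (norm X / real k) - 1) * (norm X / real k)"
          using norm_exp_minus_one_le[of "X /\<^sub>R real k"] by (simp add: divide_inverse mult.commute)
        then have "real k * norm (exp (X /\<^sub>R real k) - 1 - X /\<^sub>R real k)
            \<le> real k * ((exp (norm X / real k) - 1) * (norm X / real k))"
          by (rule mult_left_mono) simp
        then show "norm (real k *\<^sub>R (exp (X /\<^sub>R real k) - 1 - X /\<^sub>R real k)) \<le> (exp (norm X / real k) - 1) * norm X"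
          using k by simp
      qed auto
      finally show "norm (a k ^ k - exp X)
        \<le> exp K * (norm (real k *\<^sub>R (a k - 1) - X) + (exp (norm X / real k) - 1) * norm X)" .
    qed
    have "(\<lambda>k. norm X / real k) \<longlonglongrightarrow> 0"
      by (rule lim_const_over_n)
    then have "(\<lambda>k. exp K * (norm (real k *\<^sub>R (a k - 1) - X) + (exp (norm X / real k) - 1) * norm X))
        \<longlonglongrightarrow> exp K * (norm (X - X) + (exp 0 - 1) * norm X)"
      by (intro tendsto_intros assms)
    then show "(\<lambda>k. exp K * (norm (real k *\<^sub>R (a k - 1) - X) + (exp (norm X / real k) - 1) * norm X))
        \<longlonglongrightarrow> 0"
      by simp
  qed
  then show ?thesis by (simp add: LIM_zero_iff)
qed

section \<open>Complex matrices as a Banach algebra\<close>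

text \<open>A copy of the matrix type on which \<open>*\<close> is the matrix product and the norm
  is the operator norm, so that \<open>norm 1 = 1\<close>. It becomes a Banach algebra to which the
  results on \<open>exp\<close> apply.\<close>

typedef 'n cmat = "UNIV :: (complex^'n^'n::finite) set"
  morphisms mat_of Cmat ..

lemmas mat_of_Cmat [simp] = Cmat_inverse[OF UNIV_I]
declare mat_of_inverse [simp]

lemma cmat_eqI: "mat_of A = mat_of B \<Longrightarrow> A = B"
  by (simp add: mat_of_inject)

lemma bounded_linear_matvec: "bounded_linear (\<lambda>v. (A :: complex^'n^'n) *v v)"
  by (rule matrix_vector_mul_bounded_linear)

lemma onorm_matrix_le:
  fixes A :: "complex^'n^'n"
  shows "onorm (\<lambda>v. A *v v) \<le> (\<Sum>i\<in>UNIV. \<Sum>j\<in>UNIV. norm (A $ i $ j))"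
proof (rule onorm_bound)
  fix v :: "complex^'n"
  have "norm (A *v v) \<le> (\<Sum>i\<in>UNIV. norm ((A *v v) $ i))"
    unfolding norm_vec_def by (rule L2_set_le_sum) simp
  also have "\<dots> \<le> (\<Sum>i\<in>UNIV. \<Sum>j\<in>UNIV. norm (A $ i $ j) * norm v)"
    unfolding matrix_vector_mult_def
    by (auto intro!: sum_mono order_trans[OF norm_sum] mult_left_mono Finite_Cartesian_Product.norm_nth_le simp: norm_mult)
  finally show "norm (A *v v) \<le> (\<Sum>i\<in>UNIV. \<Sum>j\<in>UNIV. norm (A $ i $ j)) * norm v"
    by (simp add: sum_distrib_right)
qed (auto intro!: sum_nonneg)

lemma norm_entry_le_onorm:
  fixes A :: "complex^'n^'n"
  shows "norm (A $ i $ j) \<le> onorm (\<lambda>v. A *v v)"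
proof -
  have "A $ i $ j = (A *v axis j 1) $ i"
    by (simp add: matrix_vector_mult_def axis_def if_distrib cong: if_cong)
  also have "norm \<dots> \<le> norm (A *v axis j 1)"
    by (rule Finite_Cartesian_Product.norm_nth_le)
  also have "\<dots> \<le> onorm (\<lambda>v. A *v v) * norm (axis j (1::complex))"
    by (rule onorm[OF bounded_linear_matvec])
  finally show ?thesis by simp
qed

lemma matrix_add_rdistrib_cmat: "((A :: complex^'n^'n) + B) ** C = A ** C + B ** C"
  by (simp add: matrix_matrix_mult_def vec_eq_iff sum.distrib distrib_right)

instantiation cmat :: (finite) real_normed_algebra_1
begin

definition "0 = Cmat 0"
definition "1 = Cmat (mat 1)"
definition "A + B = Cmat (mat_of A + mat_of B)"
definition "A - B = Cmat (mat_of A - mat_of B)"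
definition "- A = Cmat (- mat_of A)"
definition "A * B = Cmat (mat_of A ** mat_of B)"
definition "c *\<^sub>R A = Cmat (c *\<^sub>R mat_of A)"
definition norm_cmat :: "'a cmat \<Rightarrow> real" where "norm A = onorm (\<lambda>v. mat_of A *v v)"
definition "dist (A :: 'a cmat) B = norm (A - B)"
definition "sgn (A :: 'a cmat) = inverse (norm A) *\<^sub>R A"
definition "(uniformity :: ('a cmat \<times> 'a cmat) filter) = (INF e\<in>{0<..}. principal {(x, y). dist x y < e})"
definition "open (U :: 'a cmat set) \<longleftrightarrow> (\<forall>x\<in>U. \<forall>\<^sub>F (x', y) in uniformity. x' = x \<longrightarrow> y \<in> U)"

lemma mat_of_simps:
  "mat_of (0 :: 'a cmat) = 0" "mat_of (1 :: 'a cmat) = mat 1" "mat_of (A + B) = mat_of A + mat_of B"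
  "mat_of (A - B) = mat_of A - mat_of B" "mat_of (- A) = - mat_of A"
  "mat_of (A * B) = mat_of A ** mat_of B" "mat_of (c *\<^sub>R A) = c *\<^sub>R mat_of A"
  by (simp_all add: zero_cmat_def one_cmat_def plus_cmat_def minus_cmat_def uminus_cmat_def
      times_cmat_def scaleR_cmat_def)

instance
proof
  fix A B C :: "'a cmat" and a b :: real
  have sc: "(c *\<^sub>R M) *v v = c *\<^sub>R (M *v v)" for c and M :: "complex^'a^'a" and v
    by (simp add: vec_eq_iff matrix_vector_mult_def scaleR_sum_right)
  show "A * B * C = A * (B * C)" "1 * A = A" "A * 1 = A"
    "(A + B) * C = A * C + B * C" "A * (B + C) = A * B + A * C"
    by (simp_all add: mat_of_inject[symmetric] mat_of_simps matrix_mul_assoc matrix_add_ldistrib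
        matrix_add_rdistrib_cmat)
  show "(a *\<^sub>R A) * B = a *\<^sub>R (A * B)" "A * (a *\<^sub>R B) = a *\<^sub>R (A * B)"
    by (auto intro!: cmat_eqI simp: mat_of_simps matrix_matrix_mult_def vec_eq_iff scaleR_sum_right)
  show "(0::'a cmat) \<noteq> 1"
    by (auto simp: mat_of_inject[symmetric] mat_of_simps vec_eq_iff mat_def)
  show "norm (A * B) \<le> norm A * norm B"
    using onorm_compose[OF bounded_linear_matvec bounded_linear_matvec, of "mat_of A" "mat_of B"]
    by (simp add: norm_cmat_def mat_of_simps o_def matrix_vector_mul_assoc)
  show "norm (1 :: 'a cmat) = 1"
    using onorm_id[where 'a = "complex^'a"] by (simp add: norm_cmat_def mat_of_simps id_def)
  show "norm (A + B) \<le> norm A + norm B"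
    using onorm_triangle[OF bounded_linear_matvec bounded_linear_matvec, of "mat_of A" "mat_of B"]
    by (simp add: norm_cmat_def mat_of_simps matrix_vector_mult_add_rdistrib)
  show "norm (a *\<^sub>R A) = \<bar>a\<bar> * norm A"
    using onorm_scaleR[OF bounded_linear_matvec, of a "mat_of A"]
    by (simp add: norm_cmat_def mat_of_simps sc)
  show "norm A = 0 \<longleftrightarrow> A = 0"
  proof
    assume "norm A = 0"
    then have "norm (mat_of A $ i $ j) \<le> 0" for i j
      using norm_entry_le_onorm[of "mat_of A" i j] by (simp add: norm_cmat_def)
    then show "A = 0"
      by (intro cmat_eqI) (simp add: vec_eq_iff mat_of_simps)
  next
    assume "A = 0"
    then show "norm A = 0"
      using onorm_zero[where 'a = "complex^'a" and 'b = "complex^'a"]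
      by (simp add: norm_cmat_def mat_of_simps)
  qed
qed (auto intro!: cmat_eqI simp: mat_of_simps algebra_simps dist_cmat_def sgn_cmat_def
    uniformity_cmat_def open_cmat_def)

end

definition entry :: "'n \<Rightarrow> 'n \<Rightarrow> 'n::finite cmat \<Rightarrow> complex" where
  "entry i j A = mat_of A $ i $ j"

lemma norm_entry_le: "norm (entry i j A) \<le> norm A"
  by (simp add: entry_def norm_cmat_def norm_entry_le_onorm)

lemma norm_cmat_le: "norm A \<le> (\<Sum>i\<in>UNIV. \<Sum>j\<in>UNIV. norm (entry i j A))"
  by (simp add: entry_def norm_cmat_def onorm_matrix_le)

lemma cmat_eq_iff: "A = B \<longleftrightarrow> (\<forall>i j. entry i j A = entry i j B)"
  by (auto simp: entry_def mat_of_inject[symmetric] vec_eq_iff)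

lemma entry_simps [simp]:
  "entry i j 0 = 0" "entry i j 1 = (if i = j then 1 else 0)" "entry i j (A + B) = entry i j A + entry i j B"
  "entry i j (A - B) = entry i j A - entry i j B" "entry i j (- A) = - entry i j A"
  "entry i j (c *\<^sub>R A) = of_real c * entry i j A"
  by (auto simp: entry_def mat_of_simps mat_def) (simp add: scaleR_conv_of_real)

lemma entry_mult: "entry i j (A * B) = (\<Sum>k\<in>UNIV. entry i k A * entry k j B)"
  by (simp add: entry_def mat_of_simps matrix_matrix_mult_def)

lemma entry_Cmat [simp]: "entry i j (Cmat M) = M $ i $ j"
  by (simp add: entry_def)

lemma bounded_linear_entry: "bounded_linear (entry i j)"
  by (rule bounded_linear_intro[where K = 1]) (simp_all add: norm_entry_le scaleR_conv_of_real[where 'a = complex])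

lemma entry_sum [simp]: "entry i j (sum f S) = (\<Sum>x\<in>S. entry i j (f x))"
  by (rule linear_sum[OF bounded_linear.linear[OF bounded_linear_entry]])

lemma tendsto_cmat_iff: "(f \<longlongrightarrow> A) F \<longleftrightarrow> (\<forall>i j. ((\<lambda>x. entry i j (f x)) \<longlongrightarrow> entry i j A) F)"
proof safe
  assume "\<forall>i j. ((\<lambda>x. entry i j (f x)) \<longlongrightarrow> entry i j A) F"
  then have "((\<lambda>x. \<Sum>i\<in>UNIV. \<Sum>j\<in>UNIV. norm (entry i j (f x) - entry i j A))
      \<longlongrightarrow> (\<Sum>i\<in>UNIV. \<Sum>j\<in>UNIV. norm (entry i j A - entry i j A))) F"
    by (intro tendsto_intros) auto
  then have "((\<lambda>x. \<Sum>i\<in>UNIV. \<Sum>j\<in>UNIV. norm (entry i j (f x) - entry i j A)) \<longlongrightarrow> 0) F"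
    by simp
  then have "((\<lambda>x. f x - A) \<longlongrightarrow> 0) F"
    by (rule Lim_null_comparison[rotated]) (use norm_cmat_le[of "f _ - A"] in auto)
  then show "(f \<longlongrightarrow> A) F"
    by (simp add: LIM_zero_iff)
qed (rule bounded_linear.tendsto[OF bounded_linear_entry])

instance cmat :: (finite) banach
proof
  fix X :: "nat \<Rightarrow> 'a cmat" assume X: "Cauchy X"
  have "convergent (\<lambda>k. entry i j (X k))" for i j
    using bounded_linear.Cauchy[OF bounded_linear_entry X] by (rule Cauchy_convergent)
  then obtain L where L: "\<And>i j. (\<lambda>k. entry i j (X k)) \<longlonglongrightarrow> L i j"
    unfolding convergent_def by metis
  have "X \<longlonglongrightarrow> Cmat (\<chi> i j. L i j)"
    unfolding tendsto_cmat_iff using L by simp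
  then show "convergent X" by (rule convergentI)
qed

definition app :: "'n::finite cmat \<Rightarrow> complex^'n \<Rightarrow> complex^'n" where
  "app A v = mat_of A *v v"

lemma app_simps [simp]:
  "app 0 v = 0" "app 1 v = v" "app (A + B) v = app A v + app B v" "app (A - B) v = app A v - app B v"
  "app (c *\<^sub>R A) v = c *\<^sub>R app A v" "app A 0 = 0"
  by (simp_all add: app_def mat_of_simps matrix_vector_mult_add_rdistrib matrix_vector_mult_diff_rdistrib)
    (simp add: vec_eq_iff matrix_vector_mult_def scaleR_sum_right)

lemma app_mult: "app (A * B) v = app A (app B v)"
  by (simp add: app_def mat_of_simps matrix_vector_mul_assoc)

lemma app_scale: "app A (c *s v) = c *s app A v"
  by (simp add: app_def vector_scalar_commute)

lemma norm_app_le: "norm (app A v) \<le> norm A * norm v"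
  unfolding app_def norm_cmat_def by (rule onorm[OF bounded_linear_matvec])

lemma bounded_linear_app: "bounded_linear (\<lambda>A. app A v)"
  by (rule bounded_linear_intro[where K = "norm v"]) (auto simp: norm_app_le)

lemma cmat_eq_iff_app: "A = B \<longleftrightarrow> (\<forall>v. app A v = app B v)"
  by (metis app_def cmat_eqI matrix_eq)

text \<open>Scalar matrices stand for multiplication by complex numbers, since \<open>cmat\<close>
  is made an algebra over the reals only.\<close>

definition smat :: "complex \<Rightarrow> 'n::finite cmat" where
  "smat c = Cmat (mat c)"

lemma entry_smat [simp]: "entry i j (smat c) = (if i = j then c else 0)"
  by (simp add: smat_def mat_def)

lemma entry_smat_mult [simp]: "entry i j (smat c * A) = c * entry i j A"
  by (simp add: entry_mult if_distribR if_distrib[of "\<lambda>x. x * _"] cong: if_cong)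

lemma entry_mult_smat [simp]: "entry i j (A * smat c) = entry i j A * c"
  by (simp add: entry_mult if_distrib[of "\<lambda>x. _ * x"] cong: if_cong)

lemma smat_commute: "smat c * A = A * smat c"
  by (auto simp: cmat_eq_iff)

lemma smat_simps [simp]:
  "smat 0 = 0" "smat 1 = 1"
  by (auto simp: cmat_eq_iff)

lemma smat_add: "smat (a + b) = smat a + smat b" and smat_diff: "smat (a - b) = smat a - smat b"
  and smat_minus: "smat (- a) = - smat a"
  by (auto simp: cmat_eq_iff)

lemma smat_mult: "smat (a * b) = smat a * smat b"
  by (auto simp: cmat_eq_iff)

lemma smat_of_real: "smat (of_real r) = r *\<^sub>R 1"
  by (auto simp: cmat_eq_iff)

lemma app_smat [simp]: "app (smat c) v = c *s v"
  by (simp add: app_def smat_def vec_eq_iff matrix_vector_mult_def mat_def if_distrib[of "\<lambda>x. x * _"] cong: if_cong)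

lemma bounded_linear_smat: "bounded_linear (smat :: complex \<Rightarrow> 'n::finite cmat)"
proof (rule bounded_linear_intro)
  fix x :: complex
  have "norm (smat x :: 'n cmat) \<le> norm x"
    unfolding norm_cmat_def
  proof (rule onorm_bound)
    fix v :: "complex^'n"
    have "norm (mat_of (smat x) *v v) = norm (x *s v)"
      by (metis app_smat app_def)
    also have "\<dots> \<le> norm x * norm v"
      unfolding norm_vec_def vector_smult_component norm_mult L2_set_right_distrib[OF norm_ge_zero] ..
    finally show "norm (mat_of (smat x) *v v) \<le> norm x * norm v" .
  qed auto
  then show "norm (smat x :: 'n cmat) \<le> norm x * 1" by simp
qed (auto simp: smat_add cmat_eq_iff scaleR_conv_of_real[where 'a = complex])

lemma smat_power: "smat c ^ k = smat (c ^ k)"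
  by (induction k) (auto simp: smat_mult)

lemma exp_smat: "exp (smat c) = smat (exp c)"
proof -
  have "(\<lambda>k. smat (c ^ k /\<^sub>R fact k) :: 'a cmat) sums smat (exp c)"
    unfolding exp_def
    by (intro bounded_linear.sums[OF bounded_linear_smat] summable_sums summable_exp_generic)
  moreover have "(\<lambda>k. smat (c ^ k /\<^sub>R fact k) :: 'a cmat) = (\<lambda>k. smat c ^ k /\<^sub>R fact k)"
    by (simp add: smat_power cmat_eq_iff scaleR_conv_of_real[where 'a = complex] fun_eq_iff)
  ultimately show ?thesis
    unfolding exp_def by (simp add: sums_iff)
qed

lemma exp_eigenvector:
  assumes "app Z v = \<zeta> *s v"
  shows "app (exp Z) v = exp \<zeta> *s v"
proof -
  have p: "app (Z ^ k) v = \<zeta> ^ k *s v" for k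
    by (induction k) (auto simp: app_mult assms app_scale vector_smult_assoc mult.commute)
  have "(\<lambda>k. app (Z ^ k /\<^sub>R fact k) v) sums app (exp Z) v"
    unfolding exp_def
    by (intro bounded_linear.sums[OF bounded_linear_app] summable_sums summable_exp_generic)
  moreover have "(\<lambda>k. app (smat (\<zeta>) ^ k /\<^sub>R fact k) v) sums app (exp (smat \<zeta>)) v"
    unfolding exp_def
    by (intro bounded_linear.sums[OF bounded_linear_app] summable_sums summable_exp_generic)
  ultimately show ?thesis
    by (simp add: p exp_smat smat_power sums_iff)
qed

lemma eigenvalue_norm_le:
  assumes "app A v = c *s v" "v \<noteq> 0"
  shows "norm c \<le> norm A"
proof -
  have "norm c * norm v = norm (c *s v)"
    unfolding norm_vec_def vector_smult_component norm_mult L2_set_right_distrib[OF norm_ge_zero] ..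
  also have "\<dots> \<le> norm A * norm v"
    using norm_app_le[of A v] assms(1) by simp
  finally show ?thesis using assms(2) by simp
qed

definition cnj_mat :: "'n::finite cmat \<Rightarrow> 'n cmat" where
  "cnj_mat A = Cmat (\<chi> i j. cnj (entry i j A))"

lemma entry_cnj_mat [simp]: "entry i j (cnj_mat A) = cnj (entry i j A)"
  by (simp add: cnj_mat_def)

lemma cnj_mat_simps: "cnj_mat (A + B) = cnj_mat A + cnj_mat B" "cnj_mat (A * B) = cnj_mat A * cnj_mat B"
  "cnj_mat (c *\<^sub>R A) = c *\<^sub>R cnj_mat A" "cnj_mat 1 = 1" "cnj_mat (smat z) = smat (cnj z)"
  by (auto simp: cmat_eq_iff entry_mult)

lemma bounded_linear_cnj_mat: "bounded_linear (cnj_mat :: 'n::finite cmat \<Rightarrow> 'n cmat)"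
proof (rule bounded_linear_intro)
  fix A :: "'n cmat"
  have "norm (cnj_mat A) \<le> (\<Sum>i\<in>UNIV. \<Sum>j\<in>UNIV. norm (entry i j A))"
    using norm_cmat_le[of "cnj_mat A"] by simp
  also have "\<dots> \<le> (\<Sum>i\<in>(UNIV::'n set). \<Sum>j\<in>(UNIV::'n set). norm A)"
    by (intro sum_mono norm_entry_le)
  finally show "norm (cnj_mat A) \<le> norm A * (real CARD('n) * real CARD('n))"
    by (simp add: mult_ac)
qed (auto simp: cnj_mat_simps)

lemma cnj_mat_exp: "cnj_mat (exp Z) = exp (cnj_mat Z)"
proof -
  have p: "cnj_mat (Z ^ k) = cnj_mat Z ^ k" for k
    by (induction k) (auto simp: cnj_mat_simps)
  have "(\<lambda>k. cnj_mat (Z ^ k /\<^sub>R fact k)) sums cnj_mat (exp Z)"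
    unfolding exp_def
    by (intro bounded_linear.sums[OF bounded_linear_cnj_mat] summable_sums summable_exp_generic)
  then show ?thesis
    by (simp add: p cnj_mat_simps exp_def sums_iff)
qed

lemma entry_exp_holomorphic: "(\<lambda>z. entry i j (exp (smat z * X))) holomorphic_on UNIV"
proof -
  have p: "(smat z * X) ^ k = smat (z ^ k) * X ^ k" for z k
    by (induction k) (auto simp: smat_mult mult.assoc, metis smat_commute mult.assoc)
  have "(\<lambda>k. entry i j ((smat z * X) ^ k /\<^sub>R fact k)) sums entry i j (exp (smat z * X))" for z
    unfolding exp_def
    by (intro bounded_linear.sums[OF bounded_linear_entry] summable_sums summable_exp_generic)
  then have s: "(\<lambda>k. entry i j (X ^ k /\<^sub>R fact k) * (z - 0) ^ k) sums entry i j (exp (smat z * X))" for z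
    by (simp add: p mult_ac)
  have "(\<lambda>z. entry i j (exp (smat z * X))) holomorphic_on ball 0 r" for r
    by (rule power_series_holomorphic) (rule s)
  then have "(\<lambda>z. entry i j (exp (smat z * X))) field_differentiable (at z)" for z
    by (rule holomorphic_on_imp_differentiable_at[of _ "ball 0 (norm z + 1)"]) auto
  then show ?thesis
    by (simp add: holomorphic_on_def field_differentiable_at_within)
qed

section \<open>Polynomials in a matrix and its eigenvalues\<close>

text \<open>Horner evaluation in the noncommutative algebra of matrices; \<open>poly\<close>
  evaluates in the coefficient ring.\<close>

definition peval :: "complex poly \<Rightarrow> 'n::finite cmat \<Rightarrow> 'n cmat" where
  "peval p A = fold_coeffs (\<lambda>a B. smat a + A * B) p 0"

lemma peval_0 [simp]: "peval 0 A = 0"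
  by (simp add: peval_def)

lemma peval_pCons [simp]: "peval (pCons a p) A = smat a + A * peval p A"
  by (cases "p = 0 \<and> a = 0") (auto simp: peval_def)

lemma peval_1 [simp]: "peval 1 A = 1"
  by (simp add: one_pCons)

lemma peval_add: "peval (p + q) A = peval p A + peval q A"
  by (induction p q rule: poly_induct2) (auto simp: smat_add algebra_simps)

lemma peval_smult: "peval (smult c p) A = smat c * peval p A"
proof (induction p)
  case (pCons a p)
  have "A * (smat c * peval p A) = smat c * (A * peval p A)"
    by (metis smat_commute mult.assoc)
  with pCons show ?case
    by (simp add: smat_mult distrib_left mult.assoc)
qed simp

lemma peval_minus: "peval (- p) A = - peval p A"
  using peval_smult[of "-1" p A] by (simp add: smat_minus)

lemma peval_diff: "peval (p - q) A = peval p A - peval q A"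
  using peval_add[of p "- q" A] by (simp add: peval_minus)

lemma peval_mult: "peval (p * q) A = peval p A * peval q A"
  by (induction p) (simp_all add: peval_add peval_smult distrib_right distrib_left mult.assoc)

lemma peval_power: "peval (p ^ k) A = peval p A ^ k"
  by (induction k) (auto simp: peval_mult)

lemma peval_monom: "peval (monom c k) A = smat c * A ^ k"
proof (induction k)
  case (Suc k)
  have "A * (smat c * A ^ k) = smat c * (A * A ^ k)"
    by (metis smat_commute mult.assoc)
  with Suc show ?case
    by (simp add: monom_Suc)
qed (simp add: monom_0)

lemma peval_sum: "peval (sum f S) A = (\<Sum>x\<in>S. peval (f x) A)"
  by (induction S rule: infinite_finite_induct) (auto simp: peval_add)

lemma peval_commute:
  assumes "A * B = B * A"
  shows "peval p A * B = B * peval p A"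
proof (induction p)
  case (pCons a p)
  have "A * peval p A * B = B * (A * peval p A)"
    by (metis pCons.IH assms mult.assoc)
  then show ?case
    by (simp add: distrib_left distrib_right smat_commute[of a B])
qed simp

lemma peval_commute_peval: "peval p A * peval q A = peval q A * peval p A"
  by (metis peval_mult mult.commute)

lemma peval_dvd_eq_0: "p dvd q \<Longrightarrow> peval p A = 0 \<Longrightarrow> peval q A = 0"
  by (auto simp: dvd_def peval_mult)

lemma peval_eigenvector: "app A v = c *s v \<Longrightarrow> app (peval p A) v = poly p c *s v"
proof (induction p)
  case (pCons a p)
  have "app (peval (pCons a p) A) v = a *s v + poly p c *s (c *s v)"
    using pCons by (simp add: app_mult app_scale)
  then show ?case
    by (simp add: vec_eq_iff distrib_right)
qed (simp add: vec_eq_iff)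

lemma peval_eq_sum:
  assumes "degree p \<le> n"
  shows "peval p A = (\<Sum>k\<le>n. smat (coeff p k) * A ^ k)"
  using assms
proof (induction p arbitrary: n)
  case (pCons a p)
  show ?case
  proof (cases n)
    case 0
    with pCons.prems have "p = 0"
      by (auto split: if_splits)
    with 0 show ?thesis by simp
  next
    case (Suc m)
    have "degree p \<le> m"
      using pCons.prems Suc by (auto split: if_splits)
    have c: "A * (smat x * B) = smat x * (A * B)" for x and B :: "'a cmat"
      by (metis smat_commute mult.assoc)
    from \<open>degree p \<le> m\<close> have "A * peval p A = (\<Sum>k\<le>m. smat (coeff p k) * A ^ Suc k)"
      by (simp add: pCons.IH sum_distrib_left c)
    then show ?thesis
      unfolding Suc by (simp add: sum.atMost_Suc_shift del: sum.atMost_Suc)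
  qed
qed simp

section \<open>Determinant, characteristic polynomial and annihilating polynomials\<close>

definition det_mat :: "'n::finite cmat \<Rightarrow> complex" where
  "det_mat A = det (mat_of A)"

lemma det_mat_mult: "det_mat (A * B) = det_mat A * det_mat B"
  by (simp add: det_mat_def mat_of_simps det_mul)

lemma det_mat_1 [simp]: "det_mat 1 = 1"
  by (simp add: det_mat_def mat_of_simps det_I)

lemma det_mat_eq_0_iff: "det_mat A = 0 \<longleftrightarrow> (\<exists>v. v \<noteq> 0 \<and> app A v = 0)"
proof -
  have "det_mat A \<noteq> 0 \<longleftrightarrow> (\<forall>v. app A v = 0 \<longrightarrow> v = 0)"
    unfolding det_mat_def app_def invertible_det_nz[symmetric] invertible_left_inverse
      matrix_left_invertible_ker ..
  then show ?thesis by blast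
qed

definition charpoly :: "'n::finite cmat \<Rightarrow> complex poly" where
  "charpoly A = det (\<chi> i j. [:- entry i j A, if i = j then 1 else 0:])"

lemma poly_charpoly: "poly (charpoly A) x = det_mat (smat x - A)"
proof -
  have "poly [:- entry i j A, if i = j then 1 else 0:] x = mat_of (smat x - A) $ i $ j" for i j
    unfolding entry_def[symmetric] by simp
  then show ?thesis
    unfolding charpoly_def det_mat_def det_def by (simp add: poly_sum poly_prod del: poly_pCons)
qed

text \<open>In the Leibniz expansion the term of a permutation has degree at most its number of
  fixed points, so only the identity contributes in degree \<open>CARD('n)\<close>.\<close>

lemma degree_charpoly_le: "degree (charpoly A) \<le> CARD('n)" and coeff_charpoly_top: "coeff (charpoly A) CARD('n) = 1"
  for A :: "'n::finite cmat"
proof -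
  define M :: "complex poly^'n^'n" where "M = (\<chi> i j. [:- entry i j A, if i = j then 1 else 0:])"
  define T where "T = (\<lambda>p. of_int (sign p) * (\<Prod>i\<in>UNIV. M $ i $ p i))"
  let ?P = "{p :: 'n \<Rightarrow> 'n. p permutes UNIV}"
  have cpT: "charpoly A = (\<Sum>p\<in>?P. T p)"
    by (simp add: charpoly_def det_def T_def M_def)
  have deg: "degree (T p) \<le> (\<Sum>i\<in>UNIV. if p i = i then 1 else 0)" for p
  proof -
    have "degree (T p) \<le> degree (of_int (sign p) :: complex poly) + degree (\<Prod>i\<in>UNIV. M $ i $ p i)"
      unfolding T_def by (rule degree_mult_le)
    also have "\<dots> = degree (\<Prod>i\<in>UNIV. M $ i $ p i)"
      by simp
    also have "\<dots> \<le> (\<Sum>i\<in>UNIV. (degree \<circ> (\<lambda>i. M $ i $ p i)) i)"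
      by (rule degree_prod_sum_le) simp
    also have "\<dots> \<le> (\<Sum>i\<in>UNIV. if p i = i then 1 else 0)"
      by (intro sum_mono) (auto simp: M_def)
    finally show ?thesis .
  qed
  have "(\<Sum>i\<in>UNIV. if p i = i then 1 else 0 :: nat) \<le> CARD('n)" for p :: "'n \<Rightarrow> 'n"
    using sum_mono[of UNIV "\<lambda>i. if p i = i then 1 else 0 :: nat" "\<lambda>_. 1"] by simp
  then show "degree (charpoly A) \<le> CARD('n)"
    unfolding cpT using deg by (intro degree_sum_le order_trans[OF deg]) (auto simp: finite_permutations)
  have z: "coeff (T p) CARD('n) = 0" if "p \<noteq> id" for p
  proof -
    obtain i where i: "p i \<noteq> i"
      using \<open>p \<noteq> id\<close> by (auto simp: fun_eq_iff)
    have "(\<Sum>i\<in>UNIV. if p i = i then 1 else 0 :: nat) < (\<Sum>i\<in>(UNIV::'n set). 1)"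
      by (rule sum_strict_mono_ex1) (use i in auto)
    then show ?thesis
      using deg[of p] by (intro coeff_eq_0) simp
  qed
  have "coeff (charpoly A) CARD('n) = (\<Sum>p\<in>?P. coeff (T p) CARD('n))"
    by (simp add: cpT coeff_sum)
  also have "\<dots> = coeff (T id) CARD('n)"
    using z by (subst sum.remove[of _ id]) (auto simp: finite_permutations permutes_id)
  also have "T id = (\<Prod>i\<in>UNIV. [:- entry i i A, 1:])"
    by (simp add: T_def M_def)
  also have "coeff \<dots> CARD('n) = 1"
  proof -
    let ?Q = "\<Prod>i\<in>(UNIV::'n set). [:- entry i i A, 1:]"
    have "degree ?Q = CARD('n)"
      by (subst degree_prod_eq_sum_degree) auto
    moreover have "lead_coeff ?Q = 1"
      by (simp add: lead_coeff_prod)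
    ultimately show ?thesis by simp
  qed
  finally show "coeff (charpoly A) CARD('n) = 1" .
qed

lemma degree_charpoly: "degree (charpoly A) = CARD('n)" for A :: "'n::finite cmat"
  by (metis degree_charpoly_le coeff_charpoly_top le_degree le_antisym zero_neq_one)

lemma lead_coeff_charpoly: "lead_coeff (charpoly A) = 1"
  by (simp add: degree_charpoly coeff_charpoly_top)

lemma charpoly_nonzero [simp]: "charpoly A \<noteq> 0"
  using lead_coeff_charpoly[of A] by auto

lemma charpoly_root_iff: "poly (charpoly A) x = 0 \<longleftrightarrow> (\<exists>v. v \<noteq> 0 \<and> app A v = x *s v)"
  unfolding poly_charpoly det_mat_eq_0_iff by auto

text \<open>Induction removes one linear factor \<open>X - \<rho>\<close> from \<open>r\<close> and
  lets \<open>B\<close> absorb it. If \<open>\<rho>\<close> is an eigenvalue, the factor divides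
  \<open>charpoly A\<close>; otherwise \<open>A - \<rho>\<close> is injective and can be
  cancelled.\<close>

lemma peval_charpoly_power_mult_eq_0:
  assumes "r \<noteq> 0" "peval r A * B = 0"
  shows "peval (charpoly A ^ degree r) A * B = 0"
  using assms
proof (induction "degree r" arbitrary: r B)
  case 0
  then obtain c where c: "r = [:c:]" "c \<noteq> 0"
    by (metis degree_eq_zeroE pCons_0_0)
  have "(smat (1 / c) * smat c) * B = smat (1 / c) * (peval r A * B)"
    by (simp add: c mult.assoc)
  also have "smat (1 / c) * smat c = 1"
    using c by (simp flip: smat_mult)
  finally show ?case
    using 0 by (simp add: mult.assoc[symmetric])
next
  case (Suc d)
  obtain \<rho> where "poly r \<rho> = 0"
    using alg_closed_imp_poly_has_root[of r] Suc.hyps(2) by auto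
  then obtain s where s: "r = [:- \<rho>, 1:] * s"
    by (auto simp: poly_eq_0_iff_dvd dvd_def)
  have s0: "s \<noteq> 0"
    using Suc.prems s by auto
  then have ds: "degree r = Suc (degree s)"
    unfolding s by (subst degree_mult_eq) auto
  let ?X = "peval [:- \<rho>, 1:] A" and ?Y = "peval (charpoly A ^ degree s) A * B"
  have "peval s A * (?X * B) = 0"
    using Suc.prems(2) unfolding s peval_mult peval_commute_peval[of "[:- \<rho>, 1:]"] mult.assoc .
  then have "peval (charpoly A ^ degree s) A * (?X * B) = 0"
    using Suc.hyps(1)[of s "?X * B"] Suc.hyps(2) ds s0 by simp
  then have XY: "?X * ?Y = 0"
    unfolding mult.assoc[symmetric] peval_commute_peval[of "[:- \<rho>, 1:]"] .
  have "peval (charpoly A) A * ?Y = 0"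
  proof (cases "poly (charpoly A) \<rho> = 0")
    case True
    then obtain t where "charpoly A = t * [:- \<rho>, 1:]"
      unfolding poly_eq_0_iff_dvd dvd_def by (auto simp: mult.commute)
    then show ?thesis
      using XY by (simp only: peval_mult mult.assoc mult_zero_right)
  next
    case False
    have "app ?Y v = 0" for v
    proof (rule ccontr)
      assume "app ?Y v \<noteq> 0"
      moreover have "app ?X (app ?Y v) = 0"
        using XY by (simp add: app_mult[symmetric])
      then have "app A (app ?Y v) = \<rho> *s app ?Y v"
        by (simp add: vec_eq_iff)
      ultimately show False
        using False charpoly_root_iff by blast
    qed
    then have "?Y = 0"
      by (simp add: cmat_eq_iff_app)
    then show ?thesis by simp
  qed
  then show ?case
    by (simp add: ds peval_mult mult.assoc)
qed

text \<open>A weak form of the Cayley--Hamilton theorem.\<close>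

lemma peval_charpoly_power_eq_0: "peval (charpoly A ^ DIM(complex^'n^'n)) A = 0" for A :: "'n::finite cmat"
proof -
  define N where "N = DIM(complex^'n^'n)"
  \<comment> \<open>\<open>N\<close> is the real dimension of the space of matrices, so the powers
    up to \<open>A ^ N\<close> satisfy a linear relation. A repetition among them is treated apart,
    because \<open>dependent\<close> speaks of the set of powers.\<close>
  obtain r where r: "r \<noteq> 0" "degree r \<le> N" "peval r A = 0"
  proof (cases "inj_on (\<lambda>k. mat_of (A ^ k)) {..N}")
    case False
    then obtain i j where ij: "i \<le> N" "j \<le> N" "i \<noteq> j" "A ^ i = A ^ j"
      by (auto simp: inj_on_def mat_of_inject)
    let ?r = "monom 1 i - monom 1 j :: complex poly"
    have "coeff ?r i = 1"
      using ij(3) by (simp add: if_not_P)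
    then have "?r \<noteq> 0"
      by (metis coeff_0 zero_neq_one)
    moreover have "degree ?r \<le> N"
      using ij by (intro degree_diff_le) (auto simp: degree_monom_eq)
    moreover have "peval ?r A = 0"
      using ij by (simp add: peval_diff peval_monom)
    ultimately show ?thesis using that by blast
  next
    case True
    let ?S = "(\<lambda>k. mat_of (A ^ k)) ` {..N}"
    have "card ?S = Suc N"
      by (subst card_image[OF True]) simp
    then have "card ?S > DIM(complex^'n^'n)"
      unfolding N_def by linarith
    then have "dependent ?S"
      by (rule dependent_biggerset)
    then obtain u w where u: "w \<in> ?S" "u w \<noteq> 0" "(\<Sum>v\<in>?S. u v *\<^sub>R v) = 0"
      using dependent_finite[of ?S] by auto
    define c where "c = (\<lambda>k. u (mat_of (A ^ k)))"
    define r where "r = (\<Sum>k\<le>N. monom (of_real (c k)) k :: complex poly)"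
    have coeff_r: "coeff r k = (if k \<le> N then of_real (c k) else 0)" for k
      by (simp add: r_def coeff_sum)
    obtain k where "k \<le> N" "c k \<noteq> 0"
      using u by (auto simp: c_def)
    then have "r \<noteq> 0"
      using coeff_r[of k] by auto
    moreover have dr: "degree r \<le> N"
      by (rule degree_le) (simp add: coeff_r)
    moreover have "mat_of (peval r A) = 0"
    proof -
      have "peval r A = (\<Sum>k\<le>N. c k *\<^sub>R A ^ k)"
        by (simp add: peval_eq_sum[OF dr] coeff_r smat_of_real)
      also have "mat_of \<dots> = (\<Sum>k\<le>N. c k *\<^sub>R mat_of (A ^ k))"
        by (induction N) (auto simp: mat_of_simps)
      also have "\<dots> = 0"
        using u(3) by (simp add: sum.reindex[OF True] c_def)
      finally show ?thesis .
    qed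
    then have "peval r A = 0"
      by (intro cmat_eqI) (simp add: mat_of_simps)
    ultimately show ?thesis using that by blast
  qed
  have "peval (charpoly A ^ degree r) A = 0"
    using peval_charpoly_power_mult_eq_0[OF r(1), of A 1] r(3) by simp
  with le_imp_power_dvd[OF r(2)] show ?thesis
    unfolding N_def by (rule peval_dvd_eq_0)
qed

text \<open>All eigenvalues get the same exponent \<open>m\<close>, large enough for every
  multiplicity. The annihilating polynomial then depends on the set of eigenvalues alone, and one
  \<open>m\<close> serves a whole family of matrices.\<close>

lemma peval_prod_roots_eq_0:
  fixes A :: "'n::finite cmat"
  assumes "m \<ge> CARD('n) * DIM(complex^'n^'n)"
  shows "peval (\<Prod>x\<in>{x. poly (charpoly A) x = 0}. [:- x, 1:] ^ m) A = 0"
proof (rule peval_dvd_eq_0[OF _ peval_charpoly_power_eq_0])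
  let ?R = "{x. poly (charpoly A) x = 0}"
  have "charpoly A = (\<Prod>x\<in>?R. [:- x, 1:] ^ order x (charpoly A))"
    using complex_poly_decompose[of "charpoly A"] by (simp add: lead_coeff_charpoly)
  then have "charpoly A ^ DIM(complex^'n^'n) = (\<Prod>x\<in>?R. [:- x, 1:] ^ (order x (charpoly A) * DIM(complex^'n^'n)))"
    by (metis (no_types, lifting) power_mult prod.cong prod_power_distrib)
  also have "\<dots> dvd (\<Prod>x\<in>?R. [:- x, 1:] ^ m)"
  proof (intro prod_dvd_prod le_imp_power_dvd)
    fix x
    have "order x (charpoly A) \<le> CARD('n)"
      using order_degree[of "charpoly A" x] by (simp add: degree_charpoly)
    then show "order x (charpoly A) * DIM(complex^'n^'n) \<le> m"
      using assms by (meson le_trans mult_le_mono1)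
  qed
  finally show "charpoly A ^ DIM(complex^'n^'n) dvd (\<Prod>x\<in>?R. [:- x, 1:] ^ m)" .
qed

text \<open>A polynomial vanishing at all the \<open>lam j\<close> has a power divisible by the
  annihilating product. Applied to the difference of two logarithms with equal branches.\<close>

lemma nilpotent_of_poly_roots:
  assumes "peval (\<Prod>j\<in>J. [:- lam j, 1:] ^ m) A = 0" "\<And>j. j \<in> J \<Longrightarrow> poly r (lam j) = 0"
  shows "peval r A ^ (m * card J) = 0"
proof -
  have "(\<Prod>j\<in>J. [:- lam j, 1:] ^ m) dvd (\<Prod>j\<in>J. r ^ m)"
    using assms(2) by (intro prod_dvd_prod dvd_power_same) (simp add: poly_eq_0_iff_dvd)
  then have "peval (r ^ (m * card J)) A = 0"
    using peval_dvd_eq_0[OF _ assms(1)] by (simp add: power_mult)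
  then show ?thesis by (simp add: peval_power)
qed

section \<open>Logarithms of a matrix\<close>

text \<open>The series of \<open>log (1 + N)\<close> cut off before degree \<open>m\<close>; its
  exponential is exactly \<open>1 + N\<close> once \<open>N ^ m\<close> vanishes.\<close>

definition tlog :: "nat \<Rightarrow> 'a::real_algebra_1 \<Rightarrow> 'a" where
  "tlog m N = (\<Sum>k=1..<m. ((-1) ^ (k + 1) / real k) *\<^sub>R N ^ k)"

text \<open>The derivative of \<open>exp (- tlog m (s N)) (1 + s N)\<close> in \<open>s\<close> is divisible by \<open>N\<^sup>m\<close>.\<close>

lemma exp_tlog_nilpotent:
  fixes N P :: "'a::{real_normed_algebra_1,banach}"
  assumes "N ^ m * P = 0"
  shows "exp (tlog m N) * P = (1 + N) * P"
proof (cases "m = 0")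
  case False
  then obtain m' where m: "m = Suc m'" by (cases m) auto
  define T where "T = (\<lambda>s::real. tlog m (s *\<^sub>R N))"
  define T' where "T' = (\<lambda>s::real. \<Sum>k=1..<m. ((-1) ^ (k + 1) * s ^ (k - 1)) *\<^sub>R N ^ k)"
  have Teq: "T s = (\<Sum>k=1..<m. ((-1) ^ (k + 1) / real k * s ^ k) *\<^sub>R N ^ k)" for s
    by (simp add: T_def tlog_def scaleR_power)
  have dT: "(T has_vector_derivative T' s) (at s)" for s
  proof -
    have "((\<lambda>s. (-1) ^ (k + 1) / real k * s ^ k) has_real_derivative (-1) ^ (k + 1) * s ^ (k - 1)) (at s)"
      if "k \<ge> 1" for k
      using that by (auto intro!: derivative_eq_intros)
    then have "((\<lambda>s. ((-1) ^ (k + 1) / real k * s ^ k) *\<^sub>R N ^ k) has_vector_derivative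
        ((-1) ^ (k + 1) * s ^ (k - 1)) *\<^sub>R N ^ k) (at s)" if "k \<ge> 1" for k
      using has_vector_derivative_scaleR[OF _ has_vector_derivative_const, of _ _ s UNIV "N ^ k"] that
      by (simp only: scaleR_zero_right add_0_left)
    then show ?thesis
      unfolding Teq[abs_def] T'_def by (intro has_vector_derivative_sum) auto
  qed
  have comm: "T s * T t = T t * T s" for s t
    unfolding Teq sum_product
    by (subst sum.swap) (intro sum.cong refl, simp add: add.commute mult.commute flip: power_add)
  \<comment> \<open>\<open>T' s\<close> is the truncated geometric series of
    \<open>N / (1 + s N)\<close>, so the product telescopes. The remainder is a multiple of
    \<open>N ^ m\<close>, which \<open>P\<close> annihilates; in the application \<open>N\<close> is
    nilpotent only on the range of \<open>P\<close>.\<close>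
  have tele: "T' s * (1 + s *\<^sub>R N) = N - ((-s) ^ m') *\<^sub>R N ^ m" for s
    unfolding T'_def m
  proof (induction m')
    case (Suc n)
    define a where "a = (-s) ^ n"
    have a: "(-1) ^ (Suc n + 1) * s ^ (Suc n - 1) = a"
      by (simp add: a_def flip: power_mult_distrib)
    have "(\<Sum>k=1..<Suc (Suc n). ((-1) ^ (k + 1) * s ^ (k - 1)) *\<^sub>R N ^ k) * (1 + s *\<^sub>R N)
       = (\<Sum>k=1..<Suc n. ((-1) ^ (k + 1) * s ^ (k - 1)) *\<^sub>R N ^ k) * (1 + s *\<^sub>R N)
         + (a *\<^sub>R N ^ Suc n) * (1 + s *\<^sub>R N)"
      by (subst sum.atLeastLessThan_Suc) (simp_all only: a distrib_right le_add1 plus_1_eq_Suc)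
    also have "\<dots> = N - a *\<^sub>R N ^ Suc n + (a *\<^sub>R N ^ Suc n) * (1 + s *\<^sub>R N)"
      unfolding Suc a_def ..
    also have "(a *\<^sub>R N ^ Suc n) * (1 + s *\<^sub>R N) = a *\<^sub>R N ^ Suc n + (a * s) *\<^sub>R N ^ Suc (Suc n)"
      unfolding distrib_left mult_1_right mult_scaleR_left mult_scaleR_right scaleR_scaleR power_Suc2[symmetric]
      by (simp only: mult.commute[of a s])
    also have "N - a *\<^sub>R N ^ Suc n + (a *\<^sub>R N ^ Suc n + (a * s) *\<^sub>R N ^ Suc (Suc n))
        = N - ((-s) ^ Suc n) *\<^sub>R N ^ Suc (Suc n)"
      unfolding a_def by (simp del: power_Suc add: power_Suc2)
    finally show ?case .
  qed simp
  define \<phi> where "\<phi> = (\<lambda>s. exp (- T s) * ((1 + s *\<^sub>R N) * P))"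
  have "(\<phi> has_vector_derivative 0) (at s)" for s
  proof -
    have "((\<lambda>s. - T s) has_vector_derivative - T' s) (at s)"
      by (rule has_vector_derivative_minus[OF dT])
    then have d1: "((\<lambda>s. exp (- T s)) has_vector_derivative exp (- T s) * - T' s) (at s)"
      by (rule exp_commuting_has_vector_derivative) (simp add: comm)
    have d2: "((\<lambda>s. (1 + s *\<^sub>R N) * P) has_vector_derivative N * P) (at s)"
      by (auto intro!: derivative_eq_intros)
    have "(\<phi> has_vector_derivative exp (- T s) * (N * P) + exp (- T s) * - T' s * ((1 + s *\<^sub>R N) * P)) (at s)"
      unfolding \<phi>_def by (rule has_vector_derivative_mult[OF d1 d2])
    also have "exp (- T s) * (N * P) + exp (- T s) * - T' s * ((1 + s *\<^sub>R N) * P)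
        = exp (- T s) * (N * P - (T' s * (1 + s *\<^sub>R N)) * P)"
      by (simp add: right_diff_distrib mult.assoc)
    also have "\<dots> = 0"
      unfolding tele by (simp add: left_diff_distrib assms)
    finally show ?thesis .
  qed
  then have "\<phi> 1 = \<phi> 0"
    using has_vector_derivative_zero_constant[of UNIV \<phi>] by (metis convex_UNIV iso_tuple_UNIV_I)
  moreover have "T 0 = 0"
    unfolding Teq by (intro sum.neutral) auto
  ultimately have "exp (- tlog m N) * ((1 + N) * P) = P"
    by (simp add: \<phi>_def) (simp add: T_def)
  then have "exp (tlog m N) * P = (exp (tlog m N) * exp (- tlog m N)) * ((1 + N) * P)"
    by (simp add: mult.assoc)
  then show ?thesis
    by (simp add: exp_minus_right)
qed (use assms in simp)

text \<open>\<open>Z\<close> and \<open>W\<close> agree on the range of \<open>P\<close>;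
  commutation makes their powers agree there as well, and hence the two series.\<close>

lemma exp_mult_cong:
  fixes Z W P :: "'a::{real_normed_algebra_1,banach}"
  assumes "Z * P = W * P" "Z * W = W * Z"
  shows "exp Z * P = exp W * P"
proof -
  have c: "Z * W ^ k = W ^ k * Z" for k
    using power_commuting_commutes[of W Z k] assms(2) by simp
  have "Z ^ k * P = W ^ k * P" for k
  proof (induction k)
    case (Suc k)
    have "Z ^ Suc k * P = Z * W ^ k * P"
      using Suc by (simp add: mult.assoc)
    also have "\<dots> = W ^ k * (W * P)"
      by (simp add: c mult.assoc assms(1))
    finally show ?case
      by (simp add: power_commutes mult.assoc[symmetric])
  qed simp
  then have "(\<lambda>k. (Z ^ k /\<^sub>R fact k) * P) = (\<lambda>k. (W ^ k /\<^sub>R fact k) * P)"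
    by simp
  moreover have "(\<lambda>k. (A ^ k /\<^sub>R fact k) * P) sums (exp A * P)" for A
    unfolding exp_def by (intro sums_mult2 summable_sums summable_exp_generic)
  ultimately show ?thesis
    by (metis sums_unique2)
qed

text \<open>
  For distinct \<open>lam j\<close>, \<open>lproj lam J m j\<close> is \<open>1\<close> modulo \<open>(X - lam j)\<^sup>m\<close> and \<open>0\<close> modulo the other
  \<open>(X - lam i)\<^sup>m\<close>; so \<open>plog lam b J m\<close> is a truncated logarithm near each \<open>lam j\<close>, with the branch
  fixed by the value \<open>b j\<close> at \<open>lam j\<close>. The formulas show that the coefficients depend
  holomorphically on \<open>lam\<close> and \<open>b\<close>.
\<close>

definition lproj :: "('j \<Rightarrow> complex) \<Rightarrow> 'j set \<Rightarrow> nat \<Rightarrow> 'j \<Rightarrow> complex poly" where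
  "lproj lam J m j =
     1 - (1 - (\<Prod>i\<in>J - {j}. smult (1 / (lam j - lam i)) [:- lam i, 1:]) ^ m) ^ m"

definition lbranch :: "('j \<Rightarrow> complex) \<Rightarrow> ('j \<Rightarrow> complex) \<Rightarrow> nat \<Rightarrow> 'j \<Rightarrow> complex poly" where
  "lbranch lam b m j = [:b j:] +
     (\<Sum>k=1..<m. smult (of_real ((-1) ^ (k + 1) / real k)) (smult (1 / lam j) [:- lam j, 1:] ^ k))"

definition plog :: "('j \<Rightarrow> complex) \<Rightarrow> ('j \<Rightarrow> complex) \<Rightarrow> 'j set \<Rightarrow> nat \<Rightarrow> complex poly" where
  "plog lam b J m = (\<Sum>j\<in>J. lproj lam J m j * lbranch lam b m j)"

text \<open>The product \<open>q\<close> inside \<open>lproj\<close> is 1 at \<open>lam j\<close>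
  and 0 at the other nodes. So \<open>1 - q ^ m\<close> vanishes at \<open>lam j\<close> and its
  m-th power vanishes there to order \<open>m\<close>. At the other nodes \<open>q ^ m\<close>
  vanishes to order \<open>m\<close>, and it divides \<open>1 - (1 - q ^ m) ^ m\<close>.\<close>

lemma lproj_dvd:
  assumes "finite J" "inj_on lam J" "j \<in> J" "m > 0"
  shows "[:- lam j, 1:] ^ m dvd 1 - lproj lam J m j"
    and "i \<in> J \<Longrightarrow> i \<noteq> j \<Longrightarrow> [:- lam i, 1:] ^ m dvd lproj lam J m j"
proof -
  define q where "q = (\<Prod>i\<in>J - {j}. smult (1 / (lam j - lam i)) [:- lam i, 1:])"
  have e: "lproj lam J m j = 1 - (1 - q ^ m) ^ m"
    by (simp add: lproj_def q_def)
  have "poly q (lam j) = (\<Prod>i\<in>J - {j}. 1)"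
    unfolding q_def poly_prod
  proof (intro prod.cong refl)
    fix i assume "i \<in> J - {j}"
    then have "lam j - lam i \<noteq> 0"
      using assms by (auto simp: inj_on_def)
    moreover have "poly (smult (1 / (lam j - lam i)) [:- lam i, 1:]) (lam j) = (lam j - lam i) / (lam j - lam i)"
      by (simp flip: diff_divide_distrib)
    ultimately show "poly (smult (1 / (lam j - lam i)) [:- lam i, 1:]) (lam j) = 1"
      by (metis divide_self)
  qed
  then have "[:- lam j, 1:] dvd 1 - q ^ m"
    by (simp add: poly_eq_0_iff_dvd[symmetric])
  then show "[:- lam j, 1:] ^ m dvd 1 - lproj lam J m j"
    unfolding e by (simp add: dvd_power_same)
  assume i: "i \<in> J" "i \<noteq> j"
  have "smult (1 / (lam j - lam i)) [:- lam i, 1:] dvd q"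
    unfolding q_def using i assms(1) by (intro dvd_prodI) auto
  moreover have "[:- lam i, 1:] dvd smult (1 / (lam j - lam i)) [:- lam i, 1:]"
    by (rule dvd_smult) simp
  ultimately have "[:- lam i, 1:] ^ m dvd q ^ m"
    using dvd_trans dvd_power_same by blast
  also have "q ^ m dvd 1 - (1 - q ^ m) ^ m"
  proof -
    have "1 - q ^ m - 1 dvd (1 - q ^ m) ^ m - 1 ^ m"
      by (subst power_diff_sumr2) simp
    then have "- (q ^ m) dvd - (1 - (1 - q ^ m) ^ m)"
      by simp
    then show ?thesis
      by (simp only: minus_dvd_iff dvd_minus_iff)
  qed
  finally show "[:- lam i, 1:] ^ m dvd lproj lam J m j"
    by (simp add: e)
qed

lemma prod_linear_power_dvd:
  assumes "finite J" "inj_on lam J" "\<And>j. j \<in> J \<Longrightarrow> [:- lam j, 1:] ^ m dvd (r :: complex poly)"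
  shows "(\<Prod>j\<in>J. [:- lam j, 1:] ^ m) dvd r"
proof (cases "r = 0 \<or> m = 0")
  case False
  let ?R = "{z. poly r z = 0}"
  have fin: "finite ?R"
    using False by (intro poly_roots_finite) auto
  have ord: "m \<le> order (lam j) r" if "j \<in> J" for j
    using assms(3)[OF that] False by (simp add: order_divides)
  have sub: "lam ` J \<subseteq> ?R"
    using ord False by (fastforce simp: order_root)
  have "(\<Prod>j\<in>J. [:- lam j, 1:] ^ m) = (\<Prod>z\<in>lam ` J. [:- z, 1:] ^ m)"
    by (simp add: prod.reindex[OF assms(2)])
  also have "\<dots> dvd (\<Prod>z\<in>lam ` J. [:- z, 1:] ^ order z r)"
    using ord by (intro prod_dvd_prod le_imp_power_dvd) auto
  also have "\<dots> dvd (\<Prod>z\<in>?R. [:- z, 1:] ^ order z r)"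
    by (rule prod_dvd_prod_subset[OF fin sub])
  also have "\<dots> dvd smult (lead_coeff r) (\<Prod>z\<in>?R. [:- z, 1:] ^ order z r)"
    by (rule dvd_smult) simp
  also have "\<dots> = r"
    by (rule complex_poly_decompose)
  finally show ?thesis .
qed auto

context
  fixes lam b :: "'j \<Rightarrow> complex" and J :: "'j set" and m :: nat and A :: "'n::finite cmat"
  assumes J: "finite J" "inj_on lam J" and m: "m > 0"
    and A: "peval (\<Prod>j\<in>J. [:- lam j, 1:] ^ m) A = 0"
begin

lemma plog_dvd:
  assumes "j \<in> J"
  shows "[:- lam j, 1:] ^ m dvd plog lam b J m - lbranch lam b m j"
proof -
  have "plog lam b J m - lbranch lam b m j
      = (\<Sum>i\<in>J - {j}. lproj lam J m i * lbranch lam b m i) - (1 - lproj lam J m j) * lbranch lam b m j"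
    unfolding plog_def using J assms by (subst sum.remove[of _ j]) (auto simp: algebra_simps)
  also have "[:- lam j, 1:] ^ m dvd \<dots>"
  proof (rule dvd_diff)
    show "[:- lam j, 1:] ^ m dvd (\<Sum>i\<in>J - {j}. lproj lam J m i * lbranch lam b m i)"
      using lproj_dvd(2)[OF J _ m] assms by (intro dvd_sum dvd_mult2) auto
    show "[:- lam j, 1:] ^ m dvd (1 - lproj lam J m j) * lbranch lam b m j"
      using lproj_dvd(1)[OF J assms m] by (rule dvd_mult2)
  qed
  finally show ?thesis .
qed

lemma poly_plog:
  assumes "j \<in> J"
  shows "poly (plog lam b J m) (lam j) = b j"
proof -
  have "[:- lam j, 1:] dvd plog lam b J m - lbranch lam b m j"
    using plog_dvd[OF assms] m dvd_power dvd_trans by blast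
  then have "poly (plog lam b J m) (lam j) = poly (lbranch lam b m j) (lam j)"
    by (simp add: poly_eq_0_iff_dvd[symmetric])
  then show ?thesis
    by (simp add: lbranch_def poly_sum power_0_left)
qed

lemma peval_eq_0_if_dvd: "(\<And>j. j \<in> J \<Longrightarrow> [:- lam j, 1:] ^ m dvd r) \<Longrightarrow> peval r A = 0"
  using peval_dvd_eq_0[OF prod_linear_power_dvd A] J by blast

text \<open>The matrices \<open>peval (lproj lam J m j) A\<close> are the projections to the
  generalized eigenspaces and add up to 1. So it suffices to compare \<open>exp Z\<close> with
  \<open>A\<close> after multiplication by each of them, where \<open>plog\<close> may be replaced
  by \<open>lbranch\<close>.\<close>

lemma exp_plog:
  assumes b: "\<And>j. j \<in> J \<Longrightarrow> exp (b j) = lam j"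
  shows "exp (peval (plog lam b J m) A) = A"
proof -
  define Z where "Z = peval (plog lam b J m) A"
  have part: "(exp Z - A) * peval (lproj lam J m j) A = 0" if j: "j \<in> J" for j
  proof -
    define P where "P = peval (lproj lam J m j) A"
    define L where "L = lam j"
    have L0: "L \<noteq> 0"
      unfolding L_def b[OF j, symmetric] by simp
    \<comment> \<open>\<open>A = L (1 + N)\<close>, where \<open>N\<close> is nilpotent on the
      generalized eigenspace of \<open>L\<close>; the two factors contribute \<open>b j\<close> and
      \<open>tlog m N\<close> to the logarithm.\<close>
    define N where "N = peval (smult (1 / L) [:- L, 1:]) A"
    have W: "peval (lbranch lam b m j) A = smat (b j) + tlog m N"
      unfolding lbranch_def tlog_def N_def L_def peval_add peval_sum peval_smult peval_power smat_of_real
      by (simp add: peval_smult)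
    have "peval ((plog lam b J m - lbranch lam b m j) * lproj lam J m j) A = 0"
    proof (rule peval_eq_0_if_dvd)
      fix i assume "i \<in> J"
      then show "[:- lam i, 1:] ^ m dvd (plog lam b J m - lbranch lam b m j) * lproj lam J m j"
        using lproj_dvd(2)[OF J j m] plog_dvd j by (cases "i = j") auto
    qed
    then have "Z * P = peval (lbranch lam b m j) A * P"
      by (simp add: peval_mult peval_diff Z_def P_def left_diff_distrib)
    then have "exp Z * P = exp (smat (b j) + tlog m N) * P"
      unfolding W[symmetric] by (rule exp_mult_cong) (simp add: Z_def peval_commute_peval)
    also have "\<dots> = smat L * (exp (tlog m N) * P)"
      using b[OF j] by (simp add: exp_add_commuting smat_commute exp_smat L_def mult.assoc)
    also have "exp (tlog m N) * P = (1 + N) * P"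
    proof (rule exp_tlog_nilpotent)
      have "peval ((smult (1 / L) [:- L, 1:]) ^ m * lproj lam J m j) A = 0"
      proof (rule peval_eq_0_if_dvd)
        fix i assume "i \<in> J"
        then show "[:- lam i, 1:] ^ m dvd smult (1 / L) [:- L, 1:] ^ m * lproj lam J m j"
          using lproj_dvd(2)[OF J j m]
          by (cases "i = j") (auto simp: L_def intro!: dvd_mult2 dvd_power_same dvd_smult simp del: smult_pCons)
      qed
      then show "N ^ m * P = 0"
        by (simp add: peval_mult peval_power N_def P_def del: smult_pCons)
    qed
    also have "smat L * ((1 + N) * P) = A * P"
    proof -
      have "smat L * (1 + N) = peval ([:L:] * (1 + smult (1 / L) [:- L, 1:])) A"
        by (simp add: N_def peval_mult peval_add peval_1 del: smult_pCons mult_pCons_left)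
      also have "[:L:] * (1 + smult (1 / L) [:- L, 1:]) = [:0, 1:]"
        using L0 by (simp add: one_pCons)
      finally show ?thesis
        by (simp add: mult.assoc[symmetric])
    qed
    finally show ?thesis
      by (simp add: left_diff_distrib P_def)
  qed
  have "peval (1 - (\<Sum>j\<in>J. lproj lam J m j)) A = 0"
  proof (rule peval_eq_0_if_dvd)
    fix j assume j: "j \<in> J"
    have "1 - (\<Sum>i\<in>J. lproj lam J m i) = (1 - lproj lam J m j) - (\<Sum>i\<in>J - {j}. lproj lam J m i)"
      using J j by (subst sum.remove[of _ j]) auto
    also have "[:- lam j, 1:] ^ m dvd \<dots>"
      using lproj_dvd(2)[OF J _ m] lproj_dvd(1)[OF J j m] j by (intro dvd_diff[OF _ dvd_sum]) auto
    finally show "[:- lam j, 1:] ^ m dvd 1 - (\<Sum>i\<in>J. lproj lam J m i)" .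
  qed
  then have "(exp Z - A) * 1 = (exp Z - A) * (\<Sum>j\<in>J. peval (lproj lam J m j) A)"
    by (simp add: peval_diff peval_sum)
  also have "\<dots> = 0"
    using part by (simp add: sum_distrib_left)
  finally show ?thesis
    by (simp add: Z_def)
qed

end

section \<open>Holomorphic families of matrices\<close>

text \<open>The common degree bound turns evaluation into one finite sum of holomorphic terms, valid
  on all of \<open>S\<close>.\<close>

definition hol_poly :: "complex set \<Rightarrow> (complex \<Rightarrow> complex poly) \<Rightarrow> bool" where
  "hol_poly S F \<longleftrightarrow> (\<exists>n. \<forall>z\<in>S. degree (F z) \<le> n) \<and> (\<forall>k. (\<lambda>z. coeff (F z) k) holomorphic_on S)"

lemma holopI: "(\<And>z. z \<in> S \<Longrightarrow> degree (F z) \<le> n) \<Longrightarrow> (\<And>k. (\<lambda>z. coeff (F z) k) holomorphic_on S) \<Longrightarrow> hol_poly S F"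
  by (auto simp: hol_poly_def)

lemma hol_poly_coeff: "hol_poly S F \<Longrightarrow> (\<lambda>z. coeff (F z) k) holomorphic_on S"
  by (simp add: hol_poly_def)

lemma hol_poly_degree: "hol_poly S F \<Longrightarrow> \<exists>n. \<forall>z\<in>S. degree (F z) \<le> n"
  by (simp add: hol_poly_def)

lemma hol_poly_const [simp]: "hol_poly S (\<lambda>z. p)"
  by (auto simp: hol_poly_def)

lemma hol_poly_pCons:
  assumes "f holomorphic_on S" "hol_poly S F"
  shows "hol_poly S (\<lambda>z. pCons (f z) (F z))"
proof -
  obtain n where "\<forall>z\<in>S. degree (F z) \<le> n"
    using hol_poly_degree[OF assms(2)] by blast
  then show ?thesis
    using assms
  proof (intro holopI[where n = "Suc n"])
    show "(\<lambda>z. coeff (pCons (f z) (F z)) k) holomorphic_on S" for k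
      using assms by (cases k) (auto intro: hol_poly_coeff)
  qed (auto intro: order_trans[OF degree_pCons_le])
qed

lemma hol_poly_add:
  assumes "hol_poly S F" "hol_poly S H"
  shows "hol_poly S (\<lambda>z. F z + H z)"
proof -
  obtain n m where "\<forall>z\<in>S. degree (F z) \<le> n" "\<forall>z\<in>S. degree (H z) \<le> m"
    using assms hol_poly_degree by meson
  then show ?thesis
    using assms by (intro holopI[where n = "max n m"])
      (auto intro!: holomorphic_intros hol_poly_coeff degree_add_le simp: max.coboundedI1 max.coboundedI2)
qed

lemma hol_poly_mult:
  assumes "hol_poly S F" "hol_poly S H"
  shows "hol_poly S (\<lambda>z. F z * H z)"
proof -
  obtain n m where "\<forall>z\<in>S. degree (F z) \<le> n" "\<forall>z\<in>S. degree (H z) \<le> m"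
    using assms hol_poly_degree by meson
  then show ?thesis
    using assms by (intro holopI[where n = "n + m"])
      (auto intro!: holomorphic_intros hol_poly_coeff order_trans[OF degree_mult_le] add_mono simp: coeff_mult)
qed

lemma hol_poly_smult:
  assumes "f holomorphic_on S" "hol_poly S F"
  shows "hol_poly S (\<lambda>z. smult (f z) (F z))"
  using hol_poly_mult[OF hol_poly_pCons[OF assms(1) hol_poly_const[of S 0]] assms(2)] by simp

lemma hol_poly_diff:
  assumes "hol_poly S F" "hol_poly S H"
  shows "hol_poly S (\<lambda>z. F z - H z)"
  using hol_poly_add[OF assms(1) hol_poly_smult[OF holomorphic_on_const[of "-1"] assms(2)]] by simp

lemma hol_poly_power: "hol_poly S F \<Longrightarrow> hol_poly S (\<lambda>z. F z ^ k)"
  by (induction k) (auto intro: hol_poly_mult)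

lemma hol_poly_sum: "(\<And>x. x \<in> X \<Longrightarrow> hol_poly S (F x)) \<Longrightarrow> hol_poly S (\<lambda>z. \<Sum>x\<in>X. F x z)"
  by (induction X rule: infinite_finite_induct) (auto intro: hol_poly_add)

lemma hol_poly_prod: "(\<And>x. x \<in> X \<Longrightarrow> hol_poly S (F x)) \<Longrightarrow> hol_poly S (\<lambda>z. \<Prod>x\<in>X. F x z)"
  by (induction X rule: infinite_finite_induct) (auto intro: hol_poly_mult)

lemma hol_poly_pderiv:
  assumes "hol_poly S F"
  shows "hol_poly S (\<lambda>z. (pderiv ^^ k) (F z))"
proof (induction k)
  case (Suc k)
  then obtain n where "\<forall>z\<in>S. degree ((pderiv ^^ k) (F z)) \<le> n"
    using hol_poly_degree by meson
  with Suc show ?case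
    by (intro holopI[where n = n])
      (auto intro!: holomorphic_intros hol_poly_coeff simp: coeff_pderiv degree_pderiv order_trans[OF diff_le_self])
qed (use assms in simp)

lemma poly_eq_sum_bounded: "degree (p :: complex poly) \<le> n \<Longrightarrow> poly p x = (\<Sum>k\<le>n. coeff p k * x ^ k)"
  unfolding poly_altdef
  by (intro sum.mono_neutral_left) (auto simp: coeff_eq_0)

lemma hol_poly_continuous_poly:
  assumes "hol_poly S F" "continuous_on S f"
  shows "continuous_on S (\<lambda>z. poly (F z) (f z))"
proof -
  obtain n where n: "\<forall>z\<in>S. degree (F z) \<le> n"
    using assms hol_poly_degree by meson
  have "continuous_on S (\<lambda>z. \<Sum>k\<le>n. coeff (F z) k * f z ^ k)"
    using holomorphic_on_imp_continuous_on[OF hol_poly_coeff[OF assms(1)]] assms(2) by (intro continuous_intros)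
  then show ?thesis
    by (rule continuous_on_eq) (use n in \<open>simp add: poly_eq_sum_bounded[where n = n]\<close>)
qed

text \<open>By Lagrange interpolation.\<close>

lemma hol_poly_of_values:
  assumes d: "\<And>z. z \<in> S \<Longrightarrow> degree (F z) \<le> d"
    and hol: "\<And>x. (\<lambda>z. poly (F z) x) holomorphic_on S"
  shows "hol_poly S F"
proof -
  define L :: "nat \<Rightarrow> complex poly" where
    "L m = (\<Prod>k\<in>{..d} - {m}. smult (1 / (of_nat m - of_nat k)) [:- of_nat k, 1:])" for m
  have poly_L: "poly (L m) (of_nat i) = (if i = m then 1 else 0)" if "m \<le> d" "i \<le> d" for m i
  proof (cases "i = m")
    case True
    have "poly (L m) (of_nat m) = (\<Prod>k\<in>{..d} - {m}. 1)"
      unfolding L_def poly_prod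
      by (intro prod.cong refl) (auto simp flip: diff_divide_distrib)
    with True show ?thesis by simp
  next
    case False
    then show ?thesis
      unfolding L_def poly_prod using that by (auto intro!: prod_zero)
  qed
  have deg_L: "degree (L m) \<le> d" if "m \<le> d" for m
  proof -
    have "degree (L m) \<le> (\<Sum>k\<in>{..d} - {m}. (degree \<circ> (\<lambda>k. smult (1 / (of_nat m - of_nat k)) [:- of_nat k, 1::complex:])) k)"
      unfolding L_def by (rule degree_prod_sum_le) simp
    also have "\<dots> \<le> (\<Sum>k\<in>{..d} - {m}. 1)"
      by (intro sum_mono) (auto intro: order_trans[OF degree_smult_le])
    also have "\<dots> \<le> d"
      using that by simp
    finally show ?thesis .
  qed
  have F: "F z = (\<Sum>m\<le>d. smult (poly (F z) (of_nat m)) (L m))" if "z \<in> S" for z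
  proof (rule poly_eqI_degree[where A = "of_nat ` {..d}"])
    have c: "card (of_nat ` {..d} :: complex set) = Suc d"
      by (subst card_image) (auto simp: inj_on_def)
    show "degree (F z) < card (of_nat ` {..d} :: complex set)"
      using d[OF that] c by simp
    have "degree (\<Sum>m\<le>d. smult (poly (F z) (of_nat m)) (L m)) \<le> d"
      by (intro degree_sum_le) (auto intro: order_trans[OF degree_smult_le] deg_L)
    then show "degree (\<Sum>m\<le>d. smult (poly (F z) (of_nat m)) (L m)) < card (of_nat ` {..d} :: complex set)"
      using c by simp
    fix x :: complex assume "x \<in> of_nat ` {..d}"
    then obtain i where i: "i \<le> d" "x = of_nat i" by auto
    have "poly (\<Sum>m\<le>d. smult (poly (F z) (of_nat m)) (L m)) x
        = (\<Sum>m\<le>d. if i = m then poly (F z) (of_nat m) else 0)"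
      unfolding poly_sum i(2) by (intro sum.cong refl) (use i poly_L in simp)
    then show "poly (F z) x = poly (\<Sum>m\<le>d. smult (poly (F z) (of_nat m)) (L m)) x"
      using i by simp
  qed
  have "(\<lambda>z. coeff (F z) k) holomorphic_on S" for k
  proof -
    have "(\<lambda>z. \<Sum>m\<le>d. poly (F z) (of_nat m) * coeff (L m) k) holomorphic_on S"
      by (intro holomorphic_intros hol)
    moreover have "coeff (F z) k = (\<Sum>m\<le>d. poly (F z) (of_nat m) * coeff (L m) k)" if "z \<in> S" for z
      by (subst F[OF that]) (simp add: coeff_sum)
    ultimately show ?thesis
      by (simp cong: holomorphic_cong)
  qed
  with d show ?thesis by (rule holopI)
qed

lemma holomorphic_on_if_const: "f holomorphic_on S \<Longrightarrow> (\<lambda>z. if P then f z else 0) holomorphic_on S"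
  by (cases P) simp_all

definition hol_mat :: "complex set \<Rightarrow> (complex \<Rightarrow> 'n::finite cmat) \<Rightarrow> bool" where
  "hol_mat S A \<longleftrightarrow> (\<forall>i j. (\<lambda>z. entry i j (A z)) holomorphic_on S)"

lemma hol_mat_subset: "hol_mat S A \<Longrightarrow> T \<subseteq> S \<Longrightarrow> hol_mat T A"
  unfolding hol_mat_def using holomorphic_on_subset by blast

lemma hol_mat_const [simp]: "hol_mat S (\<lambda>z. A)"
  by (simp add: hol_mat_def)

lemma hol_mat_add: "hol_mat S A \<Longrightarrow> hol_mat S B \<Longrightarrow> hol_mat S (\<lambda>z. A z + B z)"
  and hol_mat_diff: "hol_mat S A \<Longrightarrow> hol_mat S B \<Longrightarrow> hol_mat S (\<lambda>z. A z - B z)"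
  and hol_mat_mult: "hol_mat S A \<Longrightarrow> hol_mat S B \<Longrightarrow> hol_mat S (\<lambda>z. A z * B z)"
  unfolding hol_mat_def by (auto simp: entry_mult intro!: holomorphic_intros)

lemma hol_mat_smat: "f holomorphic_on S \<Longrightarrow> hol_mat S (\<lambda>z. smat (f z))"
  unfolding hol_mat_def entry_smat by (auto intro: holomorphic_on_if_const)

lemma hol_mat_power: "hol_mat S A \<Longrightarrow> hol_mat S (\<lambda>z. A z ^ k)"
  by (induction k) (auto intro: hol_mat_mult)

lemma hol_mat_sum: "(\<And>x. x \<in> X \<Longrightarrow> hol_mat S (A x)) \<Longrightarrow> hol_mat S (\<lambda>z. \<Sum>x\<in>X. A x z)"
  by (induction X rule: infinite_finite_induct) (auto intro: hol_mat_add)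

lemma hol_mat_peval:
  assumes "hol_poly S p" "hol_mat S A"
  shows "hol_mat S (\<lambda>z. peval (p z) (A z))"
proof -
  obtain n where n: "\<forall>z\<in>S. degree (p z) \<le> n"
    using assms hol_poly_degree by meson
  have "hol_mat S (\<lambda>z. \<Sum>k\<le>n. smat (coeff (p z) k) * A z ^ k)"
    by (intro hol_mat_sum hol_mat_mult hol_mat_smat hol_mat_power hol_poly_coeff assms)
  moreover have "entry i j (peval (p z) (A z)) = entry i j (\<Sum>k\<le>n. smat (coeff (p z) k) * A z ^ k)" if "z \<in> S" for z i j
    using n that by (subst peval_eq_sum[where n = n]) auto
  ultimately show ?thesis
    unfolding hol_mat_def by (simp del: entry_sum cong: holomorphic_cong)
qed

lemma hol_mat_det_mat: "hol_mat S A \<Longrightarrow> (\<lambda>z. det_mat (A z)) holomorphic_on S"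
  unfolding hol_mat_def det_mat_def det_def entry_def by (intro holomorphic_intros) auto

lemma hol_mat_continuous_on: "hol_mat S A \<Longrightarrow> continuous_on S A"
  unfolding hol_mat_def continuous_on_def tendsto_cmat_iff
  using holomorphic_on_imp_continuous_on continuous_on_def by blast

lemma hol_poly_charpoly:
  assumes "hol_mat S A"
  shows "hol_poly S (\<lambda>z. charpoly (A z))"
  by (rule hol_poly_of_values[OF degree_charpoly_le])
    (simp add: poly_charpoly, intro hol_mat_det_mat hol_mat_diff hol_mat_const assms)

section \<open>Generic eigenvalues of a holomorphic family\<close>

abbreviation eigs :: "'n::finite cmat \<Rightarrow> complex set" where
  "eigs A \<equiv> {x. poly (charpoly A) x = 0}"

abbreviation mult_eig :: "'n::finite cmat \<Rightarrow> complex \<Rightarrow> nat" where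
  "mult_eig A x \<equiv> order x (charpoly A)"

lemma finite_eigs [simp]: "finite (eigs A)"
  by (rule poly_roots_finite) simp

lemma mult_eig_pos: "x \<in> eigs A \<Longrightarrow> mult_eig A x > 0"
  by (auto simp: order_root)

lemma charpoly_decompose: "charpoly A = (\<Prod>x\<in>eigs A. [:- x, 1:] ^ mult_eig A x)"
  using complex_poly_decompose[of "charpoly A"] by (simp add: lead_coeff_charpoly)

lemma sum_mult_eig: "(\<Sum>x\<in>eigs A. mult_eig A x) = CARD('n)" for A :: "'n::finite cmat"
proof -
  have "degree (charpoly A) = (\<Sum>x\<in>eigs A. degree ([:- x, 1:] ^ mult_eig A x))"
    by (subst charpoly_decompose) (rule degree_prod_eq_sum_degree, auto)
  then show ?thesis
    by (simp add: degree_charpoly degree_power_eq)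
qed

lemma norm_eig_le: "x \<in> eigs A \<Longrightarrow> norm x \<le> norm A"
  using charpoly_root_iff eigenvalue_norm_le by blast

text \<open>The value of a monic polynomial is, in modulus, the product of the distances to its
  roots. A small value at \<open>y\<close> thus forces an eigenvalue near \<open>y\<close>, which
  gives the continuity of the spectrum in \<open>eig_persists\<close> and
  \<open>eigs_near\<close>.\<close>

lemma norm_poly_charpoly_ge:
  fixes A :: "'n::finite cmat"
  assumes "\<And>x. x \<in> eigs A \<Longrightarrow> \<epsilon> \<le> norm (y - x)" "\<epsilon> \<ge> 0"
  shows "\<epsilon> ^ CARD('n) \<le> norm (poly (charpoly A) y)"
proof -
  have "\<epsilon> ^ CARD('n) = (\<Prod>x\<in>eigs A. \<epsilon> ^ mult_eig A x)"
    by (simp add: power_sum[symmetric] sum_mult_eig)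
  also have "\<dots> \<le> (\<Prod>x\<in>eigs A. norm (y - x) ^ mult_eig A x)"
    using assms by (intro prod_mono) (auto intro: power_mono)
  also have "\<dots> = norm (poly (charpoly A) y)"
    by (subst (2) charpoly_decompose) (simp add: poly_prod norm_power flip: prod_norm)
  finally show ?thesis .
qed

lemma det_mat_add_smat:
  fixes A :: "'n::finite cmat"
  shows "det_mat (A + smat t) = (\<Prod>x\<in>eigs A. (x + t) ^ mult_eig A x)"
proof -
  have m: "det_mat (smat (-1) :: 'n cmat) = (-1) ^ CARD('n)"
    unfolding det_mat_def by (subst det_diagonal) (auto simp: smat_def mat_def)
  have "det_mat (smat (- t) - A) = (\<Prod>x\<in>eigs A. (- t - x) ^ mult_eig A x)"
    unfolding poly_charpoly[symmetric] by (subst charpoly_decompose) (simp add: poly_prod minus_diff_commute)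
  also have "\<dots> = (\<Prod>x\<in>eigs A. (-1) ^ mult_eig A x * (x + t) ^ mult_eig A x)"
    by (intro prod.cong refl) (simp add: minus_diff_commute flip: power_mult_distrib)
  also have "\<dots> = (-1) ^ CARD('n) * (\<Prod>x\<in>eigs A. (x + t) ^ mult_eig A x)"
    by (simp add: prod.distrib power_sum[symmetric] sum_mult_eig)
  finally have "(-1) ^ CARD('n) * det_mat (smat (- t) - A) = ((-1) ^ CARD('n) * (-1) ^ CARD('n)) * (\<Prod>x\<in>eigs A. (x + t) ^ mult_eig A x)"
    by (simp add: mult.assoc)
  also have "(-1) ^ CARD('n) * (-1) ^ CARD('n) = (1::complex)"
    by (simp flip: power_mult_distrib)
  also have "(-1) ^ CARD('n) * det_mat (smat (- t) - A) = det_mat (smat (-1) * (smat (- t) - A))"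
    by (simp add: det_mat_mult m)
  also have "smat (-1) * (smat (- t) - A) = A + smat t"
    by (simp add: smat_minus)
  finally show ?thesis by simp
qed

text \<open>
  The coefficients of \<open>disc A\<close> are polynomials in those of \<open>A\<close>, and its order of vanishing at \<open>0\<close>
  is the number of pairs of equal eigenvalues.
\<close>

definition disc :: "'n::finite cmat \<Rightarrow> complex poly" where
  "disc A = (\<Prod>x\<in>eigs A. \<Prod>y\<in>eigs A. [:x - y, 1:] ^ (mult_eig A x * mult_eig A y))"

definition coincidences :: "'n::finite cmat \<Rightarrow> nat" where
  "coincidences A = (\<Sum>x\<in>eigs A. mult_eig A x * mult_eig A x)"

text \<open>A discriminant that ignores coinciding eigenvalues, and so is nonzero for every
  matrix.\<close>

definition gaps :: "'n::finite cmat \<Rightarrow> complex" where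
  "gaps A = (\<Prod>x\<in>eigs A. \<Prod>y\<in>eigs A - {x}. (x - y) ^ (mult_eig A x * mult_eig A y))"

text \<open>Written as a determinant, \<open>disc A\<close> is seen to depend holomorphically on
  \<open>A\<close>, which its definition through single eigenvalues hides.\<close>

lemma poly_disc:
  fixes A :: "'n::finite cmat"
  shows "poly (disc A) t = det_mat (peval (charpoly A) (A + smat t))"
proof -
  have "det_mat (peval (\<Prod>x\<in>X. p x) B) = (\<Prod>x\<in>X. det_mat (peval (p x) B))" if "finite X" for X :: "complex set" and p and B :: "'n cmat"
    using that by induction (auto simp: peval_mult det_mat_mult)
  moreover have "det_mat (M ^ k) = det_mat M ^ k" for M :: "'n cmat" and k
    by (induction k) (auto simp: det_mat_mult)
  moreover have "smat (- y) + (A + smat t) * 1 = A + smat (t - y)" for y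
    by (simp add: smat_diff smat_minus)
  ultimately have "det_mat (peval (charpoly A) (A + smat t)) = (\<Prod>y\<in>eigs A. (\<Prod>x\<in>eigs A. (x + (t - y)) ^ mult_eig A x) ^ mult_eig A y)"
    by (subst charpoly_decompose) (simp only: finite_eigs peval_power peval_pCons peval_0 smat_simps mult_zero_right add_0_right
        det_mat_add_smat)
  also have "\<dots> = (\<Prod>y\<in>eigs A. \<Prod>x\<in>eigs A. (x - y + t) ^ (mult_eig A x * mult_eig A y))"
    unfolding prod_power_distrib
    by (intro prod.cong refl) (simp add: algebra_simps flip: power_mult)
  also have "\<dots> = poly (disc A) t"
    unfolding disc_def by (subst prod.swap) (simp add: poly_prod)
  finally show ?thesis ..
qed

lemma degree_disc_le: "degree (disc A) \<le> CARD('n) * CARD('n)" for A :: "'n::finite cmat"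
proof -
  have "degree (disc A) = (\<Sum>x\<in>eigs A. \<Sum>y\<in>eigs A. mult_eig A x * mult_eig A y)"
    unfolding disc_def by (subst degree_prod_eq_sum_degree; simp add: degree_prod_eq_sum_degree degree_power_eq)
  also have "\<dots> = CARD('n) * CARD('n)"
    by (simp add: sum_product[symmetric] sum_mult_eig)
  finally show ?thesis by simp
qed

lemma coeff_disc:
  "k < coincidences A \<Longrightarrow> coeff (disc A) k = 0"
  "coeff (disc A) (coincidences A) = gaps A"
proof -
  define Q where "Q = (\<Prod>x\<in>eigs A. \<Prod>y\<in>eigs A - {x}. [:x - y, 1:] ^ (mult_eig A x * mult_eig A y))"
  have "disc A = (\<Prod>x\<in>eigs A. [:0, 1:] ^ (mult_eig A x * mult_eig A x) *
      (\<Prod>y\<in>eigs A - {x}. [:x - y, 1:] ^ (mult_eig A x * mult_eig A y)))"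
    unfolding disc_def by (intro prod.cong refl, subst prod.remove) auto
  also have "\<dots> = monom 1 (coincidences A) * Q"
    by (simp add: prod.distrib Q_def coincidences_def monom_altdef power_sum)
  finally have d: "disc A = monom 1 (coincidences A) * Q" .
  show "k < coincidences A \<Longrightarrow> coeff (disc A) k = 0"
    unfolding d by (simp add: coeff_monom_mult)
  have "coeff Q 0 = gaps A"
    by (simp add: poly_0_coeff_0[symmetric] Q_def gaps_def poly_prod)
  then show "coeff (disc A) (coincidences A) = gaps A"
    unfolding d by (simp add: coeff_monom_mult)
qed

lemma gaps_nonzero: "gaps A \<noteq> 0"
  unfolding gaps_def by auto

text \<open>One factor \<open>u - v\<close> of the product is kept and all others are bounded by
  \<open>2 * C\<close>, with exponents adding up to at most \<open>CARD('n) * CARD('n)\<close>. Read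
  backwards, a lower bound for \<open>gaps A\<close> keeps distinct eigenvalues apart.\<close>

lemma norm_gaps_le:
  fixes A :: "'n::finite cmat"
  assumes C: "norm A \<le> C" "1 \<le> 2 * C" and uv: "u \<in> eigs A" "v \<in> eigs A" "u \<noteq> v"
  shows "norm (gaps A) \<le> norm (u - v) * (2 * C) ^ (CARD('n) * CARD('n))"
proof -
  define P where "P = (SIGMA x:eigs A. eigs A - {x})"
  define k where "k = (\<lambda>(x, y). mult_eig A x * mult_eig A y)"
  define f where "f = (\<lambda>(x :: complex, y). norm (x - y))"
  have fin: "finite P" by (simp add: P_def)
  have "norm (gaps A) = (\<Prod>p\<in>P. f p ^ k p)"
    unfolding gaps_def P_def f_def k_def
    by (subst prod.Sigma) (auto simp: norm_power split_beta simp flip: prod_norm)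
  also have "\<dots> = f (u, v) ^ k (u, v) * (\<Prod>p\<in>P - {(u, v)}. f p ^ k p)"
    using uv fin by (subst prod.remove[of _ "(u, v)"]) (auto simp: P_def)
  also have "\<dots> \<le> (f (u, v) * (2 * C) ^ k (u, v)) * (\<Prod>p\<in>P - {(u, v)}. (2 * C) ^ k p)"
  proof (intro mult_mono prod_mono conjI)
    have le: "f p \<le> 2 * C" if "p \<in> P" for p
    proof -
      obtain x y where p: "p = (x, y)" by force
      then have "norm x \<le> C" "norm y \<le> C"
        using that norm_eig_le[of _ A] C by (fastforce simp: P_def)+
      then show ?thesis
        using norm_triangle_ineq4[of x y] by (simp add: f_def p)
    qed
    have f0: "f p \<ge> 0" for p
      by (auto simp: f_def split_beta)
    then show "f p ^ k p \<le> (2 * C) ^ k p" if "p \<in> P - {(u, v)}" for p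
      using le that by (intro power_mono) auto
    \<comment> \<open>Positive multiplicities let one copy of \<open>norm (u - v)\<close> be split
      off. The exponent of \<open>2 * C\<close> is then raised back to \<open>k (u, v)\<close>,
      which \<open>1 \<le> 2 * C\<close> permits.\<close>
    have "k (u, v) > 0"
      using uv mult_eig_pos by (auto simp: k_def)
    then obtain k' where k': "k (u, v) = Suc k'"
      using gr0_implies_Suc by blast
    have "f (u, v) ^ k' \<le> (2 * C) ^ k'"
      using le[of "(u, v)"] uv f0 by (intro power_mono) (auto simp: P_def)
    also have "\<dots> \<le> (2 * C) ^ Suc k'"
      using C by (intro power_increasing) auto
    finally show "f (u, v) ^ k (u, v) \<le> f (u, v) * (2 * C) ^ k (u, v)"
      unfolding k' using f0 by (auto intro!: mult_left_mono)
    show "0 \<le> f p ^ k p" if "p \<in> P - {(u, v)}" for p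
      using f0 by simp
    then show "0 \<le> (\<Prod>p\<in>P - {(u, v)}. f p ^ k p)"
      by (intro prod_nonneg)
    show "0 \<le> f (u, v) * (2 * C) ^ k (u, v)"
      using f0 C by simp
  qed
  also have "\<dots> = f (u, v) * (\<Prod>p\<in>P. (2 * C) ^ k p)"
    using uv fin by (subst prod.remove[of P "(u, v)"]) (auto simp: P_def)
  also have "(\<Prod>p\<in>P. (2 * C) ^ k p) = (2 * C) ^ (\<Sum>p\<in>P. k p)"
    by (simp add: power_sum)
  also have "f (u, v) * \<dots> \<le> f (u, v) * (2 * C) ^ (CARD('n) * CARD('n))"
  proof (intro mult_left_mono power_increasing)
    have "(\<Sum>p\<in>P. k p) \<le> (\<Sum>p\<in>eigs A \<times> eigs A. k p)"
      by (intro sum_mono2) (auto simp: P_def)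
    also have "\<dots> = CARD('n) * CARD('n)"
      unfolding k_def sum.cartesian_product[symmetric]
      by (simp add: sum_product[symmetric] sum_mult_eig)
    finally show "(\<Sum>p\<in>P. k p) \<le> CARD('n) * CARD('n)" .
  qed (use C in \<open>auto simp: f_def\<close>)
  finally show ?thesis
    by (simp add: f_def)
qed

section \<open>Multiple roots as simple roots of derivatives\<close>

lemma order_pderiv_funpow:
  fixes p :: "complex poly"
  assumes "p \<noteq> 0" "k \<le> order x p"
  shows "(pderiv ^^ k) p \<noteq> 0 \<and> order x ((pderiv ^^ k) p) = order x p - k"
  using assms(2)
proof (induction k)
  case (Suc k)
  let ?q = "(pderiv ^^ k) p"
  have q: "?q \<noteq> 0" "order x ?q = order x p - k"
    using Suc by auto
  then have "order x ?q \<noteq> 0"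
    using Suc.prems by simp
  then have "degree ?q \<noteq> 0"
    using order_degree[OF q(1), of x] by simp
  then have "pderiv ?q \<noteq> 0"
    by (simp add: pderiv_eq_0_iff)
  moreover have "order x ?q = Suc (order x (pderiv ?q))"
    using \<open>order x ?q \<noteq> 0\<close> q(1) by (intro order_pderiv) (auto simp: order_root)
  ultimately show ?case
    using q by simp
qed (use assms in simp)

lemma poly_pderiv_funpow_eq_0_iff:
  fixes p :: "complex poly"
  assumes "p \<noteq> 0" "k \<le> order x p"
  shows "poly ((pderiv ^^ k) p) x = 0 \<longleftrightarrow> k < order x p"
  using order_pderiv_funpow[OF assms] assms(2) order_root[of "(pderiv ^^ k) p" x] by auto

text \<open>With \<open>q z0 = [:- f z0, 1:] * s\<close>, the equation
  \<open>poly (q z) (f z) = 0\<close> can be solved for \<open>f z - f z0\<close>. Division by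
  \<open>z - z0\<close> expresses the difference quotient of \<open>f\<close> through those of the
  coefficients of \<open>q\<close>, over \<open>poly s (f z)\<close>; simplicity of the root means
  that \<open>s\<close> does not vanish at \<open>f z0\<close>.\<close>

lemma holomorphic_simple_root:
  assumes D: "open D" and q: "hol_poly D q" and f: "continuous_on D f"
    and root: "\<And>z. z \<in> D \<Longrightarrow> poly (q z) (f z) = 0"
    and simple: "\<And>z. z \<in> D \<Longrightarrow> poly (pderiv (q z)) (f z) \<noteq> 0"
  shows "f holomorphic_on D"
proof -
  obtain n where n: "\<And>z. z \<in> D \<Longrightarrow> degree (q z) \<le> n"
    using q hol_poly_degree by meson
  have "\<exists>f'. (f has_field_derivative f') (at z0)" if z0: "z0 \<in> D" for z0
  proof -
    obtain s where s: "q z0 = [:- f z0, 1:] * s"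
      using root[OF z0] by (auto simp: poly_eq_0_iff_dvd dvd_def)
    have s0: "poly s (f z0) \<noteq> 0"
      using simple[OF z0] unfolding s pderiv_mult by (simp add: pderiv_pCons del: mult_pCons_left)
    have fc: "f \<midarrow>z0\<rightarrow> f z0"
      using f D z0 by (simp add: continuous_on_eq_continuous_at isCont_def)
    have sc: "(\<lambda>z. poly s (f z)) \<midarrow>z0\<rightarrow> poly s (f z0)"
      using fc by (intro tendsto_intros)
    have "\<exists>d. ((\<lambda>z. (coeff (q z) k - coeff (q z0) k) / (z - z0)) \<longlongrightarrow> d) (at z0)" for k
      using holomorphic_derivI[OF hol_poly_coeff[OF q, of k] D z0]
      unfolding has_field_derivative_iff by blast
    then obtain d where d: "\<And>k. ((\<lambda>z. (coeff (q z) k - coeff (q z0) k) / (z - z0)) \<longlongrightarrow> d k) (at z0)"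
      by metis
    have lim: "((\<lambda>z. - (\<Sum>k\<le>n. (coeff (q z) k - coeff (q z0) k) / (z - z0) * f z ^ k) / poly s (f z))
        \<longlongrightarrow> - (\<Sum>k\<le>n. d k * f z0 ^ k) / poly s (f z0)) (at z0)"
      by (intro tendsto_intros d fc sc s0)
    have "\<forall>\<^sub>F z in at z0. z \<in> D \<and> poly s (f z) \<noteq> 0 \<and> z \<noteq> z0"
      using D z0 tendsto_imp_eventually_ne[OF sc s0]
      by (intro eventually_conj eventually_at_in_open' eventually_neq_at_within) auto
    then have "\<forall>\<^sub>F z in at z0. - (\<Sum>k\<le>n. (coeff (q z) k - coeff (q z0) k) / (z - z0) * f z ^ k) / poly s (f z)
        = (f z - f z0) / (z - z0)"
    proof eventually_elim
      case (elim z)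
      have "(\<Sum>k\<le>n. (coeff (q z) k - coeff (q z0) k) * f z ^ k) = poly (q z) (f z) - poly (q z0) (f z)"
        using n elim z0 by (simp add: poly_eq_sum_bounded[where n = n] left_diff_distrib sum_subtractf)
      also have "\<dots> = - ((f z - f z0) * poly s (f z))"
        using root elim unfolding s by (simp add: algebra_simps)
      finally have e: "(\<Sum>k\<le>n. (coeff (q z) k - coeff (q z0) k) * f z ^ k) = - ((f z - f z0) * poly s (f z))" .
      have "(\<Sum>k\<le>n. (coeff (q z) k - coeff (q z0) k) / (z - z0) * f z ^ k)
          = (\<Sum>k\<le>n. (coeff (q z) k - coeff (q z0) k) * f z ^ k) / (z - z0)"
        by (simp add: sum_divide_distrib)
      then show ?case
        using elim unfolding e by simp
    qed
    from Lim_transform_eventually[OF lim this] show ?thesis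
      unfolding has_field_derivative_iff by blast
  qed
  then show ?thesis
    by (simp add: holomorphic_on_open[OF D])
qed

lemma isCont_tendsto_nhds: "isCont f (a :: complex) \<Longrightarrow> (f \<longlongrightarrow> f a) (nhds a)"
  by (simp add: isCont_def tendsto_at_iff_tendsto_nhds)

lemma continuous_on_UNIV_tendsto_nhds: "continuous_on UNIV f \<Longrightarrow> (f \<longlongrightarrow> f (a :: complex)) (nhds a)"
  by (rule isCont_tendsto_nhds) (simp add: continuous_on_eq_continuous_at)

section \<open>Eigenvalues of an entire family off a countable set\<close>

context
  fixes h :: "complex \<Rightarrow> 'n::finite cmat"
  assumes h: "hol_mat UNIV h"
begin

text \<open>The generic number of coincidences. Eigenvalues may be repeated for every
  \<open>z\<close>, in which case the ordinary discriminant vanishes identically and gives no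
  information.\<close>

definition mincoin :: nat where
  "mincoin = (LEAST k. \<exists>z. coincidences (h z) = k)"

text \<open>As a coefficient of \<open>disc\<close> this is entire. It equals
  \<open>gaps (h z)\<close> where the number of coincidences is minimal, and 0 elsewhere.\<close>

definition gapf :: "complex \<Rightarrow> complex" where
  "gapf z = coeff (disc (h z)) mincoin"

lemma gapf_holomorphic: "gapf holomorphic_on UNIV"
proof -
  have "hol_poly UNIV (\<lambda>z. disc (h z))"
    by (rule hol_poly_of_values[OF degree_disc_le], unfold poly_disc)
      (intro hol_mat_det_mat hol_mat_peval hol_poly_charpoly hol_mat_add h hol_mat_const)
  then show ?thesis
    unfolding gapf_def by (rule hol_poly_coeff)
qed

lemma gapf_eq_gaps:
  assumes "gapf z \<noteq> 0"
  shows "gapf z = gaps (h z)"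
proof -
  have "mincoin \<le> coincidences (h z)"
    unfolding mincoin_def by (rule Least_le) auto
  moreover have "\<not> mincoin < coincidences (h z)"
    using assms coeff_disc(1) unfolding gapf_def by blast
  ultimately show ?thesis
    unfolding gapf_def using coeff_disc(2)[of "h z"] by simp
qed

definition sing :: "complex set" where
  "sing = {z. gapf z = 0}"

lemma countable_sing: "countable sing"
proof -
  \<comment> \<open>The minimum is attained, so \<open>gapf\<close> is not identically 0.\<close>
  obtain z where "coincidences (h z) = mincoin"
    unfolding mincoin_def using LeastI_ex[of "\<lambda>k. \<exists>z. coincidences (h z) = k"] by blast
  then have z: "gapf z \<noteq> 0"
    unfolding gapf_def using coeff_disc(2)[of "h z"] gaps_nonzero[of "h z"] by simp
  show ?thesis
  proof (cases "gapf constant_on UNIV")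
    case True
    then have "sing = {}"
      using z by (auto simp: sing_def constant_on_def)
    then show ?thesis by simp
  next
    case False
    moreover have "fsigma (UNIV :: complex set)"
      using fsigma.intros[of "\<lambda>_. UNIV :: complex set"] by simp
    ultimately show ?thesis
      using holomorphic_countable_zeros[OF gapf_holomorphic open_UNIV connected_UNIV]
      by (simp add: sing_def)
  qed
qed

lemma cont_h: "isCont h z"
  using hol_mat_continuous_on[OF h] by (simp add: continuous_on_eq_continuous_at)

text \<open>Near \<open>z0\<close> the function \<open>gapf\<close> is bounded away from 0 and
  \<open>h\<close> is bounded, so \<open>norm_gaps_le\<close> gives a uniform distance.\<close>

lemma eigs_separated:
  assumes "z0 \<notin> sing"
  shows "\<exists>\<delta>>0. \<forall>\<^sub>F z in nhds z0. z \<notin> sing \<and> (\<forall>x\<in>eigs (h z). \<forall>y\<in>eigs (h z). x \<noteq> y \<longrightarrow> \<delta> \<le> norm (x - y))"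
proof -
  define \<alpha> where "\<alpha> = norm (gapf z0) / 2"
  define C where "C = norm (h z0) + 1"
  have \<alpha>: "\<alpha> > 0"
    using assms by (simp add: \<alpha>_def sing_def)
  have gc: "isCont gapf z0"
    using holomorphic_on_imp_continuous_on[OF gapf_holomorphic] by (simp add: continuous_on_eq_continuous_at)
  have "\<forall>\<^sub>F z in nhds z0. norm (gapf z) > \<alpha>"
    using \<alpha> by (intro order_tendstoD(1)[OF tendsto_norm[OF isCont_tendsto_nhds[OF gc]]]) (auto simp: \<alpha>_def)
  moreover have "\<forall>\<^sub>F z in nhds z0. norm (h z) < C"
    by (intro order_tendstoD(2)[OF tendsto_norm[OF isCont_tendsto_nhds[OF cont_h]]]) (auto simp: C_def)
  ultimately have "\<forall>\<^sub>F z in nhds z0. z \<notin> sing \<and> (\<forall>x\<in>eigs (h z). \<forall>y\<in>eigs (h z). x \<noteq> y \<longrightarrow>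
      \<alpha> / (2 * C) ^ (CARD('n) * CARD('n)) \<le> norm (x - y))"
  proof eventually_elim
    case (elim z)
    then have z: "gapf z \<noteq> 0"
      using \<alpha> by auto
    have C1: "1 \<le> 2 * C"
      by (simp add: C_def)
    have "\<alpha> / (2 * C) ^ (CARD('n) * CARD('n)) \<le> norm (x - y)"
      if "x \<in> eigs (h z)" "y \<in> eigs (h z)" "x \<noteq> y" for x y
    proof -
      have "\<alpha> \<le> norm (x - y) * (2 * C) ^ (CARD('n) * CARD('n))"
        using norm_gaps_le[OF _ C1 that] elim gapf_eq_gaps[OF z] by simp
      then show ?thesis
        using C1 by (simp add: pos_divide_le_eq)
    qed
    then show ?case
      using z by (simp add: sing_def)
  qed
  moreover have "\<alpha> / (2 * C) ^ (CARD('n) * CARD('n)) > 0"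
    using \<alpha> by (simp add: C_def add_nonneg_pos)
  ultimately show ?thesis by blast
qed

lemma eig_persists:
  assumes "\<mu> \<in> eigs (h z0)" "\<epsilon> > 0"
  shows "\<forall>\<^sub>F z in nhds z0. \<exists>x\<in>eigs (h z). norm (x - \<mu>) < \<epsilon>"
proof -
  have "continuous_on UNIV (\<lambda>z. norm (poly (charpoly (h z)) \<mu>))"
    by (intro continuous_on_norm hol_poly_continuous_poly[OF hol_poly_charpoly[OF h]] continuous_on_const)
  from continuous_on_UNIV_tendsto_nhds[OF this, of z0]
  have "((\<lambda>z. norm (poly (charpoly (h z)) \<mu>)) \<longlongrightarrow> 0) (nhds z0)"
    using assms(1) by simp
  then have "\<forall>\<^sub>F z in nhds z0. norm (poly (charpoly (h z)) \<mu>) < \<epsilon> ^ CARD('n)"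
    using assms(2) by (intro order_tendstoD(2)) auto
  then show ?thesis
  proof eventually_elim
    case (elim z)
    show ?case
    proof (rule ccontr)
      assume "\<not> ?case"
      then have "\<epsilon> ^ CARD('n) \<le> norm (poly (charpoly (h z)) \<mu>)"
        using assms(2) by (intro norm_poly_charpoly_ge) (auto simp: norm_minus_commute not_less)
      with elim show False by simp
    qed
  qed
qed

lemma eigs_near:
  assumes "\<epsilon> > 0"
  shows "\<forall>\<^sub>F z in nhds z0. \<forall>x\<in>eigs (h z). \<exists>\<mu>\<in>eigs (h z0). norm (x - \<mu>) < \<epsilon>"
proof -
  define C where "C = norm (h z0) + 1"
  define g where "g = (\<lambda>z. \<Sum>k\<le>CARD('n). norm (coeff (charpoly (h z0)) k - coeff (charpoly (h z)) k) * C ^ k)"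
  have "continuous_on UNIV g"
    unfolding g_def
    by (intro continuous_intros holomorphic_on_imp_continuous_on hol_poly_coeff hol_poly_charpoly h)
  then have "(g \<longlongrightarrow> g z0) (nhds z0)"
    by (rule continuous_on_UNIV_tendsto_nhds)
  then have "\<forall>\<^sub>F z in nhds z0. g z < \<epsilon> ^ CARD('n)"
    using assms by (intro order_tendstoD(2)) (auto simp: g_def)
  moreover have "\<forall>\<^sub>F z in nhds z0. norm (h z) < C"
    by (intro order_tendstoD(2)[OF tendsto_norm[OF isCont_tendsto_nhds[OF cont_h]]]) (auto simp: C_def)
  ultimately show ?thesis
  proof eventually_elim
    case (elim z)
    show ?case
    proof (intro ballI, rule ccontr)
      fix x assume x: "x \<in> eigs (h z)" and far: "\<not> (\<exists>\<mu>\<in>eigs (h z0). norm (x - \<mu>) < \<epsilon>)"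
      have xC: "norm x \<le> C"
        using norm_eig_le[OF x] elim by simp
      have "\<epsilon> ^ CARD('n) \<le> norm (poly (charpoly (h z0)) x)"
        using assms far by (intro norm_poly_charpoly_ge) (auto simp: not_less)
      also have "poly (charpoly (h z0)) x = poly (charpoly (h z0)) x - poly (charpoly (h z)) x"
        using x by simp
      also have "\<dots> = (\<Sum>k\<le>CARD('n). (coeff (charpoly (h z0)) k - coeff (charpoly (h z)) k) * x ^ k)"
        by (simp add: poly_eq_sum_bounded[OF degree_charpoly_le] left_diff_distrib sum_subtractf)
      also have "norm \<dots> \<le> g z"
        unfolding g_def using xC
        by (intro order_trans[OF norm_sum] sum_mono) (auto simp: norm_mult norm_power intro!: mult_left_mono power_mono)
      finally show False
        using elim by simp
    qed
  qed
qed

text \<open>The eigenvalues at \<open>z0\<close> serve as labels. Each has exactly one eigenvalue of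
  \<open>h z\<close> nearby, whose multiplicity cannot be larger; as multiplicities add up to
  \<open>CARD('n)\<close>, it is constant. The eigenvalue is then a simple root of a derivative of
  fixed order of the characteristic polynomial, and so holomorphic.\<close>

lemma local_eigenvalues:
  assumes "z0 \<notin> sing"
  obtains r lam J where "r > 0" "finite J" "ball z0 r \<inter> sing = {}"
    "\<forall>j::complex\<in>J. lam j holomorphic_on ball z0 r"
    "\<forall>z\<in>ball z0 r. inj_on (\<lambda>j. lam j z) J \<and> eigs (h z) = (\<lambda>j. lam j z) ` J"
proof -
  obtain \<delta> where \<delta>: "\<delta> > 0" and
    sep: "\<forall>\<^sub>F z in nhds z0. z \<notin> sing \<and> (\<forall>x\<in>eigs (h z). \<forall>y\<in>eigs (h z). x \<noteq> y \<longrightarrow> \<delta> \<le> norm (x - y))"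
    using eigs_separated[OF assms] by blast
  define J where "J = eigs (h z0)"
  \<comment> \<open>With a third of the separation, two points within \<open>\<epsilon>\<close> of a
    common point are less than \<open>\<delta>\<close> apart.\<close>
  define \<epsilon> where "\<epsilon> = \<delta> / 3"
  have \<epsilon>: "\<epsilon> > 0" using \<delta> by (simp add: \<epsilon>_def)
  have "\<forall>\<^sub>F z in nhds z0. \<forall>\<mu>\<in>J. \<exists>x\<in>eigs (h z). norm (x - \<mu>) < \<epsilon>"
    using eig_persists \<epsilon> by (intro eventually_ball_finite) (auto simp: J_def)
  from eventually_conj[OF sep eventually_conj[OF this eigs_near[OF \<epsilon>]]]
  obtain r1 where r1: "r1 > 0" and
    *: "\<And>z. dist z z0 < r1 \<Longrightarrow> (z \<notin> sing \<and> (\<forall>x\<in>eigs (h z). \<forall>y\<in>eigs (h z). x \<noteq> y \<longrightarrow> \<delta> \<le> norm (x - y)))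
      \<and> (\<forall>\<mu>\<in>J. \<exists>x\<in>eigs (h z). norm (x - \<mu>) < \<epsilon>)
      \<and> (\<forall>x\<in>eigs (h z). \<exists>\<mu>\<in>eigs (h z0). norm (x - \<mu>) < \<epsilon>)"
    unfolding eventually_nhds_metric by blast
  let ?D = "ball z0 r1"
  have sepD: "\<delta> \<le> norm (x - y)" if "z \<in> ?D" "x \<in> eigs (h z)" "y \<in> eigs (h z)" "x \<noteq> y" for z x y
    using * that by (simp add: dist_commute)
  define lam where "lam = (\<lambda>\<mu> z. SOME x. x \<in> eigs (h z) \<and> norm (x - \<mu>) < \<epsilon>)"
  have lam: "lam \<mu> z \<in> eigs (h z)" "norm (lam \<mu> z - \<mu>) < \<epsilon>" if "\<mu> \<in> J" "z \<in> ?D" for \<mu> z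
  proof -
    have "\<exists>x. x \<in> eigs (h z) \<and> norm (x - \<mu>) < \<epsilon>"
      using *[of z] that by (auto simp: dist_commute)
    from someI_ex[OF this] show "lam \<mu> z \<in> eigs (h z)" "norm (lam \<mu> z - \<mu>) < \<epsilon>"
      unfolding lam_def by auto
  qed
  have uniq: "x = lam \<mu> z" if "\<mu> \<in> J" "z \<in> ?D" "x \<in> eigs (h z)" "norm (x - \<mu>) < \<epsilon>" for \<mu> z x
  proof (rule ccontr)
    assume "x \<noteq> lam \<mu> z"
    then have "\<delta> \<le> norm (x - lam \<mu> z)"
      using sepD[OF that(2,3) lam(1)[OF that(1,2)]] by simp
    also have "\<dots> \<le> norm (x - \<mu>) + norm (lam \<mu> z - \<mu>)"
      using norm_triangle_ineq4[of "x - \<mu>" "lam \<mu> z - \<mu>"] by simp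
    also have "\<dots> < \<epsilon> + \<epsilon>"
      using that(4) lam(2)[OF that(1,2)] by simp
    finally show False using \<delta> by (simp add: \<epsilon>_def)
  qed
  have inj: "inj_on (\<lambda>\<mu>. lam \<mu> z) J" if z: "z \<in> ?D" for z
  proof (rule inj_onI, rule ccontr)
    fix \<mu> \<nu> assume a: "\<mu> \<in> J" "\<nu> \<in> J" "lam \<mu> z = lam \<nu> z" "\<mu> \<noteq> \<nu>"
    have "\<delta> \<le> norm (\<mu> - \<nu>)"
      using sepD[of z0 \<mu> \<nu>] a r1 by (simp add: J_def)
    also have "\<dots> \<le> norm (lam \<nu> z - \<nu>) + norm (lam \<mu> z - \<mu>)"
      using norm_triangle_ineq4[of "lam \<nu> z - \<nu>" "lam \<mu> z - \<mu>"] a(3) by simp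
    also have "\<dots> < \<epsilon> + \<epsilon>"
      by (intro add_strict_mono lam(2) a z)
    finally show False using \<delta> by (simp add: \<epsilon>_def)
  qed
  have img: "eigs (h z) = (\<lambda>\<mu>. lam \<mu> z) ` J" if z: "z \<in> ?D" for z
  proof
    show "(\<lambda>\<mu>. lam \<mu> z) ` J \<subseteq> eigs (h z)"
      using lam(1) z by blast
    show "eigs (h z) \<subseteq> (\<lambda>\<mu>. lam \<mu> z) ` J"
    proof
      fix x assume x: "x \<in> eigs (h z)"
      then obtain \<mu> where "\<mu> \<in> J" "norm (x - \<mu>) < \<epsilon>"
        using *[of z] z by (auto simp: dist_commute J_def)
      then show "x \<in> (\<lambda>\<mu>. lam \<mu> z) ` J"
        using uniq[OF _ z x] by blast
    qed
  qed
  have cont: "continuous_on ?D (lam \<mu>)" if \<mu>: "\<mu> \<in> J" for \<mu>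
    unfolding continuous_on_eq_continuous_at[OF open_ball] isCont_def tendsto_iff
  proof (intro ballI allI impI)
    fix z' \<eta> assume z': "z' \<in> ?D" and \<eta>: "(0::real) < \<eta>"
    \<comment> \<open>The second bound keeps the eigenvalue found near \<open>lam \<mu> z'\<close>
      within \<open>\<epsilon>\<close> of \<open>\<mu>\<close>, so that \<open>uniq\<close>
      identifies it with \<open>lam \<mu> z\<close>.\<close>
    define e where "e = min \<eta> (\<epsilon> - norm (lam \<mu> z' - \<mu>))"
    have "e > 0"
      using \<eta> lam(2)[OF \<mu> z'] by (simp add: e_def)
    then have "\<forall>\<^sub>F z in nhds z'. \<exists>x\<in>eigs (h z). norm (x - lam \<mu> z') < e"
      using eig_persists lam(1)[OF \<mu> z'] by blast
    moreover have "\<forall>\<^sub>F z in nhds z'. z \<in> ?D"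
      using z' by (intro eventually_nhds_in_open) auto
    ultimately have "\<forall>\<^sub>F z in nhds z'. dist (lam \<mu> z) (lam \<mu> z') < \<eta>"
    proof eventually_elim
      case (elim z)
      then obtain x where x: "x \<in> eigs (h z)" "norm (x - lam \<mu> z') < e" by blast
      have "norm (x - \<mu>) \<le> norm (x - lam \<mu> z') + norm (lam \<mu> z' - \<mu>)"
        using norm_triangle_ineq[of "x - lam \<mu> z'" "lam \<mu> z' - \<mu>"] by simp
      also have "\<dots> < \<epsilon>"
        using x(2) by (simp add: e_def)
      finally have "x = lam \<mu> z"
        by (intro uniq[OF \<mu> _ x(1)] elim)
      then show ?case
        using x(2) by (simp add: dist_norm e_def)
    qed
    then show "\<forall>\<^sub>F z in at z'. dist (lam \<mu> z) (lam \<mu> z') < \<eta>"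
      by (simp add: eventually_at_filter eventually_mono)
  qed
  have z0D: "z0 \<in> ?D" using r1 by simp
  have lam0: "lam \<mu> z0 = \<mu>" if "\<mu> \<in> J" for \<mu>
    using uniq[OF that z0D, of \<mu>] that \<epsilon> by (simp add: J_def)
  \<comment> \<open>The derivative whose order is the multiplicity at \<open>z0\<close> is nonzero
    at \<open>\<mu>\<close>, and by continuity at \<open>lam \<mu> z\<close>, which excludes a
    larger multiplicity.\<close>
  have "\<forall>\<^sub>F z in nhds z0. mult_eig (h z) (lam \<mu> z) \<le> mult_eig (h z0) \<mu>" if \<mu>: "\<mu> \<in> J" for \<mu>
  proof -
    define m where "m = mult_eig (h z0) \<mu>"
    have "continuous_on ?D (\<lambda>z. poly ((pderiv ^^ m) (charpoly (h z))) (lam \<mu> z))"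
      by (intro hol_poly_continuous_poly hol_poly_pderiv hol_poly_charpoly cont \<mu> hol_mat_subset[OF h]) auto
    then have "isCont (\<lambda>z. poly ((pderiv ^^ m) (charpoly (h z))) (lam \<mu> z)) z0"
      by (rule continuous_on_interior) (use r1 in simp)
    then have "((\<lambda>z. poly ((pderiv ^^ m) (charpoly (h z))) (lam \<mu> z)) \<longlongrightarrow> poly ((pderiv ^^ m) (charpoly (h z0))) \<mu>) (nhds z0)"
      using isCont_tendsto_nhds[where f = "\<lambda>z. poly ((pderiv ^^ m) (charpoly (h z))) (lam \<mu> z)" and a = z0]
      by (simp only: lam0[OF \<mu>])
    moreover have "poly ((pderiv ^^ m) (charpoly (h z0))) \<mu> \<noteq> 0"
      by (simp add: poly_pderiv_funpow_eq_0_iff m_def)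
    ultimately have "\<forall>\<^sub>F z in nhds z0. poly ((pderiv ^^ m) (charpoly (h z))) (lam \<mu> z) \<noteq> 0"
      by (rule tendsto_imp_eventually_ne)
    then show ?thesis
    proof eventually_elim
      case (elim z)
      then show ?case
        using poly_pderiv_funpow_eq_0_iff[of "charpoly (h z)" m "lam \<mu> z"] by (force simp: m_def)
    qed
  qed
  then have "\<forall>\<^sub>F z in nhds z0. \<forall>\<mu>\<in>J. mult_eig (h z) (lam \<mu> z) \<le> mult_eig (h z0) \<mu>"
    by (intro eventually_ball_finite) (auto simp: J_def)
  then obtain r2 where r2: "r2 > 0" and
    le: "\<And>z \<mu>. dist z z0 < r2 \<Longrightarrow> \<mu> \<in> J \<Longrightarrow> mult_eig (h z) (lam \<mu> z) \<le> mult_eig (h z0) \<mu>"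
    unfolding eventually_nhds_metric by blast
  define r where "r = min r1 r2"
  have sub: "ball z0 r \<subseteq> ?D"
    by (auto simp: r_def)
  have eq: "mult_eig (h z) (lam \<mu> z) = mult_eig (h z0) \<mu>" if z: "z \<in> ball z0 r" and \<mu>: "\<mu> \<in> J" for z \<mu>
  proof (rule sum_mono_inv[where I = J and i = \<mu> and f = "\<lambda>\<mu>. mult_eig (h z) (lam \<mu> z)"
        and g = "\<lambda>\<mu>. mult_eig (h z0) \<mu>"])
    have zD: "z \<in> ?D" using z sub by blast
    have "(\<Sum>\<mu>\<in>J. mult_eig (h z) (lam \<mu> z)) = (\<Sum>x\<in>eigs (h z). mult_eig (h z) x)"
      unfolding img[OF zD] by (simp add: sum.reindex[OF inj[OF zD]])
    then show "(\<Sum>\<mu>\<in>J. mult_eig (h z) (lam \<mu> z)) = (\<Sum>\<mu>\<in>J. mult_eig (h z0) \<mu>)"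
      by (simp add: sum_mult_eig J_def)
  qed (use le z \<mu> in \<open>auto simp: r_def J_def dist_commute\<close>)
  have hol: "lam \<mu> holomorphic_on ball z0 r" if \<mu>: "\<mu> \<in> J" for \<mu>
  proof -
    define m where "m = mult_eig (h z0) \<mu> - 1"
    have m: "mult_eig (h z0) \<mu> = Suc m"
      using mult_eig_pos[of \<mu> "h z0"] \<mu> by (simp add: m_def J_def)
    show ?thesis
    proof (rule holomorphic_simple_root[OF open_ball])
      show "hol_poly (ball z0 r) (\<lambda>z. (pderiv ^^ m) (charpoly (h z)))"
        by (intro hol_poly_pderiv hol_poly_charpoly hol_mat_subset[OF h]) auto
      show "continuous_on (ball z0 r) (lam \<mu>)"
        using cont[OF \<mu>] sub by (rule continuous_on_subset)
      show "poly ((pderiv ^^ m) (charpoly (h z))) (lam \<mu> z) = 0" if "z \<in> ball z0 r" for z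
        by (subst poly_pderiv_funpow_eq_0_iff) (auto simp: eq[OF that \<mu>] m)
      show "poly (pderiv ((pderiv ^^ m) (charpoly (h z)))) (lam \<mu> z) \<noteq> 0" if "z \<in> ball z0 r" for z
        using poly_pderiv_funpow_eq_0_iff[of "charpoly (h z)" "Suc m" "lam \<mu> z"] by (simp add: eq[OF that \<mu>] m)
    qed
  qed
  show thesis
  proof (rule that[of r J lam])
    show "ball z0 r \<inter> sing = {}"
      using * sub by (auto simp: dist_commute)
    show "r > 0" "finite J"
      using r1 r2 by (simp_all add: r_def J_def)
    show "\<forall>z\<in>ball z0 r. inj_on (\<lambda>j. lam j z) J \<and> eigs (h z) = (\<lambda>j. lam j z) ` J"
      using inj img sub by blast
    show "\<forall>j\<in>J. lam j holomorphic_on ball z0 r"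
      using hol by blast
  qed
qed

end

section \<open>Analytic continuation of logarithms\<close>

text \<open>A nonzero polynomial \<open>p\<close> of least degree with
  \<open>app (peval p X) v = 0\<close> has a root \<open>x\<close>, and its cofactor
  \<open>s\<close> gives a nonzero \<open>app (peval s X) v\<close> in the eigenspace of
  \<open>X\<close> for \<open>x\<close>. As \<open>D\<close> commutes with \<open>peval s X\<close>,
  this vector keeps the eigenvalue \<open>d\<close>.\<close>

lemma common_eigenvector:
  fixes X D :: "'a::finite cmat"
  assumes XD: "X * D = D * X" and v: "app D v = d *s v" "v \<noteq> 0"
  obtains u x where "u \<noteq> 0" "app D u = d *s u" "app X u = x *s u"
proof -
  let ?P = "\<lambda>p. p \<noteq> 0 \<and> app (peval p X) v = 0"
  have "?P (charpoly X ^ DIM(complex^'a^'a))"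
    by (simp add: peval_charpoly_power_eq_0 del: DIM_cart)
  then obtain p where p: "?P p" and min: "\<And>q. ?P q \<Longrightarrow> degree p \<le> degree q"
    using ex_has_least_nat[of ?P _ degree] by blast
  have "degree p > 0"
  proof (rule ccontr)
    assume "\<not> degree p > 0"
    then obtain c where "p = [:c:]"
      using degree_eq_zeroE by blast
    then show False
      using p v(2) by (simp add: vec_eq_iff) blast
  qed
  then obtain x where "poly p x = 0"
    using alg_closed_imp_poly_has_root by blast
  then obtain s where s: "p = [:- x, 1:] * s"
    by (auto simp: poly_eq_0_iff_dvd dvd_def)
  have s0: "s \<noteq> 0"
    using p s by auto
  have "degree p = Suc (degree s)"
    unfolding s using s0 by (subst degree_mult_eq) auto
  with min[of s] s0 have u0: "app (peval s X) v \<noteq> 0"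
    by fastforce
  have "app (peval [:- x, 1:] X) (app (peval s X) v) = 0"
    using p unfolding s peval_mult app_mult by simp
  then have "app X (app (peval s X) v) = x *s app (peval s X) v"
    by (simp add: smat_minus vec_eq_iff)
  moreover have "app D (app (peval s X) v) = app (peval s X) (app D v)"
    using peval_commute[OF XD, of s] by (simp flip: app_mult)
  then have "app D (app (peval s X) v) = d *s app (peval s X) v"
    by (simp add: v app_scale)
  ultimately show thesis
    using that u0 by blast
qed

text \<open>\<open>X\<close> commutes with \<open>A\<close>, so the eigenspace of \<open>x\<close>
  contains an eigenvector of \<open>X\<close>; its eigenvalue is a logarithm of \<open>x\<close>
  bounded by the operator norm.\<close>

lemma eig_of_log:
  assumes "exp X = A" "x \<in> eigs A"
  obtains y where "exp y = x" "norm y \<le> norm X"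
proof -
  obtain v where v: "v \<noteq> 0" "app A v = x *s v"
    using assms(2) charpoly_root_iff by blast
  have "X * A = A * X"
    using exp_commute[of X X] assms(1) by simp
  then obtain u y where u: "u \<noteq> 0" "app A u = x *s u" "app X u = y *s u"
    using v(2,1) by (rule common_eigenvector)
  have "exp y *s u = x *s u"
    using exp_eigenvector[OF u(3)] u(2) assms(1) by (simp only:)
  then have "exp y = x"
    using u(1) by (simp add: vector_mul_rcancel)
  with eigenvalue_norm_le[OF u(3,1)] show thesis
    using that by blast
qed

lemma exp_poly_eig:
  assumes "exp (peval q A) = A" "x \<in> eigs A"
  shows "exp (poly q x) = x"
proof -
  obtain v where v: "v \<noteq> 0" "app A v = x *s v"
    using assms(2) charpoly_root_iff by blast
  have "exp (poly q x) *s v = x *s v"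
    using exp_eigenvector[OF peval_eigenvector[OF v(2), of q]] v(2) assms(1) by (simp only:)
  then show ?thesis
    using v(1) by (simp add: vector_mul_rcancel)
qed

text \<open>The difference is nilpotent, because \<open>p - q\<close> vanishes at all the
  \<open>lam j\<close>, and its exponential is 1. So a polynomial logarithm is determined by its
  values on the spectrum.\<close>

lemma peval_log_unique:
  assumes "peval (\<Prod>j\<in>J. [:- lam j, 1:] ^ m) A = 0" "\<And>j. j \<in> J \<Longrightarrow> poly p (lam j) = poly q (lam j)"
    and "exp (peval p A) = exp (peval q A)"
  shows "peval p A = peval q A"
proof -
  have "peval (p - q) A ^ (m * card J) = 0"
    using assms by (intro nilpotent_of_poly_roots) auto
  moreover have "exp (peval p A - peval q A) = 1"
    by (rule exp_diff_eq_one[OF peval_commute_peval assms(3)])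
  ultimately show ?thesis
    using exp_eq_one_nilpotent[of "peval p A - peval q A"] by (simp add: peval_diff)
qed

lemma log_small_unique:
  assumes "exp X = exp Z" "X * Z = Z * X" "norm (X - Z) \<le> 1/2"
  shows "X = Z"
  using exp_eq_one_small[OF exp_diff_eq_one[OF assms(2,1)] assms(3)] by simp

text \<open>An eigenvalue argument is needed here since a polynomial logarithm with small eigenvalues need not be small.\<close>

lemma peval_log_eq_small_log:
  assumes "exp (peval q A) = A" "exp X = A" "norm X \<le> 1/4"
    and small: "\<And>x. x \<in> eigs A \<Longrightarrow> norm (poly q x) \<le> 1/4"
  shows "peval q A = X"
proof -
  define D where "D = X - peval q A"
  have XA: "A * X = X * A"
    using exp_commute[of X X] assms(2) by simp
  have XZ: "X * peval q A = peval q A * X"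
    using peval_commute[OF XA] by simp
  have expD: "exp D = 1"
    unfolding D_def using assms XZ by (intro exp_diff_eq_one) auto
  \<comment> \<open>On a common eigenvector of \<open>D\<close> and \<open>X\<close> the number
    \<open>d\<close> is \<open>x - poly q (exp x)\<close>, both terms of modulus at most 1/4; with
    \<open>exp d = 1\<close> only 0 remains. Having no other eigenvalue, \<open>D\<close> is
    nilpotent.\<close>
  have "d = 0" if d: "d \<in> eigs D" for d
  proof -
    obtain v where v: "v \<noteq> 0" "app D v = d *s v"
      using d charpoly_root_iff by blast
    have "X * D = D * X"
      by (simp add: D_def right_diff_distrib left_diff_distrib XZ)
    then obtain u x where u: "u \<noteq> 0" "app D u = d *s u" "app X u = x *s u"
      using v by (metis common_eigenvector)
    have Au: "app A u = exp x *s u"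
      using exp_eigenvector[OF u(3)] assms(2) by simp
    then have "exp x \<in> eigs A"
      using u(1) charpoly_root_iff by blast
    then have b: "norm (poly q (exp x)) \<le> 1/4"
      by (rule small)
    have "d *s u = x *s u - poly q (exp x) *s u"
      using u(2,3) peval_eigenvector[OF Au, of q] by (simp add: D_def)
    then have dd: "d = x - poly q (exp x)"
      using u(1) by (metis vector_mul_rcancel vector_sub_rdistrib)
    have "exp d *s u = 1 *s u"
      using exp_eigenvector[OF u(2)] expD by simp
    then have "exp d = 1"
      using u(1) unfolding vector_mul_rcancel by simp
    moreover have "norm d \<le> 1/2"
      using norm_triangle_ineq4[of x "poly q (exp x)"] b eigenvalue_norm_le[OF u(3,1)] assms(3)
      unfolding dd by linarith
    ultimately show "d = 0"
      by (rule exp_eq_one_small)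
  qed
  then have "peval [:0, 1:] D ^ (CARD('a) * DIM(complex^'a^'a) * card (eigs D)) = 0"
    by (intro nilpotent_of_poly_roots[where lam = "\<lambda>x. x", OF peval_prod_roots_eq_0[OF order_refl]]) auto
  then have "D = 0"
    using expD exp_eq_one_nilpotent by (simp, blast)
  then show ?thesis
    by (simp add: D_def)
qed

lemma real_avoids_countable:
  assumes "countable S" "a < (b::real)"
  obtains t where "a < t" "t < b" "complex_of_real t \<notin> S"
proof -
  have "countable (of_real -` S :: real set)"
    using countable_image_inj_Int_vimage[of complex_of_real UNIV S] assms(1) by (simp add: inj_on_def)
  then have "\<not> {a<..<b} \<subseteq> of_real -` S"
    using uncountable_open_interval[of a b] assms(2) countable_subset by blast
  then obtain t where "t \<in> {a<..<b}" "t \<notin> of_real -` S"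
    by blast
  then show thesis
    using that[of t] by simp
qed

text \<open>A complex linear functional on matrices, given by its coefficients. Membership in a
  complex subspace becomes the vanishing of such functionals, to which the identity theorem for
  holomorphic functions applies.\<close>

definition lfun :: "('n \<Rightarrow> 'n \<Rightarrow> complex) \<Rightarrow> 'n::finite cmat \<Rightarrow> complex" where
  "lfun w Z = (\<Sum>i\<in>UNIV. \<Sum>j\<in>UNIV. w i j * entry i j Z)"

lemma lfun_holomorphic: "hol_mat S Z \<Longrightarrow> (\<lambda>z. lfun w (Z z)) holomorphic_on S"
  unfolding lfun_def hol_mat_def by (intro holomorphic_intros) auto

lemma hol_poly_plog:
  assumes J: "finite J"
    and lam: "\<And>j. j \<in> J \<Longrightarrow> lam j holomorphic_on S" and b: "\<And>j. j \<in> J \<Longrightarrow> b j holomorphic_on S"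
    and inj: "\<And>z. z \<in> S \<Longrightarrow> inj_on (\<lambda>j. lam j z) J" and nz: "\<And>z j. z \<in> S \<Longrightarrow> j \<in> J \<Longrightarrow> lam j z \<noteq> 0"
  shows "hol_poly S (\<lambda>z. plog (\<lambda>j. lam j z) (\<lambda>j. b j z) J m)"
  unfolding plog_def lproj_def lbranch_def
proof (intro hol_poly_sum hol_poly_mult hol_poly_diff hol_poly_power hol_poly_prod hol_poly_smult hol_poly_add hol_poly_pCons
    hol_poly_const holomorphic_intros lam b)
  fix i j z assume "j \<in> J" "i \<in> J - {j}" "z \<in> S"
  then show "lam j z - lam i z \<noteq> 0"
    using inj[of z] by (auto simp: inj_on_def)
qed (use nz in auto)

context
  fixes h :: "complex \<Rightarrow> 'n::finite cmat" and W :: "('n \<Rightarrow> 'n \<Rightarrow> complex) set"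
  assumes h: "hol_mat UNIV h" and inv: "\<And>z. det_mat (h z) \<noteq> 0"
begin

text \<open>No branch is fixed, so monodromy does no harm: what is continued is the existence of a
  germ. Being a polynomial in \<open>h u\<close>, the logarithm commutes with whatever commutes with
  \<open>h u\<close>.\<close>

definition log_germ :: "complex \<Rightarrow> bool" where
  "log_germ z \<longleftrightarrow> (\<exists>U Z. open U \<and> z \<in> U \<and> hol_mat U Z \<and>
     (\<forall>u\<in>U. exp (Z u) = h u \<and> (\<exists>q. Z u = peval q (h u)) \<and> (\<forall>w\<in>W. lfun w (Z u) = 0)))"

lemma eig_nonzero:
  assumes "x \<in> eigs (h z)"
  shows "x \<noteq> 0"
proof
  assume "x = 0"
  then obtain v where "v \<noteq> 0" "app (h z) v = 0 *s v"
    using assms charpoly_root_iff[of "h z" x] by blast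
  then show False
    using inv[of z] det_mat_eq_0_iff[of "h z"] by (metis vector_smult_lzero)
qed

text \<open>On the disc of \<open>local_eigenvalues\<close> the eigenvalues are holomorphic and
  nonzero, so they have holomorphic logarithms with any prescribed values at \<open>x\<close>, and
  \<open>plog\<close> assembles these. The radius depends neither on \<open>x\<close> nor on the
  branch \<open>b\<close>.\<close>

lemma local_log:
  assumes "z0 \<notin> sing h"
  obtains r where "r > 0" "ball z0 r \<inter> sing h = {}"
    "\<forall>x\<in>ball z0 r. \<forall>b. (\<forall>y\<in>eigs (h x). exp (b y) = y) \<longrightarrow>
      (\<exists>Z. hol_mat (ball z0 r) Z \<and> (\<forall>u\<in>ball z0 r. exp (Z u) = h u \<and> (\<exists>q. Z u = peval q (h u))) \<and>
        (\<exists>q. Z x = peval q (h x) \<and> (\<forall>y\<in>eigs (h x). poly q y = b y)))"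
proof -
  obtain r J lam where r: "r > 0" "finite J" "ball z0 r \<inter> sing h = {}"
    and lam0: "\<forall>j::complex\<in>J. lam j holomorphic_on ball z0 r"
    and J0: "\<forall>z\<in>ball z0 r. inj_on (\<lambda>j. lam j z) J \<and> eigs (h z) = (\<lambda>j. lam j z) ` J"
    by (rule local_eigenvalues[OF h assms])
  note lam = bspec[OF lam0] and J = bspec[OF J0]
  define m where "m = CARD('n) * DIM(complex^'n^'n)"
  have m: "m > 0"
    by (simp add: m_def)
  have annihilator: "peval (\<Prod>j\<in>J. [:- lam j u, 1:] ^ m) (h u) = 0" if u: "u \<in> ball z0 r" for u
  proof -
    have "(\<Prod>x\<in>eigs (h u). [:- x, 1:] ^ m) = (\<Prod>j\<in>J. [:- lam j u, 1:] ^ m)"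
      using J[OF u] by (simp add: prod.reindex)
    then show ?thesis
      using peval_prod_roots_eq_0[of m "h u"] by (simp add: m_def)
  qed
  have lam_eig: "lam j u \<in> eigs (h u)" if "u \<in> ball z0 r" "j \<in> J" for u j
    using that(2) J[OF that(1)] by blast
  have nz: "lam j u \<noteq> 0" if "u \<in> ball z0 r" "j \<in> J" for u j
    by (rule eig_nonzero[OF lam_eig[OF that]])
  show thesis
  proof (rule that[OF r(1,3)], intro ballI allI impI)
    fix x b assume x: "x \<in> ball z0 r" and b0: "\<forall>y\<in>eigs (h x). exp (b y) = y"
    note b = bspec[OF b0]
    have "\<exists>\<beta>. \<beta> holomorphic_on ball z0 r \<and> (\<forall>u\<in>ball z0 r. exp (\<beta> u) = lam j u) \<and> \<beta> x = b (lam j x)"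
      if j: "j \<in> J" for j
    proof -
      obtain g where g: "g holomorphic_on ball z0 r" "\<And>u. u \<in> ball z0 r \<Longrightarrow> exp (g u) = lam j u"
        by (rule holomorphic_logarithm_exists[OF convex_ball open_ball lam[OF j] nz[OF _ j] x])
          (assumption, erule that, blast)
      \<comment> \<open>Two logarithms of the same number differ by a period; adding it as a
        constant adjusts the value at \<open>x\<close>.\<close>
      have "exp (b (lam j x)) = exp (g x)"
        unfolding b[OF lam_eig[OF x j]] g(2)[OF x] ..
      then have e: "exp (b (lam j x) - g x) = 1"
        by (simp add: exp_diff)
      show ?thesis
      proof (intro exI[of _ "\<lambda>u. g u + (b (lam j x) - g x)"] conjI ballI)
        show "(\<lambda>u. g u + (b (lam j x) - g x)) holomorphic_on ball z0 r"
          by (intro holomorphic_intros g(1))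
        show "exp (g u + (b (lam j x) - g x)) = lam j u" if "u \<in> ball z0 r" for u
          unfolding exp_add e using g(2)[OF that] by simp
      qed simp
    qed
    then have "\<forall>j\<in>J. \<exists>\<beta>. \<beta> holomorphic_on ball z0 r \<and> (\<forall>u\<in>ball z0 r. exp (\<beta> u) = lam j u) \<and> \<beta> x = b (lam j x)"
      by (rule ballI)
    from bchoice[OF this] obtain \<beta> where
      "\<forall>j\<in>J. \<beta> j holomorphic_on ball z0 r \<and> (\<forall>u\<in>ball z0 r. exp (\<beta> j u) = lam j u) \<and> \<beta> j x = b (lam j x)" ..
    then have \<beta>: "\<And>j. j \<in> J \<Longrightarrow> \<beta> j holomorphic_on ball z0 r"
      "\<And>j u. j \<in> J \<Longrightarrow> u \<in> ball z0 r \<Longrightarrow> exp (\<beta> j u) = lam j u" "\<And>j. j \<in> J \<Longrightarrow> \<beta> j x = b (lam j x)"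
      by auto
    define R where "R = (\<lambda>u. plog (\<lambda>j. lam j u) (\<lambda>j. \<beta> j u) J m)"
    have "hol_mat (ball z0 r) (\<lambda>u. peval (R u) (h u))"
    proof (rule hol_mat_peval)
      show "hol_poly (ball z0 r) R"
        unfolding R_def
        by (rule hol_poly_plog[OF r(2) lam \<beta>(1) _ nz]) (use J in blast)+
      show "hol_mat (ball z0 r) h"
        by (rule hol_mat_subset[OF h subset_UNIV])
    qed
    moreover have "exp (peval (R u) (h u)) = h u" if u: "u \<in> ball z0 r" for u
      unfolding R_def
    proof (rule exp_plog[OF r(2) _ m annihilator[OF u]])
      show "inj_on (\<lambda>j. lam j u) J"
        using J[OF u] by blast
    qed (rule \<beta>(2)[OF _ u])
    moreover have "poly (R x) y = b y" if y: "y \<in> eigs (h x)" for y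
    proof -
      have "y \<in> (\<lambda>j. lam j x) ` J"
        using y J[OF x] by blast
      then obtain j where j: "j \<in> J" "y = lam j x"
        by auto
      show ?thesis
        unfolding R_def j(2) \<beta>(3)[OF j(1), symmetric]
      proof (rule poly_plog[OF r(2) _ m annihilator[OF x] j(1)])
        show "inj_on (\<lambda>j. lam j x) J"
          using J[OF x] by blast
      qed
    qed
    ultimately have "hol_mat (ball z0 r) (\<lambda>u. peval (R u) (h u)) \<and>
        (\<forall>u\<in>ball z0 r. exp (peval (R u) (h u)) = h u \<and> (\<exists>q. peval (R u) (h u) = peval q (h u))) \<and>
        (\<exists>q. peval (R x) (h x) = peval q (h x) \<and> (\<forall>y\<in>eigs (h x). poly q y = b y))"
      by blast
    then show "\<exists>Z. hol_mat (ball z0 r) Z \<and> (\<forall>u\<in>ball z0 r. exp (Z u) = h u \<and> (\<exists>q. Z u = peval q (h u))) \<and>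
        (\<exists>q. Z x = peval q (h x) \<and> (\<forall>y\<in>eigs (h x). poly q y = b y))"
      by (rule exI[of _ "\<lambda>u. peval (R u) (h u)"])
  qed
qed

text \<open>The logarithm from \<open>local_log\<close> with the branch read off at \<open>x\<close>
  equals the given germ at \<open>x\<close> by \<open>peval_log_unique\<close>, and near
  \<open>x\<close> by continuity and \<open>log_small_unique\<close>. The functionals in
  \<open>W\<close> thus vanish on it near \<open>x\<close>, hence on the whole disc.\<close>

lemma log_germ_propagates:
  assumes "z0 \<notin> sing h"
  shows "\<exists>r>0. ball z0 r \<inter> sing h = {} \<and> (\<forall>x\<in>ball z0 r. \<forall>y\<in>ball z0 r. log_germ x \<longrightarrow> log_germ y)"
proof -
  obtain r where r: "r > 0" "ball z0 r \<inter> sing h = {}" and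
    ext0: "\<forall>x\<in>ball z0 r. \<forall>b. (\<forall>y\<in>eigs (h x). exp (b y) = y) \<longrightarrow>
      (\<exists>Z. hol_mat (ball z0 r) Z \<and> (\<forall>u\<in>ball z0 r. exp (Z u) = h u \<and> (\<exists>q. Z u = peval q (h u))) \<and>
        (\<exists>q. Z x = peval q (h x) \<and> (\<forall>y\<in>eigs (h x). poly q y = b y)))"
    by (rule local_log[OF assms])
  have "log_germ y" if x: "x \<in> ball z0 r" and y: "y \<in> ball z0 r" and g: "log_germ x" for x y
  proof -
    obtain U Z where U: "open U" "x \<in> U" "hol_mat U Z" and
      UZ: "\<forall>u\<in>U. exp (Z u) = h u \<and> (\<exists>q. Z u = peval q (h u)) \<and> (\<forall>w\<in>W. lfun w (Z u) = 0)"
      using g unfolding log_germ_def by (elim exE conjE)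
    have Z: "\<And>u. u \<in> U \<Longrightarrow> exp (Z u) = h u" "\<And>u. u \<in> U \<Longrightarrow> \<exists>q. Z u = peval q (h u)"
        "\<And>u w. u \<in> U \<Longrightarrow> w \<in> W \<Longrightarrow> lfun w (Z u) = 0"
      using UZ by simp_all
    obtain q where q: "Z x = peval q (h x)"
      using Z(2)[OF U(2)] ..
    have "\<forall>v\<in>eigs (h x). exp (poly q v) = v"
      using Z(1)[OF U(2)] q by (intro ballI exp_poly_eig) simp_all
    from ext0[THEN bspec, OF x, THEN spec, of "poly q", THEN mp, OF this] obtain Z' q' where Z'0: "hol_mat (ball z0 r) Z'"
      "\<forall>u\<in>ball z0 r. exp (Z' u) = h u \<and> (\<exists>q. Z' u = peval q (h u))"
      and q'0: "Z' x = peval q' (h x)" "\<forall>v\<in>eigs (h x). poly q' v = poly q v"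
      by (elim exE conjE)
    have Z': "hol_mat (ball z0 r) Z'" "\<And>u. u \<in> ball z0 r \<Longrightarrow> exp (Z' u) = h u"
      "\<And>u. u \<in> ball z0 r \<Longrightarrow> \<exists>q. Z' u = peval q (h u)"
      using Z'0 by simp_all
    have q': "Z' x = peval q' (h x)" "\<And>v. v \<in> eigs (h x) \<Longrightarrow> poly q' v = poly q v"
      using q'0 by simp_all
    have "Z' x = Z x"
      unfolding q q'(1)
      by (rule peval_log_unique[OF peval_prod_roots_eq_0[OF order_refl]])
        (use q' q Z(1)[OF U(2)] Z'(2)[OF x] in \<open>simp_all\<close>)
    define V where "V = U \<inter> ball z0 r"
    have V: "open V" "x \<in> V" "V \<subseteq> U" "V \<subseteq> ball z0 r"
      using U x by (auto simp: V_def)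
    have "continuous_on V (\<lambda>u. norm (Z' u - Z u))"
      using continuous_on_subset[OF hol_mat_continuous_on[OF Z'(1)] V(4)]
        continuous_on_subset[OF hol_mat_continuous_on[OF U(3)] V(3)] by (intro continuous_intros)
    then have "isCont (\<lambda>u. norm (Z' u - Z u)) x"
      using V by (simp add: continuous_on_eq_continuous_at)
    then have "\<forall>\<^sub>F u in nhds x. norm (Z' u - Z u) < 1/2"
      using \<open>Z' x = Z x\<close> by (intro order_tendstoD(2)[OF isCont_tendsto_nhds]) auto
    moreover have "\<forall>\<^sub>F u in nhds x. u \<in> V"
      using V by (intro eventually_nhds_in_open) auto
    ultimately have "\<forall>\<^sub>F u in nhds x. u \<in> V \<and> Z' u = Z u"
    proof eventually_elim
      case (elim u)
      then have u: "u \<in> U" "u \<in> ball z0 r" using V by auto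
      obtain p where p: "Z u = peval p (h u)"
        using Z(2)[OF u(1)] ..
      obtain p' where p': "Z' u = peval p' (h u)"
        using Z'(3)[OF u(2)] ..
      have "Z' u = Z u"
      proof (rule log_small_unique)
        show "exp (Z' u) = exp (Z u)"
          unfolding Z(1)[OF u(1)] Z'(2)[OF u(2)] ..
        show "Z' u * Z u = Z u * Z' u"
          unfolding p p' by (rule peval_commute_peval)
      qed (use elim(1) in simp)
      with elim show ?case by simp
    qed
    then obtain V' where V'0: "open V'" "x \<in> V'" "\<forall>u\<in>V'. u \<in> V \<and> Z' u = Z u"
      unfolding eventually_nhds by (elim exE conjE)
    note V' = V'0(1,2) bspec[OF V'0(3)]
    have "lfun w (Z' u) = 0" if w: "w \<in> W" and u: "u \<in> ball z0 r" for w u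
    proof (rule analytic_continuation_open[of V' "ball z0 r" "\<lambda>u. lfun w (Z' u)" "\<lambda>_. 0"])
      show "lfun w (Z' v) = 0" if "v \<in> V'" for v
        using V'(3)[OF that] Z(3)[OF _ w] V(3) by (metis subsetD)
      show "V' \<noteq> {}" "V' \<subseteq> ball z0 r"
        using V'(2,3) V(4) by blast+
    qed (rule V'(1) open_ball connected_ball lfun_holomorphic[OF Z'(1)] holomorphic_on_const u)+
    then show ?thesis
      unfolding log_germ_def
      by (intro exI[of _ "ball z0 r"] exI[of _ Z'] conjI ballI Z' open_ball y)
  qed
  then show ?thesis
    using r by (intro exI[of _ r] conjI ballI impI)
qed

text \<open>The small logarithm \<open>X\<close> is not given as a polynomial in \<open>h\<close>,
  nor as a holomorphic function of \<open>t\<close>. It is identified with the logarithm from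
  \<open>local_log\<close> whose values on the spectrum are small. The two agree on a real interval
  around \<open>t\<close>, which suffices for the identity theorem.\<close>

lemma log_germ_start:
  assumes "t0 > 0" and small: "\<And>t. 0 < t \<Longrightarrow> t < t0 \<Longrightarrow>
    \<exists>X. exp X = h (of_real t) \<and> norm X \<le> 1/8 \<and> (\<forall>w\<in>W. lfun w X = 0)"
  obtains t where "of_real t \<notin> sing h" "log_germ (of_real t)"
proof -
  obtain t where t: "0 < t" "t < t0" "of_real t \<notin> sing h"
    using real_avoids_countable[OF countable_sing[OF h] assms(1)] by blast
  obtain X where X: "exp X = h (of_real t)" "norm X \<le> 1/8"
    using small[OF t(1,2)] by (elim exE conjE)
  \<comment> \<open>\<open>eig_of_log\<close> supplies logarithms of the eigenvalues bounded by
    \<open>norm X\<close>; this smallness is what lets the branch reproduce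
    \<open>X\<close>.\<close>
  define b where "b = (\<lambda>x :: complex. SOME y :: complex. exp y = x \<and> norm y \<le> norm X)"
  have b: "exp (b x) = x \<and> norm (b x) \<le> norm X" if x: "x \<in> eigs (h (of_real t))" for x
  proof -
    obtain y where "exp y = x" "norm y \<le> norm X"
      by (rule eig_of_log[OF X(1) x])
    then have "\<exists>y. exp y = x \<and> norm y \<le> norm X"
      by (intro exI conjI)
    from someI_ex[OF this] show ?thesis
      unfolding b_def .
  qed
  obtain r where r: "r > 0" "ball (of_real t) r \<inter> sing h = {}" and
    ext0: "\<forall>x\<in>ball (of_real t) r. \<forall>b. (\<forall>y\<in>eigs (h x). exp (b y) = y) \<longrightarrow>
      (\<exists>Z. hol_mat (ball (of_real t) r) Z \<and> (\<forall>u\<in>ball (of_real t) r. exp (Z u) = h u \<and> (\<exists>q. Z u = peval q (h u))) \<and>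
        (\<exists>q. Z x = peval q (h x) \<and> (\<forall>y\<in>eigs (h x). poly q y = b y)))"
    by (rule local_log[OF t(3)])
  let ?D = "ball (complex_of_real t) r"
  have tD: "of_real t \<in> ?D" using r by simp
  have "\<forall>y\<in>eigs (h (of_real t)). exp (b y) = y"
    using b by simp
  from ext0[THEN bspec, OF tD, THEN spec, of b, THEN mp, OF this] obtain Z q where Z0: "hol_mat ?D Z"
    "\<forall>u\<in>?D. exp (Z u) = h u \<and> (\<exists>q. Z u = peval q (h u))"
    and q0: "Z (of_real t) = peval q (h (of_real t))" "\<forall>y\<in>eigs (h (of_real t)). poly q y = b y"
    by (elim exE conjE)
  have Z: "hol_mat ?D Z" "\<And>u. u \<in> ?D \<Longrightarrow> exp (Z u) = h u" "\<And>u. u \<in> ?D \<Longrightarrow> \<exists>q. Z u = peval q (h u)"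
    using Z0 by simp_all
  have q: "Z (of_real t) = peval q (h (of_real t))" "\<And>y. y \<in> eigs (h (of_real t)) \<Longrightarrow> poly q y = b y"
    using q0 by simp_all
  have "Z (of_real t) = X"
    unfolding q(1)
  proof (rule peval_log_eq_small_log)
    show "norm (poly q x) \<le> 1/4" if "x \<in> eigs (h (of_real t))" for x
      using b[OF that] X(2) q(2)[OF that] by simp
  qed (use Z(2)[OF tD] q X in auto)
  have "isCont (\<lambda>u. norm (Z u)) (of_real t)"
    using hol_mat_continuous_on[OF Z(1)] tD by (intro continuous_norm) (simp add: continuous_on_eq_continuous_at)
  then have "\<forall>\<^sub>F u in nhds (of_real t). norm (Z u) < 1/4"
    using X(2) \<open>Z (of_real t) = X\<close> by (intro order_tendstoD(2)[OF isCont_tendsto_nhds]) auto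
  then obtain e1 where e1: "e1 > 0" "\<And>u. dist u (of_real t) < e1 \<Longrightarrow> norm (Z u) < 1/4"
    unfolding eventually_nhds_metric by blast
  \<comment> \<open>On the interval of radius \<open>e\<close> the points stay in the disc and
    between 0 and \<open>t0\<close>, and \<open>norm (Z u) < 1/4\<close>. Together with
    \<open>norm Y \<le> 1/8\<close> this is within the bound 1/2 of
    \<open>log_small_unique\<close>.\<close>
  define e where "e = min (min e1 r) (min t (t0 - t))"
  have e: "e > 0"
    using e1 r t by (simp add: e_def)
  define U where "U = complex_of_real ` {t - e<..<t + e}"
  have UD: "u \<in> ?D" if uU: "u \<in> U" for u
  proof -
    obtain s where s: "u = of_real s" "s \<in> {t - e<..<t + e}"
      using uU unfolding U_def by (rule imageE)
    have "e \<le> r"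
      by (simp add: e_def)
    then have "\<bar>t - s\<bar> < r"
      using s(2) unfolding greaterThanLessThan_iff by linarith
    then show ?thesis
      unfolding s(1) mem_ball dist_of_real dist_real_def .
  qed
  have ZU: "lfun w (Z u) = 0" if uU: "u \<in> U" and "w \<in> W" for u w
  proof -
    obtain s where s: "u = of_real s" "\<bar>s - t\<bar> < e"
    proof -
      obtain s where "u = of_real s" "s \<in> {t - e<..<t + e}"
        using uU unfolding U_def by (rule imageE)
      then have "\<bar>s - t\<bar> < e"
        unfolding greaterThanLessThan_iff by linarith
      with \<open>u = of_real s\<close> show thesis
        by (rule that)
    qed
    have uD: "u \<in> ?D" by (rule UD[OF uU])
    have "0 < s" "s < t0"
      using s(2) unfolding e_def by linarith+
    then obtain Y where Y: "exp Y = h u" "norm Y \<le> 1/8" "\<forall>w\<in>W. lfun w Y = 0"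
      using small[OF \<open>0 < s\<close> \<open>s < t0\<close>] unfolding s(1) by (elim exE conjE)
    obtain p where p: "Z u = peval p (h u)"
      using Z(3)[OF uD] ..
    have "dist u (of_real t) < e1"
      using s by (simp add: e_def dist_of_real dist_real_def)
    then have "norm (Z u) < 1/4"
      by (rule e1)
    then have "norm (Y - Z u) \<le> 1/2"
      using Y(2) norm_triangle_ineq4[of Y "Z u"] by linarith
    moreover have "h u * Y = Y * h u"
      using exp_commute[of Y Y] Y(1) by simp
    then have "Y * Z u = Z u * Y"
      unfolding p by (simp add: peval_commute)
    moreover have "exp Y = exp (Z u)"
      unfolding Y(1) Z(2)[OF uD] ..
    ultimately have "Y = Z u"
      by (metis log_small_unique)
    then show ?thesis
      using Y(3) \<open>w \<in> W\<close> by simp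
  qed
  have lim: "of_real t islimpt U"
    unfolding islimpt_approachable
  proof (intro allI impI)
    fix \<epsilon> :: real assume \<epsilon>: "0 < \<epsilon>"
    have "complex_of_real (t + min e \<epsilon> / 2) \<in> U"
      unfolding U_def using e \<epsilon> by (intro imageI) auto
    moreover have "complex_of_real (t + min e \<epsilon> / 2) \<noteq> of_real t"
      unfolding of_real_eq_iff using e \<epsilon> by simp
    moreover have "dist (complex_of_real (t + min e \<epsilon> / 2)) (of_real t) < \<epsilon>"
      unfolding dist_of_real dist_real_def using e \<epsilon> by simp
    ultimately show "\<exists>x'\<in>U. x' \<noteq> complex_of_real t \<and> dist x' (of_real t) < \<epsilon>"
      by blast
  qed
  have "lfun w (Z u) = 0" if "w \<in> W" "u \<in> ?D" for w u
    by (rule analytic_continuation[OF lfun_holomorphic[OF Z(1)] open_ball connected_ball subsetI tD lim])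
      (rule UD ZU that | assumption)+
  then have "log_germ (of_real t)"
    unfolding log_germ_def
    by (intro exI[of _ ?D] exI[of _ Z] conjI ballI Z open_ball tD)
  with t(3) show thesis by (rule that)
qed

text \<open>The complement of the countable set \<open>sing h\<close> in the plane is connected, so
  the existence of a germ spreads from one real point to all of it.\<close>

theorem log_continuation:
  assumes "t0 > 0" and "\<And>t. 0 < t \<Longrightarrow> t < t0 \<Longrightarrow>
    \<exists>X. exp X = h (of_real t) \<and> norm X \<le> 1/8 \<and> (\<forall>w\<in>W. lfun w X = 0)"
  shows "\<exists>S. countable S \<and> (\<forall>z. z \<notin> S \<longrightarrow> (\<exists>q. exp (peval q (h z)) = h z \<and> (\<forall>w\<in>W. lfun w (peval q (h z)) = 0)))"
proof (intro exI[of _ "sing h"] conjI allI impI)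
  show "countable (sing h)"
    by (rule countable_sing[OF h])
  fix z assume z: "z \<notin> sing h"
  obtain t where t: "of_real t \<notin> sing h" "log_germ (of_real t)"
    using assms by (rule log_germ_start)
  have "connected (UNIV - sing h)"
    by (intro connected_open_diff_countable countable_sing h) auto
  then have "log_germ z"
  proof (rule connected_induction_simple)
    show "of_real t \<in> UNIV - sing h" "z \<in> UNIV - sing h" "log_germ (of_real t)"
      using t z by auto
    fix a assume "a \<in> UNIV - sing h"
    then have "a \<notin> sing h" by simp
    from log_germ_propagates[OF this] obtain r where r: "r > 0" "ball a r \<inter> sing h = {}"
      and lg: "\<forall>x\<in>ball a r. \<forall>y\<in>ball a r. log_germ x \<longrightarrow> log_germ y"
      by (elim exE conjE)
    have "openin (top_of_set (UNIV - sing h)) (ball a r)"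
      using r(2) by (intro open_subset open_ball) blast
    moreover have "a \<in> ball a r"
      using r(1) by simp
    ultimately show "\<exists>T. openin (top_of_set (UNIV - sing h)) T \<and> a \<in> T \<and> (\<forall>x\<in>T. \<forall>y\<in>T. log_germ x \<longrightarrow> log_germ y)"
      using lg by (intro exI[of _ "ball a r"] conjI)
  qed
  then obtain U Z where "z \<in> U" "\<forall>u\<in>U. exp (Z u) = h u \<and> (\<exists>q. Z u = peval q (h u)) \<and> (\<forall>w\<in>W. lfun w (Z u) = 0)"
    unfolding log_germ_def by (elim exE conjE)
  then have Zz: "exp (Z z) = h z \<and> (\<exists>q. Z z = peval q (h z)) \<and> (\<forall>w\<in>W. lfun w (Z z) = 0)"
    by (metis (no_types))
  then obtain q where "Z z = peval q (h z)"
    by (elim exE conjE)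
  with Zz show "\<exists>q. exp (peval q (h z)) = h z \<and> (\<forall>w\<in>W. lfun w (peval q (h z)) = 0)"
    by (intro exI[of _ q]) simp
qed

end

section \<open>Finite-dimensional normed spaces\<close>

text \<open>The model space of a chart comes with a finite spanning set and an arbitrary norm.
  Bounded coordinates and compact balls have to be derived from that.\<close>

definition findim :: "'a::real_normed_vector itself \<Rightarrow> bool" where
  "findim _ \<longleftrightarrow> (\<exists>B :: 'a set. finite B \<and> span B = UNIV)"

lemma compact_cube:
  fixes B :: "'a::real_normed_vector set"
  assumes "finite B"
  shows "compact {\<Sum>b\<in>B. a b *\<^sub>R b | a. \<forall>b\<in>B. \<bar>a b\<bar> \<le> M}"
  using assms
proof (induction B rule: finite_induct)
  case (insert b B)
  let ?K = "{\<Sum>b\<in>B. a b *\<^sub>R b | a. \<forall>b\<in>B. \<bar>a b\<bar> \<le> M}"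
  have LR: "{\<Sum>c\<in>insert b B. a c *\<^sub>R c | a. \<forall>c\<in>insert b B. \<bar>a c\<bar> \<le> M}
      = {x + y | x y. x \<in> (\<lambda>t. t *\<^sub>R b) ` {-M..M} \<and> y \<in> ?K}" (is "?L = ?R")
  proof
    show "?L \<subseteq> ?R"
    proof
      fix x assume "x \<in> ?L"
      then obtain a where a: "x = (\<Sum>c\<in>insert b B. a c *\<^sub>R c)" "\<forall>c\<in>insert b B. \<bar>a c\<bar> \<le> M"
        by blast
      have "x = a b *\<^sub>R b + (\<Sum>c\<in>B. a c *\<^sub>R c)"
        using a(1) insert by simp
      moreover have "a b *\<^sub>R b \<in> (\<lambda>t. t *\<^sub>R b) ` {-M..M}"
        using a(2) by (intro imageI) (auto simp: abs_le_iff)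
      moreover have "(\<Sum>c\<in>B. a c *\<^sub>R c) \<in> ?K"
        using a(2) by blast
      ultimately show "x \<in> ?R"
        by blast
    qed
    show "?R \<subseteq> ?L"
    proof
      fix x assume "x \<in> ?R"
      then obtain t a where t: "x = t *\<^sub>R b + (\<Sum>c\<in>B. a c *\<^sub>R c)" "t \<in> {-M..M}" "\<forall>c\<in>B. \<bar>a c\<bar> \<le> M"
        by blast
      have "x = (\<Sum>c\<in>insert b B. (a(b := t)) c *\<^sub>R c)"
      proof -
        have "(\<Sum>c\<in>B. (a(b := t)) c *\<^sub>R c) = (\<Sum>c\<in>B. a c *\<^sub>R c)"
          using insert by (intro sum.cong) auto
        then show ?thesis
          using insert t(1) by simp
      qed
      moreover have "\<forall>c\<in>insert b B. \<bar>(a(b := t)) c\<bar> \<le> M"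
        using t(2,3) by (auto simp: abs_le_iff)
      ultimately show "x \<in> ?L"
        by blast
    qed
  qed
  have "compact ((\<lambda>t. t *\<^sub>R b) ` {-M..M})"
    by (intro compact_continuous_image continuous_intros) auto
  then show ?case
    unfolding LR using insert.IH by (rule compact_sums)
qed simp

text \<open>\<open>T\<close> is the boundary of the unit cube in the coordinates of a basis
  \<open>B\<close>. It is compact and avoids 0 by independence, so the norm is at least some
  \<open>c\<close> on it; scaling by the largest coordinate bounds the coordinates of every
  vector.\<close>

lemma findim_coords:
  assumes "findim TYPE('a)"
  obtains B :: "'a::real_normed_vector set" and coord :: "'a::real_normed_vector \<Rightarrow> 'a \<Rightarrow> real" where
    "finite B" "\<forall>b\<in>B. bounded_linear (coord b)" "\<forall>x. (\<Sum>b\<in>B. coord b x *\<^sub>R b) = x"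
proof -
  obtain B0 :: "'a set" where B0: "finite B0" "span B0 = UNIV"
    using assms unfolding findim_def by blast
  obtain B where B: "B \<subseteq> B0" "independent B" "B0 \<subseteq> span B"
    using maximal_independent_subset[of B0] by blast
  have fin: "finite B"
    using B(1) B0(1) finite_subset by blast
  have sp: "span B = UNIV"
    using span_mono[OF B(3)] unfolding span_span B0(2) by auto
  define coord where "coord = (\<lambda>b x. representation B x b)"
  have sum: "(\<Sum>b\<in>B. coord b x *\<^sub>R b) = x" for x
    unfolding coord_def using sum_representation_eq[OF B(2) _ fin order_refl] sp by simp
  define T where "T = (\<Union>b\<in>B. \<Union>s\<in>{1, -1::real}.
      (\<lambda>y. s *\<^sub>R b + y) ` {\<Sum>c\<in>B - {b}. a c *\<^sub>R c | a. \<forall>c\<in>B - {b}. \<bar>a c\<bar> \<le> 1})"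
  have "compact T"
    unfolding T_def using fin
    by (intro compact_UN compact_continuous_image compact_cube continuous_intros) auto
  have "0 \<notin> T"
  proof
    assume "0 \<in> T"
    then obtain b s a where b: "b \<in> B" "s \<in> {1, -1::real}" "0 = s *\<^sub>R b + (\<Sum>c\<in>B - {b}. a c *\<^sub>R c)"
      unfolding T_def by blast
    define a' where "a' = a(b := s)"
    have "(\<Sum>c\<in>B - {b}. a' c *\<^sub>R c) = (\<Sum>c\<in>B - {b}. a c *\<^sub>R c)"
      by (intro sum.cong) (auto simp: a'_def)
    then have "(\<Sum>c\<in>B. a' c *\<^sub>R c) = 0"
      using b fin by (subst sum.remove[of _ b]) (auto simp: a'_def)
    then have "a' b = 0"
      using B(2) fin b(1) independentD[of B B a' b] by simp
    then show False
      using b(2) by (auto simp: a'_def)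
  qed
  then obtain c where c: "c > 0" "ball 0 c \<subseteq> - T"
    using open_contains_ball[of "- T"] compact_imp_closed[OF \<open>compact T\<close>] by (auto simp: open_Compl)
  have bound: "c * \<bar>coord b x\<bar> \<le> norm x" if b: "b \<in> B" for b x
  proof (cases "coord b x = 0")
    case False
    have "\<exists>b1\<in>B. \<forall>b\<in>B. \<bar>coord b x\<bar> \<le> \<bar>coord b1 x\<bar>"
    proof -
      have "Max ((\<lambda>b. \<bar>coord b x\<bar>) ` B) \<in> (\<lambda>b. \<bar>coord b x\<bar>) ` B"
        using fin b by (intro Max_in) auto
      then obtain b1 where b1: "Max ((\<lambda>b. \<bar>coord b x\<bar>) ` B) = \<bar>coord b1 x\<bar>" "b1 \<in> B"
        by (rule imageE)
      have "\<bar>coord b x\<bar> \<le> \<bar>coord b1 x\<bar>" if "b \<in> B" for b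
        unfolding b1(1)[symmetric] using fin that by (intro Max_ge) auto
      then show ?thesis
        using b1(2) by blast
    qed
    then obtain b1 where b1: "b1 \<in> B" "\<forall>b\<in>B. \<bar>coord b x\<bar> \<le> \<bar>coord b1 x\<bar>"
      by (elim bexE)
    define M where "M = \<bar>coord b1 x\<bar>"
    have M: "M > 0"
      using b1(2) b False by (fastforce simp: M_def)
    have "x /\<^sub>R M \<in> T"
    proof -
      have "x /\<^sub>R M = (\<Sum>b\<in>B. (coord b x / M) *\<^sub>R b)"
        by (subst sum[of x, symmetric]) (simp add: scaleR_sum_right divide_inverse mult.commute)
      also have "\<dots> = (coord b1 x / M) *\<^sub>R b1 + (\<Sum>b\<in>B - {b1}. (coord b x / M) *\<^sub>R b)"
        using fin b1 by (subst sum.remove[of _ b1]) auto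
      finally have e: "x /\<^sub>R M = (coord b1 x / M) *\<^sub>R b1 + (\<Sum>b\<in>B - {b1}. (coord b x / M) *\<^sub>R b)" .
      have "coord b1 x / M \<in> {1, -1}"
        using M by (auto simp: M_def abs_if)
      moreover have "\<forall>b\<in>B - {b1}. \<bar>coord b x / M\<bar> \<le> 1"
        using M b1(2) by (auto simp: M_def)
      ultimately show ?thesis
        unfolding T_def e using b1(1)
        by (intro UN_I[of b1] UN_I[of "coord b1 x / M"]
            image_eqI[where x = "\<Sum>b\<in>B - {b1}. (coord b x / M) *\<^sub>R b"]
            CollectI exI[of _ "\<lambda>b. coord b x / M"] conjI refl)
    qed
    then have "x /\<^sub>R M \<notin> ball 0 c"
      using c(2) by blast
    then have "c * M \<le> norm x"
      using M by (simp add: field_simps)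
    moreover have "c * \<bar>coord b x\<bar> \<le> c * M"
      using c(1) b1(2) b by (simp add: M_def)
    ultimately show ?thesis by linarith
  qed simp
  show thesis
  proof (rule that[OF fin])
    show "\<forall>b\<in>B. bounded_linear (coord b)"
    proof
      fix b assume "b \<in> B"
      then show "bounded_linear (coord b)"
        using bound[of b] c(1) sp B(2)
        by (intro bounded_linear_intro[where K = "1 / c"])
          (auto simp: coord_def representation_add representation_scale field_simps)
    qed
  qed (use sum in blast)
qed

lemma compact_cball_findim:
  fixes x :: "'a::real_normed_vector"
  assumes "findim TYPE('a)"
  shows "compact (cball x r)"
proof -
  obtain B :: "'a set" and coord where B: "finite B" "\<forall>b\<in>B. bounded_linear (coord b)" "\<forall>x. (\<Sum>b\<in>B. coord b x *\<^sub>R b) = x"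
    using findim_coords[OF assms] .
  have "\<forall>b\<in>B. \<exists>K. \<forall>x. \<bar>coord b x\<bar> \<le> norm x * K"
    using B(2) bounded_linear.bounded by fastforce
  then obtain K where K: "\<And>b x. b \<in> B \<Longrightarrow> \<bar>coord b x\<bar> \<le> norm x * K b"
    by metis
  define L where "L = (\<Sum>b\<in>B. \<bar>K b\<bar>)"
  have L: "\<bar>coord b x\<bar> \<le> norm x * L" if "b \<in> B" for b x
  proof -
    have "K b \<le> L"
      unfolding L_def using B(1) that member_le_sum[of b B "\<lambda>b. \<bar>K b\<bar>"] by force
    then show ?thesis
      using K[OF that, of x] by (meson mult_left_mono norm_ge_zero order_trans)
  qed
  have sub: "cball 0 r \<subseteq> {\<Sum>b\<in>B. a b *\<^sub>R b | a. \<forall>b\<in>B. \<bar>a b\<bar> \<le> r * L}"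
  proof
    fix x :: 'a assume "x \<in> cball 0 r"
    then have "norm x * L \<le> r * L"
      by (intro mult_right_mono) (auto simp: L_def sum_nonneg)
    then have "\<forall>b\<in>B. \<bar>coord b x\<bar> \<le> r * L"
      using L order_trans by blast
    then show "x \<in> {\<Sum>b\<in>B. a b *\<^sub>R b | a. \<forall>b\<in>B. \<bar>a b\<bar> \<le> r * L}"
      using B(3) by (intro CollectI exI[of _ "\<lambda>b. coord b x"]) simp
  qed
  have "compact ({\<Sum>b\<in>B. a b *\<^sub>R b | a. \<forall>b\<in>B. \<bar>a b\<bar> \<le> r * L} \<inter> cball 0 r)"
    by (intro compact_Int_closed compact_cube B) auto
  then have "compact (cball (0::'a) r)"
    using sub by (simp add: inf.absorb2)
  then have "compact ((\<lambda>y. x + y) ` cball 0 r)"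
    by (rule compact_translation)
  then show ?thesis by simp
qed

lemma findim_prod:
  assumes "findim TYPE('a::real_normed_vector)" "findim TYPE('b::real_normed_vector)"
  shows "findim TYPE('a \<times> 'b)"
proof -
  obtain B :: "'a set" and C :: "'b set" where B: "finite B" "span B = UNIV" and C: "finite C" "span C = UNIV"
    using assms unfolding findim_def by blast
  have l1: "linear (\<lambda>x::'a. (x, 0::'b))" and l2: "linear (\<lambda>y::'b. (0::'a, y))"
    by (auto intro!: linearI)
  let ?S = "(\<lambda>x. (x, 0)) ` B \<union> (\<lambda>y. (0, y)) ` C"
  have "p \<in> span ?S" for p
  proof -
    have "(fst p, 0) \<in> span ((\<lambda>x. (x, 0::'b)) ` B)"
      unfolding linear_span_image[OF l1] B by blast
    moreover have "(0, snd p) \<in> span ((\<lambda>y. (0::'a, y)) ` C)"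
      unfolding linear_span_image[OF l2] C by blast
    ultimately have "(fst p, 0) + (0, snd p) \<in> span ?S"
      by (intro span_add) (auto intro: span_mono[THEN subsetD, rotated])
    then show ?thesis by simp
  qed
  then have "span ?S = UNIV" by blast
  moreover have "finite ?S" using B C by simp
  ultimately show ?thesis unfolding findim_def by blast
qed

lemma linear_inj_bounded_below:
  fixes A :: "'a::real_normed_vector \<Rightarrow> 'b::real_normed_vector"
  assumes fd: "findim TYPE('a)" and A: "bounded_linear A" and inj: "\<And>v. A v = 0 \<Longrightarrow> v = 0"
  obtains \<kappa> where "\<kappa> > 0" "\<forall>v. \<kappa> * norm v \<le> norm (A v)"
proof (cases "\<exists>v::'a. v \<noteq> 0")
  case True
  then obtain v1 :: 'a where "v1 \<noteq> 0" by blast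
  then have ne: "v1 /\<^sub>R norm v1 \<in> sphere 0 1" by simp
  have "closed (sphere (0::'a) 1)"
    unfolding sphere_def by (intro closed_Collect_eq continuous_intros)
  then have "compact (cball (0::'a) 1 \<inter> sphere 0 1)"
    by (intro compact_Int_closed compact_cball_findim fd)
  moreover have "cball (0::'a) 1 \<inter> sphere 0 1 = sphere 0 1"
    by auto
  ultimately have "compact (sphere (0::'a) 1)" by simp
  moreover have "continuous_on (sphere 0 1) (\<lambda>v. norm (A v))"
    by (intro continuous_on_norm linear_continuous_on A)
  ultimately obtain v0 where v0: "v0 \<in> sphere 0 1" "\<forall>v\<in>sphere 0 1. norm (A v0) \<le> norm (A v)"
    using continuous_attains_inf[of "sphere 0 1"] ne by blast
  show thesis
  proof (rule that[of "norm (A v0)"])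
    show "norm (A v0) > 0"
      using inj[of v0] v0(1) by auto
    show "\<forall>v. norm (A v0) * norm v \<le> norm (A v)"
    proof
      fix v
      show "norm (A v0) * norm v \<le> norm (A v)"
      proof (cases "v = 0")
        case False
        then have "norm (A v0) \<le> norm (A (v /\<^sub>R norm v))"
          by (intro v0(2)[rule_format]) simp
        also have "\<dots> = norm (A v) / norm v"
          by (simp add: linear_cmul[OF bounded_linear.linear[OF A]] divide_inverse mult.commute)
        finally show ?thesis
          using False by (simp add: field_simps)
      qed simp
    qed
  qed
next
  \<comment> \<open>In dimension 0 there is no unit vector to minimize over.\<close>
  case False
  then have "\<forall>v. 1 * norm v \<le> norm (A v)"
    by (metis norm_ge_zero norm_zero mult_zero_right)
  then show thesis
    by (rule that[of 1, rotated]) simp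
qed

section \<open>Calculus of smooth maps\<close>

lemma Ck_on_Suc_imp: "Ck_on (Suc k) S f \<Longrightarrow> Ck_on k S f"
proof (induction k arbitrary: f)
  case 0
  then obtain f' where "\<forall>x\<in>S. (f has_derivative f' x) (at x)"
    by auto
  then show ?case
    by (auto intro!: continuous_at_imp_continuous_on has_derivative_continuous)
next
  case (Suc k)
  then obtain f' where f': "\<forall>x\<in>S. (f has_derivative f' x) (at x)" "\<forall>v. Ck_on (Suc k) S (\<lambda>x. f' x v)"
    by (auto simp del: Ck_on.simps(2) simp: Ck_on.simps(2)[of "Suc k"])
  then show ?case
    using Suc.IH by (auto intro!: exI[of _ f'])
qed

lemma Ck_on_SucE:
  assumes "Ck_on (Suc k) S f"
  obtains f' where "\<forall>x\<in>S. (f has_derivative f' x) (at x)" "\<forall>v. Ck_on k S (\<lambda>x. f' x v)"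
  using assms by auto

lemma Ck_on_SucI: "\<forall>x\<in>S. (f has_derivative f' x) (at x) \<Longrightarrow> \<forall>v. Ck_on k S (\<lambda>x. f' x v) \<Longrightarrow> Ck_on (Suc k) S f"
  by auto

lemma Ck_on_imp_continuous_on: "Ck_on k S f \<Longrightarrow> continuous_on S f"
  by (induction k) (auto dest: Ck_on_Suc_imp simp del: Ck_on.simps(2))

lemma Ck_on_cong:
  assumes "open S" "\<And>x. x \<in> S \<Longrightarrow> f x = g x" "Ck_on k S f"
  shows "Ck_on k S g"
proof (cases k)
  case 0
  with assms show ?thesis
    by (simp cong: continuous_on_cong)
next
  case (Suc m)
  obtain f' where f': "\<forall>x\<in>S. (f has_derivative f' x) (at x)" "\<forall>v. Ck_on m S (\<lambda>x. f' x v)"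
    using assms(3) unfolding Suc by (rule Ck_on_SucE)
  have "\<forall>x\<in>S. (g has_derivative f' x) (at x)"
    using f'(1) assms(1,2) has_derivative_transform_within_open by blast
  then show ?thesis
    unfolding Suc using f'(2) by (rule Ck_on_SucI)
qed

lemma Ck_on_subset: "Ck_on k S f \<Longrightarrow> T \<subseteq> S \<Longrightarrow> Ck_on k T f"
proof (induction k arbitrary: f)
  case (Suc k)
  obtain f' where f': "\<forall>x\<in>S. (f has_derivative f' x) (at x)" "\<forall>v. Ck_on k S (\<lambda>x. f' x v)"
    using Suc.prems(1) by (rule Ck_on_SucE)
  then show ?case
    using Suc.IH Suc.prems(2) by (intro Ck_on_SucI[of _ _ f']) auto
qed (auto intro: continuous_on_subset)

lemma Ck_on_const: "Ck_on k S (\<lambda>x. c)"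
  by (induction k arbitrary: c) (auto intro!: Ck_on_SucI[where f' = "\<lambda>_ _. 0"] simp del: Ck_on.simps(2))

lemma Ck_on_bounded_linear:
  assumes L: "bounded_linear L"
  shows "Ck_on k S f \<Longrightarrow> Ck_on k S (\<lambda>x. L (f x))"
proof (induction k arbitrary: f)
  case (Suc k)
  obtain f' where f': "\<forall>x\<in>S. (f has_derivative f' x) (at x)" "\<forall>v. Ck_on k S (\<lambda>x. f' x v)"
    using Suc.prems by (rule Ck_on_SucE)
  then show ?case
    using Suc.IH by (intro Ck_on_SucI[of _ _ "\<lambda>x v. L (f' x v)"]) (auto intro: bounded_linear.has_derivative[OF L])
qed (auto intro: continuous_on_compose2[OF linear_continuous_on[OF L]])

lemma Ck_on_add: "Ck_on k S f \<Longrightarrow> Ck_on k S g \<Longrightarrow> Ck_on k S (\<lambda>x. f x + g x)"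
proof (induction k arbitrary: f g)
  case (Suc k)
  obtain f' where f': "\<forall>x\<in>S. (f has_derivative f' x) (at x)" "\<forall>v. Ck_on k S (\<lambda>x. f' x v)"
    using Suc.prems(1) by (rule Ck_on_SucE)
  obtain g' where g': "\<forall>x\<in>S. (g has_derivative g' x) (at x)" "\<forall>v. Ck_on k S (\<lambda>x. g' x v)"
    using Suc.prems(2) by (rule Ck_on_SucE)
  show ?case
    using Suc.IH f' g' by (intro Ck_on_SucI[of _ _ "\<lambda>x v. f' x v + g' x v"]) (auto intro: has_derivative_add)
qed (auto intro: continuous_intros)

lemma Ck_on_scaleR:
  fixes f :: "'a::real_normed_vector \<Rightarrow> real" and g :: "'a \<Rightarrow> 'b::real_normed_vector"
  shows "Ck_on k S f \<Longrightarrow> Ck_on k S g \<Longrightarrow> Ck_on k S (\<lambda>x. f x *\<^sub>R g x)"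
proof (induction k arbitrary: f g)
  case (Suc k)
  obtain f' where f': "\<forall>x\<in>S. (f has_derivative f' x) (at x)" "\<forall>v. Ck_on k S (\<lambda>x. f' x v)"
    using Suc.prems(1) by (rule Ck_on_SucE)
  obtain g' where g': "\<forall>x\<in>S. (g has_derivative g' x) (at x)" "\<forall>v. Ck_on k S (\<lambda>x. g' x v)"
    using Suc.prems(2) by (rule Ck_on_SucE)
  note fg = Ck_on_Suc_imp[OF Suc.prems(1)] Ck_on_Suc_imp[OF Suc.prems(2)]
  show ?case
  proof (rule Ck_on_SucI[of _ _ "\<lambda>x v. f x *\<^sub>R g' x v + f' x v *\<^sub>R g x"])
    show "\<forall>x\<in>S. ((\<lambda>x. f x *\<^sub>R g x) has_derivative (\<lambda>v. f x *\<^sub>R g' x v + f' x v *\<^sub>R g x)) (at x)"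
      using f'(1) g'(1) by (auto intro: has_derivative_scaleR)
    show "\<forall>v. Ck_on k S (\<lambda>x. f x *\<^sub>R g' x v + f' x v *\<^sub>R g x)"
      using f'(2) g'(2) fg by (intro allI Ck_on_add Suc.IH) auto
  qed
qed (auto intro: continuous_intros)

lemma Ck_on_sum: "finite I \<Longrightarrow> (\<And>i. i \<in> I \<Longrightarrow> Ck_on k S (f i)) \<Longrightarrow> Ck_on k S (\<lambda>x. \<Sum>i\<in>I. f i x)"
  by (induction I rule: finite_induct) (auto intro: Ck_on_const Ck_on_add)

text \<open>\<open>Ck_on\<close> controls derivatives in fixed directions, while the chain rule
  produces the moving direction \<open>c' t s\<close>. Expanding it in a basis turns the derivative
  into a sum of products to which the induction hypothesis applies.\<close>

lemma Ck_on_compose_curve: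
  fixes c :: "real \<Rightarrow> 'p::real_normed_vector" and F :: "'p \<Rightarrow> 'b::real_normed_vector"
  assumes fd: "findim TYPE('p)" and c: "Ck_on k T c" and im: "c ` T \<subseteq> S"
  shows "Ck_on k S F \<Longrightarrow> Ck_on k T (\<lambda>t. F (c t))"
  using c
proof (induction k arbitrary: F)
  case 0
  then show ?case
    using im by (auto intro: continuous_on_compose2)
next
  case (Suc k)
  obtain B :: "'p set" and coord where B: "finite B" "\<forall>b\<in>B. bounded_linear (coord b)" "\<forall>x. (\<Sum>b\<in>B. coord b x *\<^sub>R b) = x"
    using findim_coords[OF fd] .
  obtain F' where F': "\<forall>x\<in>S. (F has_derivative F' x) (at x)" "\<forall>v. Ck_on k S (\<lambda>x. F' x v)"
    using Suc.prems(1) by (rule Ck_on_SucE)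
  obtain c' where c': "\<forall>x\<in>T. (c has_derivative c' x) (at x)" "\<forall>v. Ck_on k T (\<lambda>x. c' x v)"
    using Suc.prems(2) by (rule Ck_on_SucE)
  note ck = Ck_on_Suc_imp[OF Suc.prems(2)]
  have der: "((\<lambda>t. F (c t)) has_derivative (\<lambda>s. \<Sum>b\<in>B. coord b (c' t s) *\<^sub>R F' (c t) b)) (at t)" if t: "t \<in> T" for t
  proof -
    have Fd: "(F has_derivative F' (c t)) (at (c t))"
      using F'(1) im t by blast
    have lin: "linear (F' (c t))"
      using has_derivative_linear[OF Fd] .
    have "((\<lambda>t. F (c t)) has_derivative (\<lambda>s. F' (c t) (c' t s))) (at t)"
      using has_derivative_compose[OF c'(1)[rule_format, OF t] Fd] .
    moreover have "F' (c t) (c' t s) = (\<Sum>b\<in>B. coord b (c' t s) *\<^sub>R F' (c t) b)" for s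
    proof -
      have "F' (c t) (c' t s) = F' (c t) (\<Sum>b\<in>B. coord b (c' t s) *\<^sub>R b)"
        using B(3) by simp
      then show ?thesis
        by (simp add: linear_sum[OF lin] linear_cmul[OF lin])
    qed
    ultimately show ?thesis by simp
  qed
  show ?case
  proof (rule Ck_on_SucI)
    show "\<forall>t\<in>T. ((\<lambda>t. F (c t)) has_derivative (\<lambda>s. \<Sum>b\<in>B. coord b (c' t s) *\<^sub>R F' (c t) b)) (at t)"
      using der by blast
    have "Ck_on k T (\<lambda>t. coord b (c' t s) *\<^sub>R F' (c t) b)" if "b \<in> B" for b s
    proof (rule Ck_on_scaleR)
      show "Ck_on k T (\<lambda>t. coord b (c' t s))"
        using Ck_on_bounded_linear[OF bspec[OF B(2) that] spec[OF c'(2), of s]] .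
      show "Ck_on k T (\<lambda>t. F' (c t) b)"
        using Suc.IH[OF spec[OF F'(2), of b] ck] .
    qed
    then show "\<forall>s. Ck_on k T (\<lambda>t. \<Sum>b\<in>B. coord b (c' t s) *\<^sub>R F' (c t) b)"
      by (intro allI Ck_on_sum[OF B(1)])
  qed
qed

text \<open>The mean value inequality for \<open>F - D\<close>, whose derivative is small near
  \<open>p0\<close> by continuity of the directional derivatives.\<close>

lemma strictly_differentiable:
  fixes F :: "'a::real_normed_vector \<Rightarrow> 'b::real_normed_vector"
  assumes fd: "findim TYPE('a)" and S: "open S" "p0 \<in> S" and F: "Ck_on 1 S F"
    and D: "(F has_derivative D) (at p0)" and \<eta>: "\<eta> > 0"
  obtains \<delta> where "\<delta> > 0" "ball p0 \<delta> \<subseteq> S"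
    "\<forall>p\<in>ball p0 \<delta>. \<forall>q\<in>ball p0 \<delta>. norm (F p - F q - D (p - q)) \<le> \<eta> * norm (p - q)"
proof -
  obtain B :: "'a set" and coord where B: "finite B" "\<forall>b\<in>B. bounded_linear (coord b)" "\<forall>x. (\<Sum>b\<in>B. coord b x *\<^sub>R b) = x"
    using findim_coords[OF fd] .
  obtain F' where F': "\<forall>x\<in>S. (F has_derivative F' x) (at x)" "\<forall>v. Ck_on 0 S (\<lambda>x. F' x v)"
    using F unfolding One_nat_def by (rule Ck_on_SucE)
  have Dp0: "D = F' p0"
    using has_derivative_unique[OF D] F'(1) S(2) by blast
  \<comment> \<open>A bound for the operator norm of \<open>F' p - F' p0\<close> by finitely many
    directional derivatives, hence continuous in \<open>p\<close> and 0 at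
    \<open>p0\<close>.\<close>
  define g where "g = (\<lambda>p. \<Sum>b\<in>B. onorm (coord b) * norm (F' p b - F' p0 b))"
  have "continuous_on S g"
    unfolding g_def using F'(2) by (intro continuous_intros) auto
  then have "isCont g p0"
    using S by (simp add: continuous_on_eq_continuous_at)
  then have "\<forall>\<^sub>F p in at p0. g p < \<eta>"
    using \<eta> unfolding isCont_def by (intro order_tendstoD(2)) (auto simp: g_def)
  then obtain d1 where d1: "d1 > 0" "\<And>p. p \<noteq> p0 \<Longrightarrow> dist p p0 < d1 \<Longrightarrow> g p < \<eta>"
    unfolding eventually_at by blast
  obtain d2 where d2: "d2 > 0" "ball p0 d2 \<subseteq> S"
    using S open_contains_ball by blast
  define \<delta> where "\<delta> = min d1 d2"
  have sub: "ball p0 \<delta> \<subseteq> S"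
    using d2(2) by (auto simp: \<delta>_def)
  have gle: "g p \<le> \<eta>" if "p \<in> ball p0 \<delta>" for p
  proof (cases "p = p0")
    case True
    then show ?thesis
      using \<eta> by (simp add: g_def)
  next
    case False
    then show ?thesis
      using d1(2)[OF False] that by (simp add: \<delta>_def dist_commute)
  qed
  have on: "onorm (\<lambda>u. F' p u - D u) \<le> \<eta>" if p: "p \<in> ball p0 \<delta>" for p
  proof (rule onorm_bound)
    fix u
    have lp: "linear (F' p)" "linear (F' p0)"
      using F'(1) sub p S(2) has_derivative_linear by blast+
    have "F' p u - D u = (\<Sum>b\<in>B. coord b u *\<^sub>R (F' p b - F' p0 b))"
    proof -
      have "F' p u = (\<Sum>b\<in>B. coord b u *\<^sub>R F' p b)" "F' p0 u = (\<Sum>b\<in>B. coord b u *\<^sub>R F' p0 b)"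
        by (subst B(3)[rule_format, of u, symmetric], simp add: linear_sum[OF lp(1)] linear_sum[OF lp(2)] linear_cmul[OF lp(1)] linear_cmul[OF lp(2)])+
      then show ?thesis
        by (simp add: Dp0 scaleR_diff_right sum_subtractf)
    qed
    also have "norm \<dots> \<le> (\<Sum>b\<in>B. (onorm (coord b) * norm u) * norm (F' p b - F' p0 b))"
      using B(2) by (intro order_trans[OF norm_sum] sum_mono) (auto intro!: mult_right_mono simp: onorm[of "coord _", simplified])
    also have "\<dots> = g p * norm u"
      by (simp add: g_def sum_distrib_left mult_ac)
    also have "\<dots> \<le> \<eta> * norm u"
      using gle[OF p] by (intro mult_right_mono) auto
    finally show "norm (F' p u - D u) \<le> \<eta> * norm u" .
  qed (use \<eta> in simp)
  have DL: "bounded_linear D"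
    using D has_derivative_bounded_linear by blast
  show thesis
  proof (rule that)
    show "\<delta> > 0" using d1 d2 by (simp add: \<delta>_def)
    show "ball p0 \<delta> \<subseteq> S" by (rule sub)
    show "\<forall>p\<in>ball p0 \<delta>. \<forall>q\<in>ball p0 \<delta>. norm (F p - F q - D (p - q)) \<le> \<eta> * norm (p - q)"
    proof (intro ballI)
      fix p q assume pq: "p \<in> ball p0 \<delta>" "q \<in> ball p0 \<delta>"
      have "norm ((F p - D p) - (F q - D q)) \<le> \<eta> * norm (p - q)"
      proof (rule differentiable_bound[OF convex_ball _ on pq])
        fix x assume x: "x \<in> ball p0 \<delta>"
        have "((\<lambda>p. F p - D p) has_derivative (\<lambda>u. F' x u - D u)) (at x)"
          using F'(1) sub x by (intro has_derivative_diff bounded_linear_imp_has_derivative DL) auto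
        then show "((\<lambda>p. F p - D p) has_derivative (\<lambda>u. F' x u - D u)) (at x within ball p0 \<delta>)"
          by (rule has_derivative_at_withinI)
      qed
      then show "norm (F p - F q - D (p - q)) \<le> \<eta> * norm (p - q)"
        by (simp add: linear_diff[OF bounded_linear.linear[OF DL]] algebra_simps)
    qed
  qed
qed

section \<open>Linear Lie groups\<close>

definition cmat_of_real :: "real^'n^'n \<Rightarrow> 'n::finite cmat" where
  "cmat_of_real M = Cmat (\<chi> i j. of_real (M $ i $ j))"

lemma entry_cmat_of_real [simp]: "entry i j (cmat_of_real M) = of_real (M $ i $ j)"
  by (simp add: cmat_of_real_def)

lemma bounded_linear_cmat_of_real: "bounded_linear cmat_of_real"
  unfolding linear_conv_bounded_linear[symmetric] by (rule linearI) (auto simp: cmat_eq_iff)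

lemma cmat_of_real_mult: "cmat_of_real (A ** B) = cmat_of_real A * cmat_of_real B"
  by (auto simp: cmat_eq_iff entry_mult matrix_matrix_mult_def)

lemma cmat_of_real_mat_1: "cmat_of_real (mat 1) = 1"
  by (auto simp: cmat_eq_iff mat_def)

lemma cmat_of_real_inject: "cmat_of_real A = cmat_of_real B \<longleftrightarrow> A = B"
  by (auto simp: cmat_eq_iff vec_eq_iff)

lemma cnj_mat_cmat_of_real: "cnj_mat (cmat_of_real A) = cmat_of_real A"
  by (auto simp: cmat_eq_iff)

lemma inv_into_map_prod:
  assumes "inj_on f A" "inj_on g B" "x \<in> f ` A" "y \<in> g ` B"
  shows "inv_into (A \<times> B) (map_prod f g) (x, y) = (inv_into A f x, inv_into B g y)"
  using assms by (intro inv_into_f_eq map_prod_inj_on) (auto simp: inv_into_into f_inv_into_f)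

lemma vector_derivative_quotient:
  assumes "(g has_vector_derivative d) (at t)"
  shows "((\<lambda>s. (g (t + s) - g t) /\<^sub>R s) \<longlongrightarrow> d) (at 0)"
proof -
  have "((\<lambda>s. g (t + s)) has_vector_derivative d) (at 0)"
  proof -
    have "((\<lambda>s. t + s) has_vector_derivative 1) (at 0)"
      by (auto intro!: derivative_eq_intros)
    from vector_diff_chain_at[OF this] assms show ?thesis
      by (simp add: o_def)
  qed
  then have lim: "((\<lambda>s. (g (t + s) - g t - s *\<^sub>R d) /\<^sub>R norm s) \<longlongrightarrow> 0) (at 0)"
    by (simp add: has_vector_derivative_def has_derivative_at_within)
  have "((\<lambda>s. (g (t + s) - g t) /\<^sub>R s - d) \<longlongrightarrow> 0) (at 0)"
  proof (rule Lim_null_comparison[OF _ tendsto_norm_zero[OF lim]])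
    have "norm ((g (t + s) - g t) /\<^sub>R s - d) \<le> norm ((g (t + s) - g t - s *\<^sub>R d) /\<^sub>R norm s)" if "s \<noteq> 0" for s
    proof -
      have "(g (t + s) - g t) /\<^sub>R s - d = (g (t + s) - g t - s *\<^sub>R d) /\<^sub>R s"
        using that by (simp add: scaleR_diff_right)
      then show ?thesis by simp
    qed
    then show "\<forall>\<^sub>F s in at 0. norm ((g (t + s) - g t) /\<^sub>R s - d) \<le> norm ((g (t + s) - g t - s *\<^sub>R d) /\<^sub>R norm s)"
      unfolding eventually_at by (intro exI[of _ 1]) simp
  qed
  then show ?thesis
    by (simp add: LIM_zero_iff)
qed

text \<open>\<open>\<rho>\<close> is an injective smooth homomorphism, with nothing said about its
  image or its differential; injectivity of the differential is derived in
  \<open>A_inj\<close>.\<close>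

locale linear_lie =
  fixes G :: "('g, 'e::real_normed_vector) lie_struct" and \<rho> :: "'g \<Rightarrow> real^'n^'n::finite"
  assumes lie: "lie_group G" and rho: "\<rho> \<in> lie_hom G GL" and inj_rho: "inj_on \<rho> (carrier G)"
begin

sublocale group G
  using lie by (simp add: lie_group_def)

abbreviation T :: "'g topology" where "T \<equiv> topo G"

lemma topspace_T [simp]: "topspace T = carrier G"
  using lie by (simp add: lie_group_def)

lemma manifold: "smooth_manifold T (atlas G)"
  using lie by (simp add: lie_group_def)

lemma fd: "findim TYPE('e)"
  using manifold by (simp add: smooth_manifold_def findim_def)

lemma smooth_mult: "smooth_map (prod_topology T T) (prod_atlas (atlas G) (atlas G)) T (atlas G) (\<lambda>(x, y). x \<otimes>\<^bsub>G\<^esub> y)"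
  using lie by (simp add: lie_group_def)

lemma mult_cont: "continuous_map (prod_topology T T) T (\<lambda>(x, y). x \<otimes>\<^bsub>G\<^esub> y)"
  using smooth_mult unfolding smooth_map_def by (rule conjunct1)

lemma left_mult_cont:
  assumes "a \<in> carrier G"
  shows "continuous_map T T (\<lambda>x. a \<otimes>\<^bsub>G\<^esub> x)"
proof -
  have "continuous_map T (prod_topology T T) (\<lambda>x. (a, x))"
    using assms by (intro continuous_map_pairedI) auto
  from continuous_map_compose[OF this mult_cont] show ?thesis
    by (simp add: o_def)
qed

lemma mult_cont2:
  assumes "continuous_map X T f" "continuous_map X T g"
  shows "continuous_map X T (\<lambda>x. f x \<otimes>\<^bsub>G\<^esub> g x)"
proof -
  have "continuous_map X (prod_topology T T) (\<lambda>x. (f x, g x))"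
    using assms by (intro continuous_map_pairedI) auto
  from continuous_map_compose[OF this mult_cont] show ?thesis
    by (simp add: o_def)
qed

lemma chart:
  assumes "(U, \<phi>) \<in> atlas G"
  shows "openin T U" "open (\<phi> ` U)" "inj_on \<phi> U" "U \<subseteq> carrier G"
    "continuous_map (subtopology T U) euclidean \<phi>" "continuous_map (top_of_set (\<phi> ` U)) T (inv_into U \<phi>)"
proof -
  have c: "smooth_chart T (U, \<phi>)"
    using manifold assms unfolding smooth_manifold_def by simp
  then show oU: "openin T U" and "open (\<phi> ` U)"
    by (simp_all add: smooth_chart_def)
  show sub: "U \<subseteq> carrier G"
    using openin_subset[OF oU] by simp
  have ts: "topspace (subtopology T U) = U"
    using sub by auto
  have hm: "homeomorphic_map (subtopology T U) (top_of_set (\<phi> ` U)) \<phi>"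
    using c by (simp add: smooth_chart_def)
  then show inj: "inj_on \<phi> U"
    unfolding homeomorphic_map_def ts by (rule conjunct2)
  obtain g where g: "homeomorphic_maps (subtopology T U) (top_of_set (\<phi> ` U)) \<phi> g"
    using hm homeomorphic_map_maps by blast
  then show "continuous_map (subtopology T U) euclidean \<phi>"
    by (simp add: homeomorphic_maps_def continuous_map_in_subtopology)
  have "continuous_map (top_of_set (\<phi> ` U)) (subtopology T U) g"
    using g by (simp add: homeomorphic_maps_def)
  then have gc: "continuous_map (top_of_set (\<phi> ` U)) T g"
    by (simp add: continuous_map_in_subtopology)
  have "g y = inv_into U \<phi> y" if y: "y \<in> topspace (top_of_set (\<phi> ` U))" for y
  proof -
    obtain u where u: "u \<in> U" "y = \<phi> u"
      using y by auto
    moreover have "g (\<phi> u) = u"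
      using g u(1) ts unfolding homeomorphic_maps_def by blast
    ultimately show ?thesis
      using inj by simp
  qed
  then show "continuous_map (top_of_set (\<phi> ` U)) T (inv_into U \<phi>)"
    by (rule continuous_map_eq[OF gc])
qed

lemma chart_inverse:
  assumes "(U, \<phi>) \<in> atlas G"
  shows "g \<in> U \<Longrightarrow> inv_into U \<phi> (\<phi> g) = g" "x \<in> \<phi> ` U \<Longrightarrow> \<phi> (inv_into U \<phi> x) = x"
    "x \<in> \<phi> ` U \<Longrightarrow> inv_into U \<phi> x \<in> U"
  using chart(3)[OF assms] by (auto simp: f_inv_into_f inv_into_into)

lemma open_chart_preimage:
  assumes "(U, \<phi>) \<in> atlas G" "openin T W"
  shows "open {x \<in> \<phi> ` U. inv_into U \<phi> x \<in> W}"
  using openin_continuous_map_preimage[OF chart(6)[OF assms(1)] assms(2)] chart(2)[OF assms(1)]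
  by (simp add: openin_open_eq)

lemma openin_chart_preimage:
  assumes "(U, \<phi>) \<in> atlas G" "open V"
  shows "openin T {g \<in> U. \<phi> g \<in> V}"
proof -
  have "topspace (subtopology T U) = U"
    using chart(4)[OF assms(1)] by auto
  then have "openin (subtopology T U) {g \<in> U. \<phi> g \<in> V}"
    using openin_continuous_map_preimage[OF chart(5)[OF assms(1)], of V] assms(2) by simp
  then show ?thesis
    using chart(1)[OF assms(1)] by (simp add: openin_open_subtopology)
qed

text \<open>Multiplication in coordinates: the first factor and the product are read in chart
  \<open>c\<close>, the second factor in \<open>d\<close>. This suits right multiplication by
  elements near the identity, with \<open>d\<close> the chart there.\<close>

definition cmult :: "'g set \<times> ('g \<Rightarrow> 'e) \<Rightarrow> 'g set \<times> ('g \<Rightarrow> 'e) \<Rightarrow> 'e \<times> 'e \<Rightarrow> 'e" where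
  "cmult c d = (\<lambda>(x, y). snd c (inv_into (fst c) (snd c) x \<otimes>\<^bsub>G\<^esub> inv_into (fst d) (snd d) y))"

definition cdom :: "'g set \<times> ('g \<Rightarrow> 'e) \<Rightarrow> 'g set \<times> ('g \<Rightarrow> 'e) \<Rightarrow> ('e \<times> 'e) set" where
  "cdom c d = {(x, y) \<in> (snd c ` fst c) \<times> (snd d ` fst d).
      inv_into (fst c) (snd c) x \<otimes>\<^bsub>G\<^esub> inv_into (fst d) (snd d) y \<in> fst c}"

lemma open_cdom:
  assumes "c \<in> atlas G" "d \<in> atlas G"
  shows "open (cdom c d)"
proof -
  obtain V \<xi> U \<phi> where cd: "c = (V, \<xi>)" "d = (U, \<phi>)" by (cases c, cases d)
  have c: "(V, \<xi>) \<in> atlas G" and d: "(U, \<phi>) \<in> atlas G"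
    using assms cd by auto
  let ?A = "\<xi> ` V" and ?B = "\<phi> ` U"
  have c1: "continuous_map (top_of_set (?A \<times> ?B)) T (\<lambda>p. inv_into V \<xi> (fst p))"
    using continuous_map_compose[OF continuous_map_fst chart(6)[OF c], of "top_of_set ?B"] by (simp add: o_def)
  have c2: "continuous_map (top_of_set (?A \<times> ?B)) T (\<lambda>p. inv_into U \<phi> (snd p))"
    using continuous_map_compose[OF continuous_map_snd chart(6)[OF d], of "top_of_set ?A"] by (simp add: o_def)
  have "openin (top_of_set (?A \<times> ?B)) {p \<in> topspace (top_of_set (?A \<times> ?B)).
      inv_into V \<xi> (fst p) \<otimes>\<^bsub>G\<^esub> inv_into U \<phi> (snd p) \<in> V}"
    by (rule openin_continuous_map_preimage[OF mult_cont2[OF c1 c2] chart(1)[OF c]])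
  moreover have "{p \<in> topspace (top_of_set (?A \<times> ?B)).
      inv_into V \<xi> (fst p) \<otimes>\<^bsub>G\<^esub> inv_into U \<phi> (snd p) \<in> V} = cdom c d"
    unfolding cdom_def cd by auto
  ultimately show ?thesis
    using open_Times[OF chart(2)[OF c] chart(2)[OF d]] by (simp add: openin_open_eq)
qed

lemma smooth_cmult:
  assumes "c \<in> atlas G" "d \<in> atlas G"
  shows "Ck_on k (cdom c d) (cmult c d)"
proof -
  obtain V \<xi> U \<phi> where cd: "c = (V, \<xi>)" "d = (U, \<phi>)" by (cases c, cases d)
  have c: "(V, \<xi>) \<in> atlas G" and d: "(U, \<phi>) \<in> atlas G"
    using assms cd by auto
  have pa: "(V \<times> U, map_prod \<xi> \<phi>) \<in> prod_atlas (atlas G) (atlas G)"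
    unfolding prod_atlas_def using c d by blast
  let ?m = "\<lambda>(x, y). x \<otimes>\<^bsub>G\<^esub> y"
  have "\<forall>(U1, \<phi>1)\<in>prod_atlas (atlas G) (atlas G). \<forall>(V1, \<psi>1)\<in>atlas G.
      smooth_on (\<phi>1 ` (U1 \<inter> ?m -` V1)) (\<psi>1 \<circ> ?m \<circ> inv_into U1 \<phi>1)"
    using smooth_mult unfolding smooth_map_def by (rule conjunct2)
  from bspec[OF this pa] have "\<forall>(V1, \<psi>1)\<in>atlas G.
      smooth_on (map_prod \<xi> \<phi> ` (V \<times> U \<inter> ?m -` V1)) (\<psi>1 \<circ> ?m \<circ> inv_into (V \<times> U) (map_prod \<xi> \<phi>))"
    by simp
  from bspec[OF this c] have s: "Ck_on k (map_prod \<xi> \<phi> ` (V \<times> U \<inter> ?m -` V)) (\<xi> \<circ> ?m \<circ> inv_into (V \<times> U) (map_prod \<xi> \<phi>))"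
    by (simp add: smooth_on_def)
  have inv: "inv_into (V \<times> U) (map_prod \<xi> \<phi>) (x, y) = (inv_into V \<xi> x, inv_into U \<phi> y)" if "(x, y) \<in> cdom c d" for x y
    using that chart(3)[OF c] chart(3)[OF d] by (intro inv_into_map_prod) (auto simp: cdom_def cd)
  have "cdom c d \<subseteq> map_prod \<xi> \<phi> ` (V \<times> U \<inter> ?m -` V)"
  proof
    fix p assume p: "p \<in> cdom c d"
    obtain x y where xy: "p = (x, y)" by (cases p)
    have q: "x \<in> \<xi> ` V" "y \<in> \<phi> ` U" "inv_into V \<xi> x \<otimes>\<^bsub>G\<^esub> inv_into U \<phi> y \<in> V"
      using p by (simp_all add: cdom_def cd xy)
    have "p = map_prod \<xi> \<phi> (inv_into V \<xi> x, inv_into U \<phi> y)"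
      using q chart_inverse(2)[OF c] chart_inverse(2)[OF d] by (simp add: xy)
    moreover have "(inv_into V \<xi> x, inv_into U \<phi> y) \<in> V \<times> U \<inter> ?m -` V"
      using q chart_inverse(3)[OF c] chart_inverse(3)[OF d] by simp
    ultimately show "p \<in> map_prod \<xi> \<phi> ` (V \<times> U \<inter> ?m -` V)"
      by (rule image_eqI)
  qed
  from Ck_on_subset[OF s this] show ?thesis
  proof (rule Ck_on_cong[OF open_cdom[OF assms], rotated])
    fix p assume p: "p \<in> cdom c d"
    obtain x y where xy: "p = (x, y)" by (cases p)
    show "(\<xi> \<circ> ?m \<circ> inv_into (V \<times> U) (map_prod \<xi> \<phi>)) p = cmult c d p"
      using inv p by (simp add: xy cmult_def cd)
  qed
qed

definition chart1 :: "'g set \<times> ('g \<Rightarrow> 'e)" where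
  "chart1 = (SOME c. c \<in> atlas G \<and> \<one>\<^bsub>G\<^esub> \<in> fst c)"

definition "U1 = fst chart1"
definition "\<phi>1 = snd chart1"
definition "\<psi>1 = inv_into U1 \<phi>1"
definition "x0 = \<phi>1 \<one>\<^bsub>G\<^esub>"
definition "O1 = \<phi>1 ` U1"

lemma chart1: "(U1, \<phi>1) \<in> atlas G" "\<one>\<^bsub>G\<^esub> \<in> U1" "chart1 = (U1, \<phi>1)"
proof -
  have "(\<Union>(U, \<phi>)\<in>atlas G. U) = carrier G"
    using manifold unfolding smooth_manifold_def by simp
  then have "\<one>\<^bsub>G\<^esub> \<in> (\<Union>(U, \<phi>)\<in>atlas G. U)"
    by simp
  then have "\<exists>c. c \<in> atlas G \<and> \<one>\<^bsub>G\<^esub> \<in> fst c"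
    by force
  from someI_ex[OF this] have "chart1 \<in> atlas G \<and> \<one>\<^bsub>G\<^esub> \<in> fst chart1"
    unfolding chart1_def .
  then show "(U1, \<phi>1) \<in> atlas G" "\<one>\<^bsub>G\<^esub> \<in> U1" "chart1 = (U1, \<phi>1)"
    by (simp_all add: U1_def \<phi>1_def)
qed

lemma psi1: "g \<in> U1 \<Longrightarrow> \<psi>1 (\<phi>1 g) = g" "x \<in> O1 \<Longrightarrow> \<phi>1 (\<psi>1 x) = x" "x \<in> O1 \<Longrightarrow> \<psi>1 x \<in> U1"
  "x \<in> O1 \<Longrightarrow> \<psi>1 x \<in> carrier G"
  using chart_inverse[OF chart1(1)] chart(4)[OF chart1(1)] by (auto simp: \<psi>1_def O1_def)

lemma open_O1: "open O1" and x0_O1: "x0 \<in> O1" and psi1_x0: "\<psi>1 x0 = \<one>\<^bsub>G\<^esub>"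
  using chart(2)[OF chart1(1)] chart1(2) psi1(1) by (auto simp: O1_def x0_def)

section \<open>The representation in the chart at the identity\<close>

definition "r g = cmat_of_real (\<rho> g)"

lemma rho_hom: "\<rho> \<in> hom G GL"
  using rho by (simp add: lie_hom_def)

lemma rho_mult: "x \<in> carrier G \<Longrightarrow> y \<in> carrier G \<Longrightarrow> \<rho> (x \<otimes>\<^bsub>G\<^esub> y) = \<rho> x ** \<rho> y"
  using hom_mult[OF rho_hom] by (simp add: GL_def)

lemma rho_invertible: "x \<in> carrier G \<Longrightarrow> invertible (\<rho> x)"
  using hom_in_carrier[OF rho_hom] by (simp add: GL_def)

lemma rho_one: "\<rho> \<one>\<^bsub>G\<^esub> = mat 1"
proof -
  have "\<rho> \<one>\<^bsub>G\<^esub> ** \<rho> \<one>\<^bsub>G\<^esub> = \<rho> \<one>\<^bsub>G\<^esub>"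
    using rho_mult[of "\<one>\<^bsub>G\<^esub>" "\<one>\<^bsub>G\<^esub>"] by simp
  moreover obtain B where "\<rho> \<one>\<^bsub>G\<^esub> ** B = mat 1"
    using rho_invertible[of "\<one>\<^bsub>G\<^esub>"] by (auto simp: invertible_def)
  ultimately show ?thesis
    by (metis matrix_mul_assoc matrix_mul_rid)
qed

lemma r_mult: "x \<in> carrier G \<Longrightarrow> y \<in> carrier G \<Longrightarrow> r (x \<otimes>\<^bsub>G\<^esub> y) = r x * r y"
  by (simp add: r_def rho_mult cmat_of_real_mult)

lemma r_one [simp]: "r \<one>\<^bsub>G\<^esub> = 1"
  by (simp add: r_def rho_one cmat_of_real_mat_1)

lemma r_pow: "x \<in> carrier G \<Longrightarrow> r (x [^]\<^bsub>G\<^esub> (k::nat)) = r x ^ k"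
  by (induction k) (simp_all add: r_mult power_commutes)

lemma inj_r: "inj_on r (carrier G)"
  using inj_rho by (auto simp: inj_on_def r_def cmat_of_real_inject)

lemma cnj_mat_r: "cnj_mat (r g) = r g"
  by (simp add: r_def cnj_mat_cmat_of_real)

definition "f x = r (\<psi>1 x)"

lemma f_smooth: "Ck_on k O1 f"
proof -
  have "\<forall>(U, \<phi>)\<in>atlas G. \<forall>(V, \<psi>)\<in>atlas (GL :: (real^'n^'n, real^'n^'n) lie_struct).
      smooth_on (\<phi> ` (U \<inter> \<rho> -` V)) (\<psi> \<circ> \<rho> \<circ> inv_into U \<phi>)"
    using rho by (simp add: lie_hom_def smooth_map_def)
  from bspec[OF this chart1(1)] have "smooth_on (\<phi>1 ` (U1 \<inter> \<rho> -` {M. invertible M})) (id \<circ> \<rho> \<circ> inv_into U1 \<phi>1)"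
    by (simp add: GL_def)
  moreover have "U1 \<inter> \<rho> -` {M. invertible M} = U1"
    using chart(4)[OF chart1(1)] rho_invertible by auto
  ultimately have "Ck_on k O1 (\<lambda>x. \<rho> (\<psi>1 x))"
    by (simp add: smooth_on_def O1_def \<psi>1_def o_def)
  from Ck_on_bounded_linear[OF bounded_linear_cmat_of_real this] show ?thesis
    by (simp add: f_def[abs_def] r_def)
qed

lemma f_x0 [simp]: "f x0 = 1"
  by (simp add: f_def psi1_x0)

lemma inj_f: "inj_on f O1"
proof (rule inj_onI)
  fix x y assume a: "x \<in> O1" "y \<in> O1" "f x = f y"
  then have "\<psi>1 x = \<psi>1 y"
    using inj_onD[OF inj_r] psi1(4) by (simp add: f_def)
  then show "x = y"
    using psi1(2) a by metis
qed

text \<open>The differential of the representation at the identity; its range is the Lie algebra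
  realized by matrices.\<close>

definition "A = (SOME D. (f has_derivative D) (at x0))"

lemma A: "(f has_derivative A) (at x0)"
proof -
  obtain f' where "\<forall>x\<in>O1. (f has_derivative f' x) (at x)" "\<forall>v. Ck_on 0 O1 (\<lambda>x. f' x v)"
    using f_smooth[of "Suc 0"] by (rule Ck_on_SucE)
  then have "\<exists>D. (f has_derivative D) (at x0)"
    using x0_O1 by blast
  from someI_ex[OF this] show ?thesis
    unfolding A_def .
qed

lemma A_linear: "bounded_linear A"
  using A has_derivative_bounded_linear by blast

text \<open>Strict differentiability of the multiplication at \<open>(x0, x0)\<close> is applied to
  the pairs \<open>(x, y)\<close> and \<open>(x, x0)\<close>. They differ only in the second entry,
  where the derivative is the identity because \<open>x0\<close> represents the neutral element. The
  error is relative to \<open>y - x0\<close> and uniform in \<open>x\<close>, so it can be summed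
  over many factors.\<close>

lemma mult_near:
  assumes "\<eta> > 0"
  obtains \<delta> where "\<delta> > 0" "ball x0 \<delta> \<subseteq> O1"
    "\<forall>x\<in>ball x0 \<delta>. \<forall>y\<in>ball x0 \<delta>. \<psi>1 x \<otimes>\<^bsub>G\<^esub> \<psi>1 y \<in> U1 \<and>
        norm (\<phi>1 (\<psi>1 x \<otimes>\<^bsub>G\<^esub> \<psi>1 y) - x - (y - x0)) \<le> \<eta> * norm (y - x0)"
proof -
  define M where "M = cmult chart1 chart1"
  define W where "W = cdom chart1 chart1"
  have M: "M (x, y) = \<phi>1 (\<psi>1 x \<otimes>\<^bsub>G\<^esub> \<psi>1 y)" for x y
    by (simp add: M_def cmult_def chart1(3) \<psi>1_def)
  have W: "(x, y) \<in> W \<longleftrightarrow> x \<in> O1 \<and> y \<in> O1 \<and> \<psi>1 x \<otimes>\<^bsub>G\<^esub> \<psi>1 y \<in> U1" for x y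
    by (simp add: W_def cdom_def chart1(3) \<psi>1_def O1_def)
  have at: "chart1 \<in> atlas G"
    using chart1(1,3) by simp
  have oW: "open W" and CW: "Ck_on k W M" for k
    unfolding M_def W_def using open_cdom[OF at at] smooth_cmult[OF at at] by auto
  have p0: "(x0, x0) \<in> W"
    by (simp add: W x0_O1 psi1_x0 chart1(2))
  obtain M' where M': "\<forall>p\<in>W. (M has_derivative M' p) (at p)" "\<forall>v. Ck_on 0 W (\<lambda>p. M' p v)"
    using CW[of "Suc 0"] by (rule Ck_on_SucE)
  have D: "(M has_derivative M' (x0, x0)) (at (x0, x0))"
    using M'(1) p0 by blast
  have D2: "M' (x0, x0) (0, u) = u" for u
  proof -
    have "((\<lambda>y. (x0, y)) has_derivative (\<lambda>u. (0, u))) (at x0)"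
      by (auto intro!: derivative_eq_intros)
    from has_derivative_compose[OF this D] have "((\<lambda>y. M (x0, y)) has_derivative (\<lambda>u. M' (x0, x0) (0, u))) (at x0)" .
    moreover have "((\<lambda>y. M (x0, y)) has_derivative (\<lambda>u. u)) (at x0)"
    proof (rule has_derivative_transform_within_open[OF has_derivative_ident open_O1 x0_O1])
      fix y assume "y \<in> O1"
      then show "y = M (x0, y)"
        using psi1 by (simp add: M psi1_x0)
    qed
    ultimately have "(\<lambda>u. M' (x0, x0) (0, u)) = (\<lambda>u. u)"
      by (rule has_derivative_unique)
    then show ?thesis by metis
  qed
  obtain \<delta> where \<delta>: "\<delta> > 0" "ball (x0, x0) \<delta> \<subseteq> W"
    "\<forall>p\<in>ball (x0, x0) \<delta>. \<forall>q\<in>ball (x0, x0) \<delta>. norm (M p - M q - M' (x0, x0) (p - q)) \<le> \<eta> * norm (p - q)"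
    using CW[of 1] by (rule strictly_differentiable[OF findim_prod[OF fd fd] oW p0 _ D assms])
  have b: "(x, y) \<in> ball (x0, x0) \<delta>" if "x \<in> ball x0 (\<delta> / 2)" "y \<in> ball x0 (\<delta> / 2)" for x y
  proof -
    have "dist (x0, x0) (x, y) \<le> dist x0 x + dist x0 y"
      unfolding dist_Pair_Pair by (rule sqrt_sum_squares_le_sum) auto
    then show ?thesis
      using that by simp
  qed
  have bO: "x \<in> O1" if "x \<in> ball x0 (\<delta> / 2)" for x
    using b[OF that, of x0] \<delta>(1,2) W by fastforce
  show thesis
  proof (rule that[of "\<delta> / 2"])
    show "\<delta> / 2 > 0" using \<delta>(1) by simp
    show "ball x0 (\<delta> / 2) \<subseteq> O1" using bO by blast
    show "\<forall>x\<in>ball x0 (\<delta> / 2). \<forall>y\<in>ball x0 (\<delta> / 2). \<psi>1 x \<otimes>\<^bsub>G\<^esub> \<psi>1 y \<in> U1 \<and>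
        norm (\<phi>1 (\<psi>1 x \<otimes>\<^bsub>G\<^esub> \<psi>1 y) - x - (y - x0)) \<le> \<eta> * norm (y - x0)"
    proof (intro ballI)
      fix x y assume xy: "x \<in> ball x0 (\<delta> / 2)" "y \<in> ball x0 (\<delta> / 2)"
      have x0b: "x0 \<in> ball x0 (\<delta> / 2)" using \<delta>(1) by simp
      have "(x, y) \<in> W"
        using b[OF xy] \<delta>(2) by blast
      then have "\<psi>1 x \<otimes>\<^bsub>G\<^esub> \<psi>1 y \<in> U1"
        by (simp add: W)
      moreover have "norm (M (x, y) - M (x, x0) - M' (x0, x0) ((x, y) - (x, x0))) \<le> \<eta> * norm ((x, y) - (x, x0))"
        using \<delta>(3) b[OF xy] b[OF xy(1) x0b] by blast
      moreover have "M (x, x0) = x"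
        using psi1 bO[OF xy(1)] by (simp add: M psi1_x0)
      ultimately show "\<psi>1 x \<otimes>\<^bsub>G\<^esub> \<psi>1 y \<in> U1 \<and>
        norm (\<phi>1 (\<psi>1 x \<otimes>\<^bsub>G\<^esub> \<psi>1 y) - x - (y - x0)) \<le> \<eta> * norm (y - x0)"
        by (simp add: D2 M norm_Pair)
    qed
  qed
qed

text \<open>The Euler polygon with steps \<open>v / k\<close> converges, by compactness, to the exponential.\<close>

lemma exp_in_chart:
  assumes "0 < \<eta>" "\<eta> \<le> 1/2"
  obtains \<delta> where "\<delta> > 0" "\<forall>v. norm v < \<delta> \<longrightarrow> (\<exists>c\<in>O1. norm (c - x0 - v) \<le> \<eta> * norm v \<and> f c = exp (A v))"
proof -
  obtain d where d: "d > 0" "ball x0 d \<subseteq> O1"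
    and near: "\<forall>x\<in>ball x0 d. \<forall>y\<in>ball x0 d. \<psi>1 x \<otimes>\<^bsub>G\<^esub> \<psi>1 y \<in> U1 \<and>
        norm (\<phi>1 (\<psi>1 x \<otimes>\<^bsub>G\<^esub> \<psi>1 y) - x - (y - x0)) \<le> \<eta> * norm (y - x0)"
    by (rule mult_near[OF assms(1)])
  have "\<exists>c\<in>O1. norm (c - x0 - v) \<le> \<eta> * norm v \<and> f c = exp (A v)" if v: "norm v < d / 2" for v
  proof -
    define g where "g = (\<lambda>k::nat. \<psi>1 (x0 + v /\<^sub>R real k))"
    have yb: "x0 + v /\<^sub>R real k \<in> ball x0 d" if "k > 0" for k
    proof -
      have "norm (v /\<^sub>R real k) \<le> norm v"
        using that mult_right_mono[of "inverse (real k)" 1 "norm v"] by (simp add: inverse_le_1_iff)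
      moreover have "norm v < d"
        using v norm_ge_zero[of v] by linarith
      ultimately show ?thesis
        by (simp only: mem_ball dist_norm) (simp add: norm_minus_commute)
    qed
    have gG: "g k \<in> carrier G" if "k > 0" for k
      unfolding g_def using yb[OF that] d(2) psi1(4) by blast
    \<comment> \<open>Each factor adds an error of at most \<open>\<eta> * norm v / real k\<close>,
      so after \<open>j\<close> steps the error is linear in \<open>j\<close> and the powers do not
      leave the chart.\<close>
    have poly: "g k [^]\<^bsub>G\<^esub> j \<in> U1 \<and> norm (\<phi>1 (g k [^]\<^bsub>G\<^esub> j) - x0 - (real j / real k) *\<^sub>R v) \<le> (real j / real k) * \<eta> * norm v"
      if k: "k > 0" and j: "j \<le> k" for j k :: nat
      using j
    proof (induction j)
      case 0
      then show ?case
        by (simp add: chart1(2) x0_def)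
    next
      case (Suc j)
      define x where "x = \<phi>1 (g k [^]\<^bsub>G\<^esub> j)"
      have IH: "g k [^]\<^bsub>G\<^esub> j \<in> U1" "norm (x - x0 - (real j / real k) *\<^sub>R v) \<le> (real j / real k) * \<eta> * norm v"
        using Suc by (auto simp: x_def)
      have jk: "real j / real k \<le> 1"
        using Suc.prems k by simp
      \<comment> \<open>\<open>\<eta> \<le> 1/2\<close> and \<open>norm v < d / 2\<close> keep the
        polygon at distance less than \<open>d\<close> from \<open>x0\<close>, where the estimate
        \<open>near\<close> applies.\<close>
      have "norm (x - x0) \<le> norm (x - x0 - (real j / real k) *\<^sub>R v) + norm ((real j / real k) *\<^sub>R v)"
        using norm_triangle_ineq[of "x - x0 - (real j / real k) *\<^sub>R v" "(real j / real k) *\<^sub>R v"] by simp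
      also have "\<dots> \<le> (real j / real k) * (\<eta> * norm v) + (real j / real k) * norm v"
        using IH(2) by (simp add: mult.assoc)
      also have "\<dots> \<le> 1 * (\<eta> * norm v) + 1 * norm v"
        using jk assms by (intro add_mono mult_right_mono) auto
      also have "\<dots> \<le> 1/2 * norm v + norm v"
        using mult_right_mono[OF assms(2), of "norm v"] by simp
      also have "\<dots> < d"
        using v norm_ge_zero[of v] by linarith
      finally have xb: "x \<in> ball x0 d"
        by (simp add: dist_norm norm_minus_commute)
      have psix: "\<psi>1 x = g k [^]\<^bsub>G\<^esub> j"
        unfolding x_def by (rule psi1(1)[OF IH(1)])
      have "\<psi>1 x \<otimes>\<^bsub>G\<^esub> \<psi>1 (x0 + v /\<^sub>R real k) = g k [^]\<^bsub>G\<^esub> Suc j"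
        unfolding psix by (simp add: g_def)
      then have n: "g k [^]\<^bsub>G\<^esub> Suc j \<in> U1"
        "norm (\<phi>1 (g k [^]\<^bsub>G\<^esub> Suc j) - x - v /\<^sub>R real k) \<le> \<eta> * norm (v /\<^sub>R real k)"
        using near[rule_format, OF xb yb[OF k]] by simp_all
      have "(real (Suc j) / real k) *\<^sub>R v = v /\<^sub>R real k + (real j / real k) *\<^sub>R v"
        by (simp add: add_divide_distrib inverse_eq_divide flip: scaleR_add_left)
      then have "\<phi>1 (g k [^]\<^bsub>G\<^esub> Suc j) - x0 - (real (Suc j) / real k) *\<^sub>R v
          = (\<phi>1 (g k [^]\<^bsub>G\<^esub> Suc j) - x - v /\<^sub>R real k) + (x - x0 - (real j / real k) *\<^sub>R v)"
        by (simp add: algebra_simps)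
      also have "norm \<dots> \<le> \<eta> * norm (v /\<^sub>R real k) + (real j / real k) * \<eta> * norm v"
        by (intro order_trans[OF norm_triangle_ineq] add_mono n IH)
      also have "\<dots> = (real (Suc j) / real k) * \<eta> * norm v"
        by (simp add: add_divide_distrib divide_inverse distrib_right distrib_left mult_ac)
      finally show ?case
        using n(1) by blast
    qed
    define c where "c = (\<lambda>k. \<phi>1 (g (Suc k) [^]\<^bsub>G\<^esub> Suc k))"
    have cU: "g (Suc k) [^]\<^bsub>G\<^esub> Suc k \<in> U1" and cn: "norm (c k - x0 - v) \<le> \<eta> * norm v" for k
      using poly[of "Suc k" "Suc k"] by (simp_all add: c_def del: nat_pow_Suc)
    have "c k \<in> cball (x0 + v) (\<eta> * norm v)" for k
      using cn[of k] by (simp add: dist_norm norm_minus_commute algebra_simps)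
    \<comment> \<open>All end points of the polygons lie in one compact ball; being closed, it
      passes the estimate on to a limit point.\<close>
    then obtain l s where l: "l \<in> cball (x0 + v) (\<eta> * norm v)" and s: "strict_mono s" "(c \<circ> s) \<longlonglongrightarrow> l"
      using compact_cball_findim[OF fd] unfolding compact_def by metis
    have ln: "norm (l - x0 - v) \<le> \<eta> * norm v"
      using l by (simp add: dist_norm norm_minus_commute algebra_simps)
    have "norm (l - x0) \<le> norm (l - x0 - v) + norm v"
      using norm_triangle_ineq[of "l - x0 - v" v] by simp
    also have "\<dots> \<le> 1/2 * norm v + norm v"
      using ln mult_right_mono[OF assms(2), of "norm v"] by simp
    also have "\<dots> < d"
      using v norm_ge_zero[of v] by linarith
    finally have lO: "l \<in> O1"
      using d(2) by (auto simp: dist_norm norm_minus_commute)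
    have "isCont f l"
      using Ck_on_imp_continuous_on[OF f_smooth] open_O1 lO by (simp add: continuous_on_eq_continuous_at)
    then have lim1: "(\<lambda>k. f ((c \<circ> s) k)) \<longlonglongrightarrow> f l"
      using s(2) by (rule isCont_tendsto_compose)
    have fc: "f (c k) = f (x0 + v /\<^sub>R real (Suc k)) ^ Suc k" for k
      unfolding f_def c_def psi1(1)[OF cU] r_pow[OF gG[OF zero_less_Suc]] by (simp add: g_def)
    \<comment> \<open>The difference quotients of \<open>f\<close> along \<open>v\<close> at times
      \<open>1 / real k\<close> have the form required by \<open>power_tendsto_exp\<close>.\<close>
    have "((\<lambda>t. x0 + t *\<^sub>R v) has_derivative (\<lambda>t. t *\<^sub>R v)) (at 0)"
      by (auto intro!: derivative_eq_intros)
    moreover have "(f has_derivative A) (at (x0 + 0 *\<^sub>R v))"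
      using A by simp
    ultimately have "((\<lambda>t. f (x0 + t *\<^sub>R v)) has_derivative (\<lambda>t. A (t *\<^sub>R v))) (at 0)"
      by (rule has_derivative_compose)
    then have "((\<lambda>t. f (x0 + t *\<^sub>R v)) has_vector_derivative A v) (at 0)"
      by (simp add: has_vector_derivative_def linear_cmul[OF bounded_linear.linear[OF A_linear]])
    then have "((\<lambda>t. (f (x0 + t *\<^sub>R v) - 1) /\<^sub>R t) \<longlongrightarrow> A v) (at 0)"
      using vector_derivative_quotient[of "\<lambda>t. f (x0 + t *\<^sub>R v)" "A v" 0] by simp
    then have "(\<lambda>k. (f (x0 + (1 / real (Suc k)) *\<^sub>R v) - 1) /\<^sub>R (1 / real (Suc k))) \<longlonglongrightarrow> A v"
    proof (rule filterlim_compose)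
      show "filterlim (\<lambda>k. 1 / real (Suc k)) (at 0) sequentially"
        unfolding filterlim_at by (intro conjI LIMSEQ_Suc[OF lim_1_over_n]) simp
    qed
    then have "(\<lambda>k. real (Suc k) *\<^sub>R (f (x0 + v /\<^sub>R real (Suc k)) - 1)) \<longlonglongrightarrow> A v"
      by (simp add: divide_inverse)
    then have "(\<lambda>k. real k *\<^sub>R (f (x0 + v /\<^sub>R real k) - 1)) \<longlonglongrightarrow> A v"
      by (rule LIMSEQ_imp_Suc)
    then have "(\<lambda>k. f (x0 + v /\<^sub>R real k) ^ k) \<longlonglongrightarrow> exp (A v)"
      by (rule power_tendsto_exp)
    then have "(\<lambda>k. f (c k)) \<longlonglongrightarrow> exp (A v)"
      unfolding fc by (rule LIMSEQ_Suc)
    then have "(\<lambda>k. f ((c \<circ> s) k)) \<longlonglongrightarrow> exp (A v)"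
      using LIMSEQ_subseq_LIMSEQ[OF _ s(1)] by (fastforce simp: o_def)
    then have "f l = exp (A v)"
      using lim1 LIMSEQ_unique by blast
    with lO ln show ?thesis by blast
  qed
  then show thesis
    using d(1) that[of "d / 2"] by simp
qed

text \<open>For small \<open>t\<close> the matrix \<open>exp (A (t *\<^sub>R v))\<close> is 1, so by
  injectivity of \<open>f\<close> the chart point representing it is \<open>x0\<close>. That point
  is also within \<open>1/2 * norm (t *\<^sub>R v)\<close> of \<open>x0 + t *\<^sub>R v\<close>,
  which forces \<open>v = 0\<close>.\<close>

lemma A_inj:
  assumes "A v = 0"
  shows "v = 0"
proof -
  obtain \<delta> where \<delta>: "\<delta> > 0" "\<forall>v. norm v < \<delta> \<longrightarrow> (\<exists>c\<in>O1. norm (c - x0 - v) \<le> 1/2 * norm v \<and> f c = exp (A v))"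
    by (rule exp_in_chart[of "1/2"]) auto
  define t where "t = \<delta> / (2 * (norm v + 1))"
  have t: "t > 0"
    using \<delta>(1) norm_ge_zero[of v] by (auto simp: t_def intro!: divide_pos_pos add_nonneg_pos)
  have "norm (t *\<^sub>R v) < \<delta>"
  proof -
    have "\<delta> * norm v < \<delta> * (2 * (norm v + 1))"
      using \<delta>(1) norm_ge_zero[of v] by (intro mult_strict_left_mono) (auto simp: algebra_simps add_nonneg_pos)
    then have "\<delta> * norm v / (2 * (norm v + 1)) < \<delta>"
      using norm_ge_zero[of v] by (simp add: pos_divide_less_eq add_nonneg_pos)
    moreover have "norm (t *\<^sub>R v) = \<delta> * norm v / (2 * (norm v + 1))"
      using t \<delta>(1) by (simp add: t_def)
    ultimately show ?thesis by simp
  qed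
  then obtain c where c: "c \<in> O1" "norm (c - x0 - t *\<^sub>R v) \<le> 1/2 * norm (t *\<^sub>R v)" "f c = exp (A (t *\<^sub>R v))"
    using \<delta>(2) by blast
  have "f c = f x0"
    using c(3) assms by (simp add: linear_cmul[OF bounded_linear.linear[OF A_linear]])
  then have "c = x0"
    using inj_onD[OF inj_f] c(1) x0_O1 by blast
  then show ?thesis
    using c(2) t by simp
qed

end

section \<open>The exponential map in the chart at the identity\<close>

context linear_lie
begin

lemma A_lin: "linear A"
  by (rule bounded_linear.linear[OF A_linear])

text \<open>The exponential map of \<open>G\<close> in coordinates, obtained by inverting the
  injective \<open>f\<close>; by \<open>exp_in_chart\<close> this is meaningful for small
  \<open>v\<close>.\<close>

definition "exp_coord v = inv_into O1 f (exp (A v))"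

lemma exp_coord_exp:
  obtains \<delta> where "\<delta> > 0"
    "\<forall>v. norm v < \<delta> \<longrightarrow> exp_coord v \<in> O1 \<and> f (exp_coord v) = exp (A v) \<and> norm (exp_coord v - x0 - v) \<le> 1/2 * norm v"
proof -
  obtain \<delta> where \<delta>: "\<delta> > 0" "\<forall>v. norm v < \<delta> \<longrightarrow> (\<exists>c\<in>O1. norm (c - x0 - v) \<le> 1/2 * norm v \<and> f c = exp (A v))"
    by (rule exp_in_chart[of "1/2"]) auto
  show thesis
  proof (rule that[OF \<delta>(1)], intro allI impI)
    fix v :: 'e assume "norm v < \<delta>"
    then obtain c where c: "c \<in> O1" "norm (c - x0 - v) \<le> 1/2 * norm v" "f c = exp (A v)"
      using \<delta>(2) by blast
    have "exp_coord v = c"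
      unfolding exp_coord_def c(3)[symmetric] by (rule inv_into_f_f[OF inj_f c(1)])
    then show "exp_coord v \<in> O1 \<and> f (exp_coord v) = exp (A v) \<and> norm (exp_coord v - x0 - v) \<le> 1/2 * norm v"
      using c by simp
  qed
qed

lemma exp_coord_0: "exp_coord 0 = x0"
  unfolding exp_coord_def linear_0[OF A_lin] exp_zero f_x0[symmetric] by (rule inv_into_f_f[OF inj_f x0_O1])

text \<open>\<open>f\<close> and \<open>exp\<close> are both strictly differentiable, and
  \<open>f (exp_coord v) = exp (A v)\<close>. Comparing increments bounds \<open>A\<close> of the
  deviation, and \<open>A\<close> is bounded below. The case 1/2 serves surjectivity, arbitrary
  \<open>\<eta>\<close> the derivative at 0.\<close>

lemma exp_coord_near_id:
  assumes \<eta>: "\<eta> > 0"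
  obtains R where "R > 0" "\<forall>v\<in>ball 0 R. exp_coord v \<in> O1 \<and> f (exp_coord v) = exp (A v)"
    "\<forall>v\<in>ball 0 R. \<forall>w\<in>ball 0 R. norm (exp_coord v - exp_coord w - (v - w)) \<le> \<eta> * norm (v - w)"
proof -
  obtain \<kappa> where \<kappa>: "\<kappa> > 0" "\<forall>v. \<kappa> * norm v \<le> norm (A v)"
    using A_inj by (rule linear_inj_bounded_below[OF fd A_linear])
  obtain K where K: "K > 0" "\<forall>v. norm (A v) \<le> norm v * K"
    using bounded_linear.pos_bounded[OF A_linear] by blast
  \<comment> \<open>The bound \<open>\<kappa> / 2\<close> lets half of the left side be absorbed at
    the end. The bound \<open>\<kappa> * \<eta> / 4\<close>, attained a second time through
    \<open>\<rho>1\<close>, makes the remaining errors add up to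
    \<open>\<kappa> * \<eta> / 2\<close> times \<open>norm (v - w)\<close>.\<close>
  define \<eta>1 where "\<eta>1 = min (\<kappa> / 2) (\<kappa> * \<eta> / 4)"
  have \<eta>1: "\<eta>1 > 0" "\<eta>1 \<le> \<kappa> / 2" "\<eta>1 \<le> \<kappa> * \<eta> / 4"
    using \<kappa>(1) \<eta> by (simp_all add: \<eta>1_def)
  define \<rho>1 where "\<rho>1 = ln (1 + \<kappa> * \<eta> / (4 * K))"
  have q: "\<kappa> * \<eta> / (4 * K) > 0"
    using \<kappa>(1) \<eta> K(1) by simp
  then have \<rho>1: "\<rho>1 > 0" and e\<rho>: "(exp \<rho>1 - 1) * K = \<kappa> * \<eta> / 4"
    using K(1) by (simp_all add: \<rho>1_def add_pos_pos)
  obtain \<delta>0 where \<delta>0: "\<delta>0 > 0"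
    "\<forall>v. norm v < \<delta>0 \<longrightarrow> exp_coord v \<in> O1 \<and> f (exp_coord v) = exp (A v) \<and> norm (exp_coord v - x0 - v) \<le> 1/2 * norm v"
    by (rule exp_coord_exp)
  obtain \<delta> where \<delta>: "\<delta> > 0" "ball x0 \<delta> \<subseteq> O1"
    "\<forall>p\<in>ball x0 \<delta>. \<forall>q\<in>ball x0 \<delta>. norm (f p - f q - A (p - q)) \<le> \<eta>1 * norm (p - q)"
    by (rule strictly_differentiable[OF fd open_O1 x0_O1 f_smooth A \<eta>1(1)])
  define R where "R = min \<delta>0 (min (\<delta> / 2) (\<rho>1 / K))"
  have R: "R > 0" "R \<le> \<delta>0" "R \<le> \<delta> / 2" "R \<le> \<rho>1 / K"
    using \<delta>0(1) \<delta>(1) \<rho>1 K(1) unfolding R_def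
    by (simp, simp, intro min.coboundedI2[OF min.cobounded1], intro min.coboundedI2[OF min.cobounded2])
  have near: "exp_coord v \<in> O1" "f (exp_coord v) = exp (A v)" "exp_coord v \<in> ball x0 \<delta>" "norm (A v) \<le> \<rho>1" if v: "v \<in> ball 0 R" for v
  proof -
    have vn: "norm v < R" using v by simp
    then have c: "exp_coord v \<in> O1" "f (exp_coord v) = exp (A v)" "norm (exp_coord v - x0 - v) \<le> 1/2 * norm v"
      using \<delta>0(2) R(2) by auto
    show "exp_coord v \<in> O1" "f (exp_coord v) = exp (A v)" by (rule c)+
    have "norm (exp_coord v - x0) \<le> norm (exp_coord v - x0 - v) + norm v"
      using norm_triangle_ineq[of "exp_coord v - x0 - v" v] by simp
    also have "\<dots> < \<delta>"
      using c(3) vn R(3) norm_ge_zero[of v] by linarith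
    finally show "exp_coord v \<in> ball x0 \<delta>"
      by (simp add: dist_norm norm_minus_commute)
    have "norm v * K \<le> \<rho>1 / K * K"
      using vn R(4) K(1) by (intro mult_right_mono) auto
    then show "norm (A v) \<le> \<rho>1"
      using K(2)[rule_format, of v] K(1) by simp
  qed
  show thesis
  proof (rule that[OF R(1)])
    show "\<forall>v\<in>ball 0 R. exp_coord v \<in> O1 \<and> f (exp_coord v) = exp (A v)"
      using near(1,2) by blast
    show "\<forall>v\<in>ball 0 R. \<forall>w\<in>ball 0 R. norm (exp_coord v - exp_coord w - (v - w)) \<le> \<eta> * norm (v - w)"
    proof (intro ballI)
      fix v w :: 'e assume vw: "v \<in> ball 0 R" "w \<in> ball 0 R"
      define \<Delta> where "\<Delta> = exp_coord v - exp_coord w"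
      have 1: "norm (f (exp_coord v) - f (exp_coord w) - A \<Delta>) \<le> \<eta>1 * norm \<Delta>"
        unfolding \<Delta>_def using \<delta>(3) near(3)[OF vw(1)] near(3)[OF vw(2)] by blast
      have "norm (exp (A v) - exp (A w) - (A v - A w)) \<le> (exp \<rho>1 - 1) * norm (A v - A w)"
        by (rule norm_exp_diff_le[OF near(4)[OF vw(1)] near(4)[OF vw(2)]])
      also have "A v - A w = A (v - w)"
        by (simp add: linear_diff[OF A_lin])
      also have "(exp \<rho>1 - 1) * norm (A (v - w)) \<le> (exp \<rho>1 - 1) * (norm (v - w) * K)"
        using \<rho>1 K(2) by (intro mult_left_mono) auto
      also have "\<dots> = ((exp \<rho>1 - 1) * K) * norm (v - w)"
        by simp
      finally have 2: "norm (exp (A v) - exp (A w) - A (v - w)) \<le> \<kappa> * \<eta> / 4 * norm (v - w)"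
        unfolding e\<rho> .
      have "\<kappa> * norm (\<Delta> - (v - w)) \<le> norm (A (\<Delta> - (v - w)))"
        using \<kappa>(2) by blast
      also have "A (\<Delta> - (v - w)) = (exp (A v) - exp (A w) - A (v - w)) - (f (exp_coord v) - f (exp_coord w) - A \<Delta>)"
        using near(2)[OF vw(1)] near(2)[OF vw(2)] by (simp add: linear_diff[OF A_lin])
      also have "norm \<dots> \<le> \<kappa> * \<eta> / 4 * norm (v - w) + \<eta>1 * norm \<Delta>"
        using norm_triangle_ineq4[of "exp (A v) - exp (A w) - A (v - w)" "f (exp_coord v) - f (exp_coord w) - A \<Delta>"] 1 2 by linarith
      also have "\<eta>1 * norm \<Delta> \<le> \<eta>1 * (norm (\<Delta> - (v - w)) + norm (v - w))"
        using \<eta>1(1) norm_triangle_ineq[of "\<Delta> - (v - w)" "v - w"] by (intro mult_left_mono) auto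
      also have "\<dots> = \<eta>1 * norm (\<Delta> - (v - w)) + \<eta>1 * norm (v - w)"
        by (rule distrib_left)
      also have "\<dots> \<le> \<kappa> / 2 * norm (\<Delta> - (v - w)) + \<kappa> * \<eta> / 4 * norm (v - w)"
        using \<eta>1 by (intro add_mono mult_right_mono) auto
      finally have "\<kappa> * norm (\<Delta> - (v - w)) \<le> \<kappa> * (\<eta> * norm (v - w))"
        by (simp add: algebra_simps)
      then show "norm (exp_coord v - exp_coord w - (v - w)) \<le> \<eta> * norm (v - w)"
        using \<kappa>(1) by (simp add: \<Delta>_def)
    qed
  qed
qed

text \<open>\<open>exp_coord\<close> differs from a translation by a map with Lipschitz constant
  1/2. Banach's fixed point theorem for \<open>v + (y - exp_coord v)\<close> then shows that it
  reaches every \<open>y\<close> near \<open>x0\<close>.\<close>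

lemma near_identity:
  assumes \<epsilon>: "\<epsilon> > 0"
  obtains W where "openin T W" "\<one>\<^bsub>G\<^esub> \<in> W" "\<forall>g\<in>W. \<exists>v. r g = exp (A v) \<and> norm (A v) \<le> \<epsilon>"
proof -
  obtain K where K: "K > 0" "\<forall>v. norm (A v) \<le> norm v * K"
    using bounded_linear.pos_bounded[OF A_linear] by blast
  obtain R where R: "R > 0" "\<forall>v\<in>ball 0 R. exp_coord v \<in> O1 \<and> f (exp_coord v) = exp (A v)"
    "\<forall>v\<in>ball 0 R. \<forall>w\<in>ball 0 R. norm (exp_coord v - exp_coord w - (v - w)) \<le> 1/2 * norm (v - w)"
    by (rule exp_coord_near_id[of "1/2"]) auto
  define R' where "R' = min (R / 2) (\<epsilon> / K)"
  have R': "R' > 0" "R' < R" "R' \<le> \<epsilon> / K"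
    using R(1) \<epsilon> K(1) by (simp_all add: R'_def min_less_iff_disj)
  have sub: "v \<in> ball 0 R" if "v \<in> cball 0 R'" for v :: 'e
    using that R'(2) by simp
  have surj: "\<exists>v\<in>cball 0 R'. exp_coord v = y" if y: "y \<in> ball x0 (R' / 2)" for y
  proof -
    define h where "h = (\<lambda>v. v + (y - exp_coord v))"
    have lip: "norm (h v - h w) \<le> 1/2 * norm (v - w)" if "v \<in> cball 0 R'" "w \<in> cball 0 R'" for v w
    proof -
      have "h v - h w = - (exp_coord v - exp_coord w - (v - w))"
        by (simp add: h_def)
      then have "norm (h v - h w) = norm (exp_coord v - exp_coord w - (v - w))"
        by (simp only: norm_minus_cancel)
      then show ?thesis
        using R(3) sub[OF that(1)] sub[OF that(2)] by auto
    qed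
    have z: "0 \<in> cball (0::'e) R'"
      using R'(1) by simp
    have "\<exists>!v. v \<in> cball 0 R' \<and> h v = v"
    proof (rule Banach_fix)
      show "complete (cball (0::'e) R')"
        by (rule compact_imp_complete[OF compact_cball_findim[OF fd]])
      show "cball (0::'e) R' \<noteq> {}"
        using z by blast
      show "h ` cball 0 R' \<subseteq> cball 0 R'"
      proof (rule image_subsetI)
        fix v :: 'e assume v: "v \<in> cball 0 R'"
        have "norm (h v) \<le> norm (h v - h 0) + norm (h 0)"
          using norm_triangle_ineq[of "h v - h 0" "h 0"] by simp
        also have "\<dots> \<le> 1/2 * norm v + norm (y - x0)"
          using lip[OF v z] by (simp add: h_def exp_coord_0)
        also have "\<dots> \<le> R'"
          using v y by (simp add: dist_norm norm_minus_commute)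
        finally show "h v \<in> cball 0 R'"
          by simp
      qed
      show "dist (h v) (h w) \<le> 1/2 * dist v w" if "v \<in> cball 0 R'" "w \<in> cball 0 R'" for v w
        using lip[OF that] by (simp add: dist_norm)
    qed auto
    then obtain v where "v \<in> cball 0 R'" "h v = v" by blast
    then show ?thesis
      by (intro bexI[of _ v]) (simp_all add: h_def)
  qed
  show thesis
  proof (rule that)
    show "openin T {g \<in> U1. \<phi>1 g \<in> ball x0 (R' / 2)}"
      by (rule openin_chart_preimage[OF chart1(1) open_ball])
    show "\<one>\<^bsub>G\<^esub> \<in> {g \<in> U1. \<phi>1 g \<in> ball x0 (R' / 2)}"
      using chart1(2) R'(1) by (simp add: x0_def)
    show "\<forall>g\<in>{g \<in> U1. \<phi>1 g \<in> ball x0 (R' / 2)}. \<exists>v. r g = exp (A v) \<and> norm (A v) \<le> \<epsilon>"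
    proof
      fix g assume "g \<in> {g \<in> U1. \<phi>1 g \<in> ball x0 (R' / 2)}"
      then have g: "g \<in> U1" "\<phi>1 g \<in> ball x0 (R' / 2)" by auto
      obtain v where v: "v \<in> cball 0 R'" "exp_coord v = \<phi>1 g"
        using surj[OF g(2)] by blast
      have "r g = exp (A v)"
        using R(2) sub[OF v(1)] v(2) psi1(1)[OF g(1)] by (metis f_def)
      moreover have "norm (A v) \<le> \<epsilon>"
      proof -
        have "norm v * K \<le> \<epsilon> / K * K"
          using v(1) R'(3) K(1) by (intro mult_right_mono) auto
        then show ?thesis
          using K(2)[rule_format, of v] K(1) by simp
      qed
      ultimately show "\<exists>v. r g = exp (A v) \<and> norm (A v) \<le> \<epsilon>" by blast
    qed
  qed
qed

text \<open>Defined for all times through the injective \<open>r\<close>. Algebraic identities can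
  be checked on matrices, whereas continuity and smoothness have to be obtained in charts of
  \<open>G\<close>.\<close>

definition one_param :: "'e \<Rightarrow> real \<Rightarrow> 'g" where
  "one_param v t = inv_into (carrier G) r (exp (t *\<^sub>R A v))"

text \<open>\<open>A v\<close> is an integer multiple of the image of a small vector, and the image
  of \<open>G\<close> is closed under powers.\<close>

lemma exp_in_image: "exp (A v) \<in> r ` carrier G"
proof -
  obtain \<delta> where \<delta>: "\<delta> > 0"
    "\<forall>v. norm v < \<delta> \<longrightarrow> exp_coord v \<in> O1 \<and> f (exp_coord v) = exp (A v) \<and> norm (exp_coord v - x0 - v) \<le> 1/2 * norm v"
    by (rule exp_coord_exp)
  obtain N :: nat where N: "norm v / \<delta> < real N"
    using reals_Archimedean2 by blast
  then have N0: "N > 0"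
    using \<delta>(1) by (metis divide_nonneg_pos norm_ge_zero not_less of_nat_0 neq0_conv)
  have "norm (v /\<^sub>R real N) < \<delta>"
    using N N0 \<delta>(1) by (simp add: field_simps)
  then have c: "exp_coord (v /\<^sub>R real N) \<in> O1" "r (\<psi>1 (exp_coord (v /\<^sub>R real N))) = exp (A (v /\<^sub>R real N))"
    using \<delta>(2) by (auto simp: f_def)
  have "exp (A v) = exp (A (v /\<^sub>R real N)) ^ N"
    using exp_scaleR_nat[of N "A (v /\<^sub>R real N)"] N0 by (simp add: linear_cmul[OF A_lin])
  also have "\<dots> = r (\<psi>1 (exp_coord (v /\<^sub>R real N)) [^]\<^bsub>G\<^esub> N)"
    unfolding c(2)[symmetric] by (rule r_pow[symmetric, OF psi1(4)[OF c(1)]])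
  finally show ?thesis
    by (rule image_eqI) (rule nat_pow_closed[OF psi1(4)[OF c(1)]])
qed

lemma one_param: "one_param v t \<in> carrier G" "r (one_param v t) = exp (t *\<^sub>R A v)"
proof -
  have "exp (t *\<^sub>R A v) \<in> r ` carrier G"
    using exp_in_image[of "t *\<^sub>R v"] by (simp add: linear_cmul[OF A_lin])
  then show "one_param v t \<in> carrier G" "r (one_param v t) = exp (t *\<^sub>R A v)"
    unfolding one_param_def by (simp_all add: inv_into_into f_inv_into_f)
qed

lemma r_eqD: "x \<in> carrier G \<Longrightarrow> y \<in> carrier G \<Longrightarrow> r x = r y \<Longrightarrow> x = y"
  using inj_onD[OF inj_r] by blast

lemma one_param_add: "one_param v (s + t) = one_param v s \<otimes>\<^bsub>G\<^esub> one_param v t"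
proof (rule r_eqD)
  have "exp (s *\<^sub>R A v + t *\<^sub>R A v) = exp (s *\<^sub>R A v) * exp (t *\<^sub>R A v)"
    by (rule exp_add_commuting) simp
  then show "r (one_param v (s + t)) = r (one_param v s \<otimes>\<^bsub>G\<^esub> one_param v t)"
    by (simp add: r_mult one_param scaleR_add_left)
qed (simp_all add: one_param)

lemma one_param_0: "one_param v 0 = \<one>\<^bsub>G\<^esub>"
  by (rule r_eqD) (simp_all add: one_param)

lemma one_param_local:
  assumes "exp_coord (t *\<^sub>R v) \<in> O1" "f (exp_coord (t *\<^sub>R v)) = exp (A (t *\<^sub>R v))"
  shows "one_param v t = \<psi>1 (exp_coord (t *\<^sub>R v))" "one_param v t \<in> U1" "\<phi>1 (one_param v t) = exp_coord (t *\<^sub>R v)"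
proof -
  show e: "one_param v t = \<psi>1 (exp_coord (t *\<^sub>R v))"
    by (rule r_eqD) (use assms in \<open>simp_all add: one_param psi1 f_def linear_cmul[OF A_lin]\<close>)
  show "one_param v t \<in> U1" "\<phi>1 (one_param v t) = exp_coord (t *\<^sub>R v)"
    unfolding e using psi1(2,3)[OF assms(1)] by auto
qed

lemma one_param_eventually_local: "\<forall>\<^sub>F t in nhds 0. exp_coord (t *\<^sub>R v) \<in> O1 \<and> f (exp_coord (t *\<^sub>R v)) = exp (A (t *\<^sub>R v))"
proof -
  obtain \<delta> where \<delta>: "\<delta> > 0"
    "\<forall>v. norm v < \<delta> \<longrightarrow> exp_coord v \<in> O1 \<and> f (exp_coord v) = exp (A v) \<and> norm (exp_coord v - x0 - v) \<le> 1/2 * norm v"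
    by (rule exp_coord_exp)
  have "((\<lambda>t. norm (t *\<^sub>R v)) \<longlongrightarrow> norm (0 *\<^sub>R v)) (nhds 0)"
    by (intro tendsto_intros filterlim_ident)
  then have "\<forall>\<^sub>F t in nhds 0. norm (t *\<^sub>R v) < \<delta>"
    by (rule order_tendstoD(2)) (use \<delta>(1) in simp)
  then show ?thesis
    by eventually_elim (use \<delta>(2) in blast)
qed

lemma one_param_derivative_0: "((\<lambda>t. \<phi>1 (one_param v t)) has_vector_derivative v) (at 0)"
proof -
  have "((\<lambda>t. exp_coord (t *\<^sub>R v)) has_derivative (\<lambda>t. t *\<^sub>R v)) (at 0)"
    unfolding has_derivative_at_alt
  proof (intro conjI allI impI)
    show "bounded_linear (\<lambda>t. t *\<^sub>R v)"
      by (rule bounded_linear_scaleR_left)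
    fix e :: real assume e: "0 < e"
    \<comment> \<open>The summand 1 covers the case \<open>v = 0\<close>.\<close>
    have e': "e / (norm v + 1) > 0"
      using e by (simp add: add_nonneg_pos)
    obtain R where R: "R > 0" "\<forall>v\<in>ball 0 R. exp_coord v \<in> O1 \<and> f (exp_coord v) = exp (A v)"
      "\<forall>u\<in>ball 0 R. \<forall>w\<in>ball 0 R. norm (exp_coord u - exp_coord w - (u - w)) \<le> e / (norm v + 1) * norm (u - w)"
      by (rule exp_coord_near_id[OF e'])
    show "\<exists>d>0. \<forall>y. norm (y - 0) < d \<longrightarrow>
        norm (exp_coord (y *\<^sub>R v) - exp_coord (0 *\<^sub>R v) - (y - 0) *\<^sub>R v) \<le> e * norm (y - 0)"
    proof (intro exI[of _ "R / (norm v + 1)"] conjI allI impI)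
      show "R / (norm v + 1) > 0"
        using R(1) by (simp add: add_nonneg_pos)
      fix y :: real assume y: "norm (y - 0) < R / (norm v + 1)"
      have nv: "norm v + 1 > 0"
        by (simp add: add_nonneg_pos)
      have "\<bar>y\<bar> * norm v \<le> \<bar>y\<bar> * (norm v + 1)"
        by (intro mult_left_mono) auto
      also have "\<dots> < R"
        using y nv by (simp add: pos_less_divide_eq)
      finally have yb: "y *\<^sub>R v \<in> ball 0 R" "0 *\<^sub>R v \<in> ball 0 R"
        using R(1) by simp_all
      have "norm (exp_coord (y *\<^sub>R v) - exp_coord (0 *\<^sub>R v) - (y *\<^sub>R v - 0 *\<^sub>R v)) \<le> e / (norm v + 1) * norm (y *\<^sub>R v - 0 *\<^sub>R v)"
        using R(3) yb by blast
      also have "\<dots> = e * \<bar>y\<bar> * (norm v / (norm v + 1))"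
        by simp
      also have "\<dots> \<le> e * \<bar>y\<bar> * 1"
        using e nv by (intro mult_left_mono) auto
      finally show "norm (exp_coord (y *\<^sub>R v) - exp_coord (0 *\<^sub>R v) - (y - 0) *\<^sub>R v) \<le> e * norm (y - 0)"
        by simp
    qed
  qed
  then have d: "((\<lambda>t. exp_coord (t *\<^sub>R v)) has_vector_derivative v) (at 0)"
    by (simp add: has_vector_derivative_def)
  obtain d0 where d0: "d0 > 0" "\<forall>t::real. dist t 0 < d0 \<longrightarrow> exp_coord (t *\<^sub>R v) \<in> O1 \<and> f (exp_coord (t *\<^sub>R v)) = exp (A (t *\<^sub>R v))"
    using one_param_eventually_local[of v] unfolding eventually_nhds_metric by blast
  show ?thesis
  proof (rule has_vector_derivative_transform_within_open[OF d])
    show "open (ball 0 d0)" "0 \<in> ball 0 d0" using d0(1) by simp_all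
    fix t :: real assume "t \<in> ball 0 d0"
    then have "dist t 0 < d0" by (simp add: dist_commute)
    then show "exp_coord (t *\<^sub>R v) = \<phi>1 (one_param v t)"
      using one_param_local(3) d0(2) by metis
  qed
qed

text \<open>Continuity of the matrix curve is not enough, as the topology of \<open>G\<close> may be
  finer than that of its image. Continuity at 0 holds in the chart and is carried to other times by
  left translation.\<close>

lemma one_param_continuous: "continuous_map euclidean T (one_param v)"
  unfolding continuous_map
proof (intro conjI allI impI)
  show "one_param v ` topspace euclidean \<subseteq> topspace T"
    using one_param(1) by auto
  fix W assume W: "openin T W"
  have "\<exists>e>0. ball t e \<subseteq> {t. one_param v t \<in> W}" if t: "one_param v t \<in> W" for t
  proof -
    define W' where "W' = {g \<in> topspace T. one_param v t \<otimes>\<^bsub>G\<^esub> g \<in> W}"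
    have oW': "openin T W'"
      unfolding W'_def by (rule openin_continuous_map_preimage[OF left_mult_cont[OF one_param(1)] W])
    have "open {x \<in> \<phi>1 ` U1. inv_into U1 \<phi>1 x \<in> W'}"
      by (rule open_chart_preimage[OF chart1(1) oW'])
    then have o: "open {x \<in> O1. \<psi>1 x \<in> W'}"
      by (simp add: O1_def \<psi>1_def)
    have x0W: "x0 \<in> {x \<in> O1. \<psi>1 x \<in> W'}"
      using t one_param(1) by (simp add: x0_O1 psi1_x0 W'_def)
    have "((\<lambda>s. \<phi>1 (one_param v s)) \<longlongrightarrow> \<phi>1 (one_param v 0)) (nhds 0)"
      using has_vector_derivative_continuous[OF one_param_derivative_0[of v]]
      unfolding isCont_def by (rule tendsto_at_iff_tendsto_nhds[THEN iffD1])
    then have "\<forall>\<^sub>F s in nhds 0. \<phi>1 (one_param v s) \<in> {x \<in> O1. \<psi>1 x \<in> W'}"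
      by (rule topological_tendstoD[OF _ o]) (use x0W in \<open>simp add: one_param_0 x0_def\<close>)
    then have "\<forall>\<^sub>F s in nhds 0. one_param v (t + s) \<in> W"
      using one_param_eventually_local[of v]
    proof eventually_elim
      case (elim s)
      have "one_param v s \<in> W'"
        using elim one_param_local[of s v] psi1(1) by simp
      then show ?case
        by (simp add: W'_def one_param_add)
    qed
    then obtain e where e: "e > 0" "\<forall>s::real. dist s 0 < e \<longrightarrow> one_param v (t + s) \<in> W"
      unfolding eventually_nhds_metric by blast
    have "one_param v u \<in> W" if "u \<in> ball t e" for u
    proof -
      have "dist (u - t) 0 < e"
        using that by (simp add: dist_norm norm_minus_commute)
      then have "one_param v (t + (u - t)) \<in> W"
        using e(2) by blast
      then show ?thesis by simp
    qed
    with e(1) show ?thesis by blast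
  qed
  then show "openin euclidean {x \<in> topspace euclidean. one_param v x \<in> W}"
    by (simp add: open_contains_ball)
qed

text \<open>Near \<open>t\<close> the curve is the product of \<open>one_param v t\<close> with
  \<open>one_param v s\<close> for small \<open>s\<close>, so only the second argument of the
  multiplication moves, with velocity \<open>v\<close>.\<close>

lemma one_param_curve_derivative:
  assumes c: "(V, \<xi>) \<in> atlas G" and t: "one_param v t \<in> V"
    and M': "(cmult (V, \<xi>) chart1 has_derivative M') (at (\<xi> (one_param v t), x0))"
  shows "((\<lambda>t. \<xi> (one_param v t)) has_vector_derivative M' (0, v)) (at t)"
proof -
  have "((\<lambda>s. (\<xi> (one_param v t), \<phi>1 (one_param v s))) has_derivative (\<lambda>s. (0, s *\<^sub>R v))) (at 0)"
    using one_param_derivative_0[of v] unfolding has_vector_derivative_def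
    by (intro has_derivative_Pair has_derivative_const)
  moreover have "(cmult (V, \<xi>) chart1 has_derivative M') (at (\<xi> (one_param v t), \<phi>1 (one_param v 0)))"
    using M' by (simp add: one_param_0 x0_def)
  ultimately have "((\<lambda>s. cmult (V, \<xi>) chart1 (\<xi> (one_param v t), \<phi>1 (one_param v s))) has_derivative (\<lambda>s. M' (0, s *\<^sub>R v))) (at 0)"
    by (rule has_derivative_compose)
  moreover have "M' (0, s *\<^sub>R v) = s *\<^sub>R M' (0, v)" for s
    using linear_cmul[OF has_derivative_linear[OF M'], of s "(0, v)"] by simp
  ultimately have d: "((\<lambda>s. cmult (V, \<xi>) chart1 (\<xi> (one_param v t), \<phi>1 (one_param v s))) has_vector_derivative M' (0, v)) (at 0)"
    by (simp add: has_vector_derivative_def)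
  obtain d0 where d0: "d0 > 0" "\<forall>t::real. dist t 0 < d0 \<longrightarrow> exp_coord (t *\<^sub>R v) \<in> O1 \<and> f (exp_coord (t *\<^sub>R v)) = exp (A (t *\<^sub>R v))"
    using one_param_eventually_local[of v] unfolding eventually_nhds_metric by blast
  have "((\<lambda>s. \<xi> (one_param v (t + s))) has_vector_derivative M' (0, v)) (at 0)"
  proof (rule has_vector_derivative_transform_within_open[OF d])
    show "open (ball 0 d0)" "0 \<in> ball 0 d0" using d0(1) by simp_all
    fix s :: real assume "s \<in> ball 0 d0"
    then have "dist s 0 < d0" by (simp add: dist_commute)
    then have "one_param v s \<in> U1"
      using one_param_local(2) d0(2) by metis
    then show "cmult (V, \<xi>) chart1 (\<xi> (one_param v t), \<phi>1 (one_param v s)) = \<xi> (one_param v (t + s))"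
      unfolding cmult_def chart1(3)
      using chart_inverse(1)[OF c t] chart_inverse(1)[OF chart1(1)] by (simp add: one_param_add)
  qed
  moreover have "((\<lambda>u. u - t) has_vector_derivative 1) (at t)"
    by (auto intro!: derivative_eq_intros)
  ultimately have "((\<lambda>s. \<xi> (one_param v (t + s))) \<circ> (\<lambda>u. u - t) has_vector_derivative 1 *\<^sub>R M' (0, v)) (at t)"
    by (intro vector_diff_chain_at) simp_all
  then show ?thesis
    by (simp add: o_def)
qed

text \<open>In a chart, \<open>one_param v\<close> solves an autonomous equation with smooth right-hand side.\<close>

lemma one_param_smooth:
  assumes c: "(V, \<xi>) \<in> atlas G"
  shows "Ck_on k {t. one_param v t \<in> V} (\<lambda>t. \<xi> (one_param v t))"
proof (induction k)
  have at1: "chart1 \<in> atlas G"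
    using chart1(1,3) by simp
  let ?M = "cmult (V, \<xi>) chart1" and ?W = "cdom (V, \<xi>) chart1"
  have W: "(\<xi> (one_param v t), x0) \<in> ?W" if "one_param v t \<in> V" for t
    using that chart_inverse(1)[OF c that] x0_O1 psi1_x0 one_param(1)
    by (auto simp: cdom_def chart1(3) O1_def \<psi>1_def)
  {
    case 0
    obtain M' where "\<forall>p\<in>?W. (?M has_derivative M' p) (at p)" "\<forall>u. Ck_on 0 ?W (\<lambda>p. M' p u)"
      using smooth_cmult[OF c at1, of "Suc 0"] by (rule Ck_on_SucE)
    then have "((\<lambda>t. \<xi> (one_param v t)) has_vector_derivative M' (\<xi> (one_param v t), x0) (0, v)) (at t)" if "one_param v t \<in> V" for t
      using W[OF that] by (intro one_param_curve_derivative[OF c that]) auto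
    from has_vector_derivative_continuous[OF this] have "isCont (\<lambda>t. \<xi> (one_param v t)) t" if "one_param v t \<in> V" for t
      using that .
    then show ?case
      by (auto intro!: continuous_at_imp_continuous_on)
  next
    \<comment> \<open>Bootstrapping: the velocity
      \<open>M' (\<xi> (one_param v t), x0) (0, v)\<close> is a smooth function of the curve itself,
      so the derivative is as smooth as the curve.\<close>
    case (Suc k)
    obtain M' where M': "\<forall>p\<in>?W. (?M has_derivative M' p) (at p)" "\<forall>u. Ck_on k ?W (\<lambda>p. M' p u)"
      using smooth_cmult[OF c at1, of "Suc k"] by (rule Ck_on_SucE)
    have "Ck_on k {t. one_param v t \<in> V} (\<lambda>t. (\<xi> (one_param v t), 0) + (0, x0))"
      using Ck_on_bounded_linear[OF bounded_linear_Pair[OF bounded_linear_ident bounded_linear_zero] Suc]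
      by (intro Ck_on_add Ck_on_const)
    then have curve: "Ck_on k {t. one_param v t \<in> V} (\<lambda>t. (\<xi> (one_param v t), x0))"
      by simp
    have im: "(\<lambda>t. (\<xi> (one_param v t), x0)) ` {t. one_param v t \<in> V} \<subseteq> ?W"
      using W by auto
    show ?case
    proof (rule Ck_on_SucI)
      show "\<forall>t\<in>{t. one_param v t \<in> V}. ((\<lambda>t. \<xi> (one_param v t)) has_derivative (\<lambda>s. s *\<^sub>R M' (\<xi> (one_param v t), x0) (0, v))) (at t)"
        using one_param_curve_derivative[OF c] M'(1) W unfolding has_vector_derivative_def by blast
      show "\<forall>s. Ck_on k {t. one_param v t \<in> V} (\<lambda>t. s *\<^sub>R M' (\<xi> (one_param v t), x0) (0, v))"
      proof
        fix s :: real
        have "Ck_on k {t. one_param v t \<in> V} (\<lambda>t. M' (\<xi> (one_param v t), x0) (0, v))"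
          using Ck_on_compose_curve[OF findim_prod[OF fd fd] curve im spec[OF M'(2), of "(0, v)"]] .
        then show "Ck_on k {t. one_param v t \<in> V} (\<lambda>t. s *\<^sub>R M' (\<xi> (one_param v t), x0) (0, v))"
          by (rule Ck_on_bounded_linear[OF bounded_linear_scaleR_right])
      qed
    qed
  }
qed

lemma one_param_lie_hom: "one_param v \<in> lie_hom real_lie G"
  unfolding lie_hom_def smooth_map_def
proof (intro CollectI conjI)
  show "one_param v \<in> hom real_lie G"
    by (auto simp: hom_def real_lie_def one_param one_param_add)
  show "continuous_map (topo real_lie) T (one_param v)"
    using one_param_continuous by (simp add: real_lie_def)
  show "\<forall>(U, \<phi>)\<in>atlas real_lie. \<forall>(V, \<psi>)\<in>atlas G. smooth_on (\<phi> ` (U \<inter> one_param v -` V)) (\<psi> \<circ> one_param v \<circ> inv_into U \<phi>)"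
  proof -
    have "smooth_on (id ` (UNIV \<inter> one_param v -` V)) (\<psi> \<circ> one_param v \<circ> inv_into UNIV id)" if "(V, \<psi>) \<in> atlas G" for V \<psi>
      using one_param_smooth[OF that] by (simp add: smooth_on_def vimage_def o_def id_def[symmetric] inv_id)
    then show ?thesis
      by (auto simp: real_lie_def)
  qed
qed

end

section \<open>The image of the exponential map\<close>

lemma smooth_functions_iff:
  "f \<in> smooth_functions G \<longleftrightarrow> continuous_map (topo G) euclideanreal f \<and>
     (\<forall>(U, \<phi>)\<in>atlas G. \<forall>k. Ck_on k (\<phi> ` U) (\<lambda>x. f (inv_into U \<phi> x)))"
  by (simp add: smooth_functions_def smooth_map_def real_lie_def smooth_on_def o_def)

lemma smooth_functions_lincomb:
  assumes "f \<in> smooth_functions G" "h \<in> smooth_functions G"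
  shows "(\<lambda>x. a * f x + b * h x) \<in> smooth_functions G"
  unfolding smooth_functions_iff
proof (intro conjI)
  show "continuous_map (topo G) euclideanreal (\<lambda>x. a * f x + b * h x)"
    using assms unfolding smooth_functions_iff
    by (intro continuous_map_add continuous_map_real_mult_left) auto
  have "Ck_on k (\<phi> ` U) (\<lambda>x. a *\<^sub>R f (inv_into U \<phi> x) + b *\<^sub>R h (inv_into U \<phi> x))" if "(U, \<phi>) \<in> atlas G" for U \<phi> k
    using assms that unfolding smooth_functions_iff
    by (intro Ck_on_add Ck_on_bounded_linear[OF bounded_linear_scaleR_right]) auto
  then show "\<forall>(U, \<phi>)\<in>atlas G. \<forall>k. Ck_on k (\<phi> ` U) (\<lambda>x. a * f (inv_into U \<phi> x) + b * h (inv_into U \<phi> x))"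
    by auto
qed

lemma smooth_functions_mult:
  assumes "f \<in> smooth_functions G" "h \<in> smooth_functions G"
  shows "(\<lambda>x. f x * h x) \<in> smooth_functions G"
  unfolding smooth_functions_iff
proof (intro conjI)
  show "continuous_map (topo G) euclideanreal (\<lambda>x. f x * h x)"
    using assms unfolding smooth_functions_iff
    by (intro continuous_map_real_mult) auto
  have "Ck_on k (\<phi> ` U) (\<lambda>x. f (inv_into U \<phi> x) *\<^sub>R h (inv_into U \<phi> x))" if "(U, \<phi>) \<in> atlas G" for U \<phi> k
    using assms that unfolding smooth_functions_iff
    by (intro Ck_on_scaleR) auto
  then show "\<forall>(U, \<phi>)\<in>atlas G. \<forall>k. Ck_on k (\<phi> ` U) (\<lambda>x. f (inv_into U \<phi> x) * h (inv_into U \<phi> x))"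
    by auto
qed

lemma real_lie_hom_add:
  "\<gamma> \<in> lie_hom real_lie G \<Longrightarrow> \<gamma> (s + t) = \<gamma> s \<otimes>\<^bsub>G\<^esub> \<gamma> t"
  by (auto simp: lie_hom_def hom_def real_lie_def)

lemma real_lie_hom_closed: "\<gamma> \<in> lie_hom real_lie G \<Longrightarrow> \<gamma> t \<in> carrier G"
  by (auto simp: lie_hom_def hom_def real_lie_def)

lemma lie_hom_compose_differentiable:
  assumes lie: "lie_group G" and \<gamma>: "\<gamma> \<in> lie_hom real_lie G" and f: "f \<in> smooth_functions G"
  shows "\<exists>d. ((\<lambda>t. f (\<gamma> t)) has_real_derivative d) (at t)"
proof -
  have man: "smooth_manifold (topo G) (atlas G)" and ts: "topspace (topo G) = carrier G"
    using lie by (simp_all add: lie_group_def)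
  have "(\<Union>(U, \<phi>)\<in>atlas G. U) = carrier G"
    using man ts unfolding smooth_manifold_def by simp
  then have "\<gamma> t \<in> (\<Union>(U, \<phi>)\<in>atlas G. U)"
    using real_lie_hom_closed[OF \<gamma>] by simp
  then obtain U \<phi> where c: "(U, \<phi>) \<in> atlas G" "\<gamma> t \<in> U"
    by (auto split: prod.splits)
  have sm: "continuous_map euclidean (topo G) \<gamma>"
    "\<forall>(V, \<psi>)\<in>atlas G. smooth_on (id ` (UNIV \<inter> \<gamma> -` V)) (\<psi> \<circ> \<gamma> \<circ> inv_into UNIV id)"
    using \<gamma> by (simp_all add: lie_hom_def smooth_map_def real_lie_def)
  have cs1: "Ck_on 1 (\<gamma> -` U) (\<lambda>s. \<phi> (\<gamma> s))"
    using bspec[OF sm(2) c(1)] by (simp add: smooth_on_def o_def inv_id)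
  obtain c' where "\<forall>s\<in>\<gamma> -` U. ((\<lambda>s. \<phi> (\<gamma> s)) has_derivative c' s) (at s)" "\<forall>v. Ck_on 0 (\<gamma> -` U) (\<lambda>s. c' s v)"
    using cs1 unfolding One_nat_def by (rule Ck_on_SucE)
  then have c': "((\<lambda>s. \<phi> (\<gamma> s)) has_derivative c' t) (at t)"
    using c(2) by simp
  have "Ck_on 1 (\<phi> ` U) (\<lambda>x. f (inv_into U \<phi> x))"
    using bspec[OF conjunct2[OF f[unfolded smooth_functions_iff]] c(1)] by (simp del: Ck_on.simps)
  then obtain f' where "\<forall>x\<in>\<phi> ` U. ((\<lambda>x. f (inv_into U \<phi> x)) has_derivative f' x) (at x)"
      "\<forall>v. Ck_on 0 (\<phi> ` U) (\<lambda>x. f' x v)"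
    unfolding One_nat_def by (rule Ck_on_SucE)
  then have f': "((\<lambda>x. f (inv_into U \<phi> x)) has_derivative f' (\<phi> (\<gamma> t))) (at (\<phi> (\<gamma> t)))"
    using c(2) by simp
  have sch: "smooth_chart (topo G) (U, \<phi>)"
    using man c(1) unfolding smooth_manifold_def by simp
  then have oU: "openin (topo G) U" and inj: "inj_on \<phi> U"
    using openin_subset[of "topo G" U]
    by (auto simp: smooth_chart_def homeomorphic_map_def topspace_subtopology Int_absorb1)
  have "openin euclidean {s \<in> topspace euclidean. \<gamma> s \<in> U}"
    by (rule openin_continuous_map_preimage[OF sm(1) oU])
  then have o: "open {s. \<gamma> s \<in> U}"
    by simp
  have "((\<lambda>s. f (inv_into U \<phi> (\<phi> (\<gamma> s)))) has_derivative (\<lambda>s. f' (\<phi> (\<gamma> t)) (c' t s))) (at t)"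
    by (rule has_derivative_compose[OF c' f'])
  then have "((\<lambda>s. f (\<gamma> s)) has_derivative (\<lambda>s. f' (\<phi> (\<gamma> t)) (c' t s))) (at t)"
    by (rule has_derivative_transform_within_open[OF _ o]) (use c(2) inj in auto)
  then have "(\<lambda>t. f (\<gamma> t)) differentiable at t"
    unfolding differentiable_def by blast
  then show ?thesis
    unfolding real_differentiable_def[symmetric] .
qed

text \<open>Differentiation along \<open>\<gamma>\<close> at time 0, extended by 0 to the functions
  that are not smooth, is the required element of the Lie algebra.\<close>

lemma lie_hom_in_exp_image:
  assumes lie: "lie_group G" and \<gamma>: "\<gamma> \<in> lie_hom real_lie G"
  shows "\<gamma> 1 \<in> exp_image G"
proof -
  interpret group G
    using lie by (simp add: lie_group_def)
  have "\<gamma> 0 \<otimes>\<^bsub>G\<^esub> \<gamma> 0 = \<gamma> 0"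
    using real_lie_hom_add[OF \<gamma>, of 0 0] by simp
  then have \<gamma>0: "\<gamma> 0 = \<one>\<^bsub>G\<^esub>"
    using real_lie_hom_closed[OF \<gamma>, of 0] by simp
  define X where "X = (\<lambda>f. if f \<in> smooth_functions G then deriv (\<lambda>t. f (\<gamma> t)) 0 else 0)"
  have D: "((\<lambda>t. f (\<gamma> t)) has_real_derivative X f) (at 0)" if "f \<in> smooth_functions G" for f
    using lie_hom_compose_differentiable[OF lie \<gamma> that, of 0] that by (auto simp: X_def dest: DERIV_imp_deriv)
  have "X \<in> lie_algebra G"
    unfolding lie_algebra_def
  proof (intro CollectI conjI ballI allI impI)
    fix f h a b assume fh: "f \<in> smooth_functions G" "h \<in> smooth_functions G"
    have "((\<lambda>t. a * f (\<gamma> t) + b * h (\<gamma> t)) has_real_derivative a * X f + b * X h) (at 0)"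
      by (intro DERIV_add DERIV_cmult D fh)
    then show "X (\<lambda>x. a * f x + b * h x) = a * X f + b * X h"
      by (rule DERIV_unique[OF D[OF smooth_functions_lincomb[OF fh]]])
  next
    fix f h assume fh: "f \<in> smooth_functions G" "h \<in> smooth_functions G"
    have "((\<lambda>t. f (\<gamma> t) * h (\<gamma> t)) has_real_derivative X f * h (\<gamma> 0) + X h * f (\<gamma> 0)) (at 0)"
      by (intro DERIV_mult D fh)
    then have "X (\<lambda>x. f x * h x) = X f * h (\<gamma> 0) + X h * f (\<gamma> 0)"
      by (rule DERIV_unique[OF D[OF smooth_functions_mult[OF fh]]])
    then show "X (\<lambda>x. f x * h x) = f \<one>\<^bsub>G\<^esub> * X h + h \<one>\<^bsub>G\<^esub> * X f"
      by (simp add: \<gamma>0)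
  qed (simp add: X_def)
  moreover have "is_lie_exp G X (\<gamma> 1)"
    unfolding is_lie_exp_def initial_velocity_def using \<gamma> D by blast
  ultimately show ?thesis
    unfolding exp_image_def by blast
qed

lemma exp_image_subset_squares:
  assumes "group G"
  shows "exp_image G \<subseteq> power_map G 2 ` carrier G"
proof
  interpret group G by fact
  fix g assume "g \<in> exp_image G"
  then obtain \<gamma> where \<gamma>: "\<gamma> \<in> lie_hom real_lie G" "g = \<gamma> 1"
    unfolding exp_image_def is_lie_exp_def by blast
  have c: "\<gamma> (1/2) \<in> carrier G"
    by (rule real_lie_hom_closed[OF \<gamma>(1)])
  have "g = power_map G 2 (\<gamma> (1/2))"
    using real_lie_hom_add[OF \<gamma>(1), of "1/2" "1/2"] c by (simp add: \<gamma>(2) power_map_def numeral_2_eq_2)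
  with c show "g \<in> power_map G 2 ` carrier G"
    by blast
qed

section \<open>Squares are limits of exponentials\<close>

lemma inner_complex_mat:
  fixes x y :: "complex^'n^'n"
  shows "x \<bullet> y = Re (\<Sum>i\<in>UNIV. \<Sum>j\<in>UNIV. cnj (x $ i $ j) * y $ i $ j)"
  by (simp add: inner_vec_def inner_complex_def)

context linear_lie
begin

lemma cnj_mat_A: "cnj_mat (A v) = A v"
proof -
  have "((\<lambda>x. cnj_mat (f x)) has_derivative (\<lambda>v. cnj_mat (A v))) (at x0)"
    by (rule bounded_linear.has_derivative[OF bounded_linear_cnj_mat A])
  then have "(f has_derivative (\<lambda>v. cnj_mat (A v))) (at x0)"
    by (simp add: f_def cnj_mat_r flip: f_def[abs_def])
  from has_derivative_unique[OF this A] show ?thesis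
    by metis
qed

text \<open>The functionals are complex linear, so their common zeros form the complexification of
  the range of \<open>A\<close>, as the next lemma shows.\<close>

definition annihilator :: "('n \<Rightarrow> 'n \<Rightarrow> complex) set" where
  "annihilator = {w. \<forall>v. lfun w (A v) = 0}"

text \<open>Finite-dimensional duality: the component of \<open>Z\<close> orthogonal to the
  complexified Lie algebra defines, by conjugation, a functional in \<open>annihilator\<close>,
  whose value at \<open>Z\<close> is the squared norm of that component.\<close>

lemma annihilated_imp_complexified:
  assumes Z: "\<forall>w\<in>annihilator. lfun w Z = 0"
  obtains u v where "Z = A u + smat \<i> * A v"
proof -
  define S where "S = {mat_of (A u + smat \<i> * A v) | u v. True}"
  have SI: "mat_of (A u + smat \<i> * A v) \<in> S" for u v
    unfolding S_def by blast
  have sub: "subspace S"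
    unfolding subspace_def
  proof (intro conjI ballI allI)
    show "0 \<in> S"
      unfolding S_def by (intro CollectI exI[of _ 0]) (simp add: linear_0[OF A_lin] mat_of_simps)
    fix x y and c :: real assume "x \<in> S" "y \<in> S"
    then obtain u v u' v' where uv: "x = mat_of (A u + smat \<i> * A v)" "y = mat_of (A u' + smat \<i> * A v')"
      unfolding S_def by blast
    have "x + y = mat_of (A (u + u') + smat \<i> * A (v + v'))"
      unfolding uv mat_of_simps(3)[symmetric] by (simp add: linear_add[OF A_lin] distrib_left add_ac)
    then show "x + y \<in> S"
      by (simp only: SI)
    have "c *\<^sub>R x = mat_of (A (c *\<^sub>R u) + smat \<i> * A (c *\<^sub>R v))"
      unfolding uv mat_of_simps(7)[symmetric] by (simp add: linear_cmul[OF A_lin] scaleR_add_right)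
    then show "c *\<^sub>R x \<in> S"
      by (simp only: SI)
  qed
  obtain y z where yz: "y \<in> span S" "\<forall>w\<in>span S. orthogonal z w" "mat_of Z = y + z"
  proof (rule orthogonal_subspace_decomp_exists[of S "mat_of Z"])
    fix y z assume "y \<in> span S" "\<And>w. w \<in> span S \<Longrightarrow> orthogonal z w" "mat_of Z = y + z"
    then show thesis by (intro that[of y z] ballI)
  qed
  have spS: "span S = S"
    using sub by simp
  define w where "w = (\<lambda>i j. cnj (z $ i $ j))"
  have lw: "lfun w Y = (\<Sum>i\<in>UNIV. \<Sum>j\<in>UNIV. cnj (z $ i $ j) * mat_of Y $ i $ j)" for Y
    by (simp add: lfun_def w_def entry_def)
  have lS: "lfun w Y = 0" if Y: "mat_of Y \<in> S" for Y
  proof (rule complex_eqI)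
    show "Re (lfun w Y) = Re 0"
      using bspec[OF yz(2), of "mat_of Y"] Y spS unfolding lw by (simp add: orthogonal_def inner_complex_mat)
    obtain u v where "Y = A u + smat \<i> * A v"
      using Y by (auto simp: S_def mat_of_inject)
    \<comment> \<open>Orthogonality refers to the real inner product and controls only the real part
      of \<open>lfun w Y\<close>. The imaginary part is reached through
      \<open>smat \<i> * Y\<close>, as \<open>S\<close> is stable under multiplication by
      \<open>\<i>\<close>.\<close>
    then have "smat \<i> * Y = A (- v) + smat \<i> * A u"
      by (simp add: distrib_left linear_neg[OF A_lin] smat_minus mult.assoc[symmetric] smat_mult[symmetric])
    then have "mat_of (smat \<i> * Y) \<in> S"
      by (simp only: SI)
    then have "Re (lfun w (smat \<i> * Y)) = 0"
      using bspec[OF yz(2), of "mat_of (smat \<i> * Y)"] spS unfolding lw by (simp add: orthogonal_def inner_complex_mat)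
    moreover have "lfun w (smat \<i> * Y) = \<i> * lfun w Y"
      by (simp add: lfun_def sum_distrib_left mult_ac)
    ultimately show "Im (lfun w Y) = Im 0"
      by simp
  qed
  have "w \<in> annihilator"
    unfolding annihilator_def
  proof (intro CollectI allI lS)
    fix v
    show "mat_of (A v) \<in> S"
      using SI[of v 0] by (simp add: linear_0[OF A_lin])
  qed
  then have "lfun w Z = 0"
    using Z by blast
  moreover have "lfun w (Cmat y) = 0"
    using yz(1) spS by (intro lS) simp
  moreover have "Z = Cmat y + Cmat z"
    by (rule cmat_eqI) (simp add: mat_of_simps yz(3))
  moreover have "lfun w (Cmat y + Cmat z) = lfun w (Cmat y) + lfun w (Cmat z)"
    by (simp add: lfun_def distrib_left sum.distrib)
  ultimately have "lfun w (Cmat z) = 0"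
    by simp
  then have "z \<bullet> z = 0"
    unfolding lw inner_complex_mat by simp
  then have "mat_of Z \<in> S"
    using yz(1,3) spS by simp
  then show thesis
    using that by (auto simp: S_def mat_of_inject)
qed

section \<open>Products of one-parameter subgroups\<close>

definition word :: "'e list \<Rightarrow> real \<Rightarrow> 'g" where
  "word vs t = foldr (\<lambda>v x. one_param v t \<otimes>\<^bsub>G\<^esub> x) vs \<one>\<^bsub>G\<^esub>"

text \<open>The entire extension of \<open>r (word vs t)\<close> to complex times, where it may
  leave the image of \<open>G\<close>. All factors share one time, so that time 0 gives the identity
  and the logarithm near 0 is small.\<close>

definition cword :: "'e list \<Rightarrow> complex \<Rightarrow> 'n cmat" where
  "cword vs z = foldr (\<lambda>v B. exp (smat z * A v) * B) vs 1"

lemma word_closed: "word vs t \<in> carrier G"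
  by (induction vs) (simp_all add: word_def one_param)

lemma r_word: "r (word vs t) = cword vs (of_real t)"
proof (induction vs)
  case (Cons v vs)
  have "word (v # vs) t = one_param v t \<otimes>\<^bsub>G\<^esub> word vs t"
    by (simp add: word_def)
  then show ?case
    using Cons by (simp add: r_mult one_param word_closed cword_def smat_of_real)
qed (simp add: word_def cword_def)

lemma word_append: "word (us @ vs) t = word us t \<otimes>\<^bsub>G\<^esub> word vs t"
proof (rule r_eqD)
  have "cword (us @ vs) z = cword us z * cword vs z" for z
    by (induction us) (simp_all add: cword_def mult.assoc)
  then show "r (word (us @ vs) t) = r (word us t \<otimes>\<^bsub>G\<^esub> word vs t)"
    by (simp add: r_mult r_word word_closed)
qed (simp_all add: word_closed)

lemma word_single: "word [v] t = one_param v t"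
  by (simp add: word_def one_param)

lemma word_0: "word vs 0 = \<one>\<^bsub>G\<^esub>"
  by (induction vs) (simp_all add: word_def one_param_0)

lemma word_continuous: "continuous_map euclidean T (word vs)"
proof (induction vs)
  case (Cons v vs)
  have "continuous_map euclidean T (\<lambda>t. one_param v t \<otimes>\<^bsub>G\<^esub> word vs t)"
    by (rule mult_cont2[OF one_param_continuous Cons])
  then show ?case
    by (simp add: word_def[abs_def])
qed (simp add: word_def[abs_def])

lemma hol_mat_cword: "hol_mat UNIV (cword vs)"
proof (induction vs)
  case (Cons v vs)
  have "hol_mat UNIV (\<lambda>z. exp (smat z * A v) * cword vs z)"
    by (intro hol_mat_mult Cons) (simp add: hol_mat_def entry_exp_holomorphic)
  then show ?case
    by (simp add: cword_def[abs_def])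
qed (simp add: cword_def[abs_def])

lemma det_mat_cword: "det_mat (cword vs z) \<noteq> 0"
proof (induction vs)
  case (Cons v vs)
  have "det_mat (exp (smat z * A v)) * det_mat (exp (- (smat z * A v))) = 1"
    by (simp add: exp_minus_right flip: det_mat_mult)
  then have "det_mat (exp (smat z * A v)) \<noteq> 0"
    by auto
  with Cons show ?case
    by (simp add: cword_def det_mat_mult)
qed (simp add: cword_def)

text \<open>The elements of the translate \<open>N h\<close> of \<open>W\<close> are
  \<open>h\<close> times one-parameter factors. Such a factor can be appended to a word and also
  undone, so \<open>H\<close> and its complement are both open.\<close>

lemma word_surj:
  assumes conn: "connected_space T" and g: "g \<in> carrier G"
  obtains vs where "g = word vs 1"
proof -
  define H where "H = range (\<lambda>vs. word vs 1)"
  obtain W where W: "openin T W" "\<one>\<^bsub>G\<^esub> \<in> W" "\<forall>g\<in>W. \<exists>v. r g = exp (A v) \<and> norm (A v) \<le> 1"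
    by (rule near_identity[of 1]) auto
  have Wsub: "W \<subseteq> carrier G"
    using openin_subset[OF W(1)] by simp
  have Wgam: "\<exists>v. x = one_param v 1" if "x \<in> W" for x
  proof -
    obtain v where "r x = exp (A v)"
      using bspec[OF W(3) \<open>x \<in> W\<close>] by blast
    then have "x = one_param v 1"
      using that Wsub by (intro r_eqD) (auto simp: one_param)
    then show ?thesis ..
  qed
  have Hsub: "H \<subseteq> carrier G"
    using word_closed by (auto simp: H_def)
  have Hmult: "h \<otimes>\<^bsub>G\<^esub> one_param v 1 \<in> H" if "h \<in> H" for h v
  proof -
    obtain vs where "h = word vs 1"
      using \<open>h \<in> H\<close> unfolding H_def by (rule rangeE)
    then have "h \<otimes>\<^bsub>G\<^esub> one_param v 1 = word (vs @ [v]) 1"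
      by (simp add: word_append word_single)
    then show ?thesis
      unfolding H_def by (rule range_eqI)
  qed
  define N where "N h = {x \<in> topspace T. inv\<^bsub>G\<^esub> h \<otimes>\<^bsub>G\<^esub> x \<in> W}" for h
  have oN: "openin T (N h)" if "h \<in> carrier G" for h
    unfolding N_def
    by (rule openin_continuous_map_preimage[OF left_mult_cont W(1)]) (simp add: that)
  have hN: "h \<in> N h" if "h \<in> carrier G" for h
    using that W(2) by (simp add: N_def)
  have Nx: "\<exists>v. x = h \<otimes>\<^bsub>G\<^esub> one_param v 1" if "h \<in> carrier G" "x \<in> N h" for h x
  proof -
    have x: "x \<in> carrier G" "inv\<^bsub>G\<^esub> h \<otimes>\<^bsub>G\<^esub> x \<in> W"
      using that(2) by (simp_all add: N_def)
    obtain v where v: "inv\<^bsub>G\<^esub> h \<otimes>\<^bsub>G\<^esub> x = one_param v 1"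
      using Wgam[OF x(2)] by blast
    have "x = h \<otimes>\<^bsub>G\<^esub> (inv\<^bsub>G\<^esub> h \<otimes>\<^bsub>G\<^esub> x)"
      using that(1) x(1) by (simp add: m_assoc[symmetric])
    then have "x = h \<otimes>\<^bsub>G\<^esub> one_param v 1"
      unfolding v .
    then show ?thesis ..
  qed
  have "openin T H"
    unfolding openin_subopen[of T H]
  proof
    fix h assume h: "h \<in> H"
    then have hc: "h \<in> carrier G" using Hsub by blast
    have "N h \<subseteq> H"
      using Nx[OF hc] Hmult[OF h] by fast
    then show "\<exists>V. openin T V \<and> h \<in> V \<and> V \<subseteq> H"
      using oN[OF hc] hN[OF hc] by blast
  qed
  moreover have "openin T (topspace T - H)"
    unfolding openin_subopen[of T "topspace T - H"]
  proof
    fix h assume h: "h \<in> topspace T - H"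
    then have hc: "h \<in> carrier G" by simp
    have "x \<notin> H" if x: "x \<in> N h" for x
    proof
      assume xH: "x \<in> H"
      obtain v where v: "x = h \<otimes>\<^bsub>G\<^esub> one_param v 1"
        using Nx[OF hc x] by blast
      \<comment> \<open>The last factor is cancelled by reversing its vector, which exhibits
        \<open>h\<close> as a word.\<close>
      have "h = h \<otimes>\<^bsub>G\<^esub> (one_param v 1 \<otimes>\<^bsub>G\<^esub> one_param v (-1))"
        using hc by (simp flip: one_param_add add: one_param_0)
      also have "\<dots> = x \<otimes>\<^bsub>G\<^esub> one_param v (-1)"
        unfolding v using hc one_param(1) by (simp add: m_assoc)
      also have "one_param v (-1) = one_param (- v) 1"
        by (rule r_eqD) (simp_all add: one_param linear_neg[OF A_lin])
      finally have "h = x \<otimes>\<^bsub>G\<^esub> one_param (- v) 1" .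
      then have "h \<in> H"
        using Hmult[OF xH, of "- v"] by argo
      with h show False by simp
    qed
    moreover have "N h \<subseteq> topspace T"
      by (auto simp: N_def)
    ultimately have "N h \<subseteq> topspace T - H"
      by blast
    then show "\<exists>V. openin T V \<and> h \<in> V \<and> V \<subseteq> topspace T - H"
      using oN[OF hc] hN[OF hc] by blast
  qed
  then have "closedin T H"
    using Hsub by (simp add: closedin_def)
  moreover have "\<one>\<^bsub>G\<^esub> \<in> H"
    unfolding H_def by (rule range_eqI[of _ _ "[]"]) (simp add: word_def)
  ultimately have "H = topspace T"
    using conn unfolding connected_space_clopen_in by blast
  then have "g \<in> range (\<lambda>vs. word vs 1)"
    using g unfolding H_def by simp
  then show thesis
    using that by blast
qed

lemma word_square_in_exp_image:
  shows "\<exists>S. countable S \<and> (\<forall>t. complex_of_real t \<notin> S \<longrightarrow> word vs t \<otimes>\<^bsub>G\<^esub> word vs t \<in> exp_image G)"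
proof -
  obtain W where W: "openin T W" "\<one>\<^bsub>G\<^esub> \<in> W" "\<forall>g\<in>W. \<exists>v. r g = exp (A v) \<and> norm (A v) \<le> 1/8"
    by (rule near_identity[of "1/8"]) auto
  have "openin euclidean {t \<in> topspace euclidean. word vs t \<in> W}"
    by (rule openin_continuous_map_preimage[OF word_continuous W(1)])
  then have "open {t. word vs t \<in> W}" by simp
  moreover have "0 \<in> {t. word vs t \<in> W}"
    using W(2) by (simp add: word_0)
  ultimately obtain t0 where t0: "t0 > 0" "ball 0 t0 \<subseteq> {t. word vs t \<in> W}"
    using open_contains_ball by blast
  \<comment> \<open>Near time 0 logarithms in the real Lie algebra itself are available; 1/8 is the
    size that \<open>log_continuation\<close> asks for.\<close>
  have small: "\<exists>X. exp X = cword vs (of_real t) \<and> norm X \<le> 1/8 \<and> (\<forall>w\<in>annihilator. lfun w X = 0)"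
    if t: "0 < t" "t < t0" for t
  proof -
    have "t \<in> ball 0 t0"
      using t by simp
    then have "word vs t \<in> W"
      using t0(2) by blast
    then obtain v where v: "r (word vs t) = exp (A v)" "norm (A v) \<le> 1/8"
      using W(3) by blast
    have "\<forall>w\<in>annihilator. lfun w (A v) = 0"
      by (simp add: annihilator_def)
    with v show ?thesis
      unfolding r_word by (intro exI[of _ "A v"]) simp
  qed
  have "\<exists>S. countable S \<and> (\<forall>z. z \<notin> S \<longrightarrow>
      (\<exists>q. exp (peval q (cword vs z)) = cword vs z \<and> (\<forall>w\<in>annihilator. lfun w (peval q (cword vs z)) = 0)))"
    by (rule log_continuation[OF hol_mat_cword det_mat_cword t0(1)]) (rule small)
  then obtain S where S: "countable S"
    "\<forall>z. z \<notin> S \<longrightarrow> (\<exists>q. exp (peval q (cword vs z)) = cword vs z \<and> (\<forall>w\<in>annihilator. lfun w (peval q (cword vs z)) = 0))"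
    by (elim exE conjE)
  have "word vs t \<otimes>\<^bsub>G\<^esub> word vs t \<in> exp_image G" if t: "complex_of_real t \<notin> S" for t
  proof -
    define h where "h = cword vs (of_real t)"
    obtain q where q: "exp (peval q h) = h" "\<forall>w\<in>annihilator. lfun w (peval q h) = 0"
      using S(2) t unfolding h_def by blast
    define Z where "Z = peval q h"
    obtain u v where uv: "Z = A u + smat \<i> * A v"
      by (rule annihilated_imp_complexified[OF q(2)[folded Z_def]])
    have "cnj_mat h = h"
      unfolding h_def r_word[symmetric] by (rule cnj_mat_r)
    then have eZ: "exp Z = h" "exp (cnj_mat Z) = h"
      using q(1) by (simp_all add: Z_def flip: cnj_mat_exp)
    \<comment> \<open>\<open>cnj_mat Z\<close> commutes with its exponential \<open>h\<close>, and
      therefore with \<open>Z\<close>, a polynomial in \<open>h\<close>.\<close>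
    have "h * cnj_mat Z = cnj_mat Z * h"
      using exp_commute[of "cnj_mat Z" "cnj_mat Z"] eZ(2) by simp
    then have comm: "Z * cnj_mat Z = cnj_mat Z * Z"
      unfolding Z_def by (rule peval_commute)
    \<comment> \<open>Conjugation fixes \<open>A u\<close> and \<open>A v\<close>, so the imaginary
      parts cancel.\<close>
    have "Z + cnj_mat Z = A (2 *\<^sub>R u)"
      unfolding uv by (simp add: cnj_mat_simps cnj_mat_A linear_add[OF A_lin] smat_minus scaleR_2)
    then have "exp (A (2 *\<^sub>R u)) = h * h"
      using exp_add_commuting[OF comm] eZ by simp
    also have "\<dots> = r (word vs t \<otimes>\<^bsub>G\<^esub> word vs t)"
      by (simp add: r_mult word_closed r_word h_def)
    finally have "word vs t \<otimes>\<^bsub>G\<^esub> word vs t = one_param (2 *\<^sub>R u) 1"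
      by (intro r_eqD) (simp_all add: one_param word_closed)
    then show ?thesis
      using lie_hom_in_exp_image[OF lie one_param_lie_hom] by simp
  qed
  with S(1) show ?thesis by blast
qed

lemma square_in_closure_exp_image:
  assumes conn: "connected_space T" and g: "g \<in> carrier G"
  shows "g \<otimes>\<^bsub>G\<^esub> g \<in> T closure_of exp_image G"
  unfolding in_closure_of
proof (intro conjI allI impI)
  show "g \<otimes>\<^bsub>G\<^esub> g \<in> topspace T"
    using g by simp
  fix V assume V: "g \<otimes>\<^bsub>G\<^esub> g \<in> V \<and> openin T V"
  obtain vs where vs: "g = word vs 1"
    using word_surj[OF conn g] .
  obtain S where S: "countable S" "\<forall>t. complex_of_real t \<notin> S \<longrightarrow> word vs t \<otimes>\<^bsub>G\<^esub> word vs t \<in> exp_image G"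
    using word_square_in_exp_image[of vs] by (elim exE conjE)
  have "openin euclidean {t \<in> topspace euclidean. word vs t \<otimes>\<^bsub>G\<^esub> word vs t \<in> V}"
    using V by (intro openin_continuous_map_preimage[OF mult_cont2[OF word_continuous word_continuous]]) simp
  then have "open {t. word vs t \<otimes>\<^bsub>G\<^esub> word vs t \<in> V}" by simp
  moreover have "1 \<in> {t. word vs t \<otimes>\<^bsub>G\<^esub> word vs t \<in> V}"
    using V vs by simp
  ultimately obtain e where e: "e > 0" "ball 1 e \<subseteq> {t. word vs t \<otimes>\<^bsub>G\<^esub> word vs t \<in> V}"
    using open_contains_ball by blast
  \<comment> \<open>Time 1 itself may belong to \<open>S\<close>; times just above it avoid
    \<open>S\<close> and still lead into \<open>V\<close>.\<close>
  obtain t where t: "1 < t" "t < 1 + e" "complex_of_real t \<notin> S"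
    by (rule real_avoids_countable[OF S(1), of 1 "1 + e"]) (use e(1) in simp)
  have "t \<in> ball 1 e"
    using t by (simp add: dist_real_def)
  then show "\<exists>y. y \<in> exp_image G \<and> y \<in> V"
    using e(2) S(2) t(3) by blast
qed

end

theorem corollary1p5:
  fixes G :: "('g, 'e::real_normed_vector) lie_struct"
  assumes "connected_lie_group G"
    and "linear_lie_group TYPE('n::finite) G"
  shows "weakly_exponential G \<longleftrightarrow> dense_in (topo G) (power_map G 2 ` carrier G)"
proof -
  have lie: "lie_group G" and conn: "connected_space (topo G)"
    using assms(1) by (simp_all add: connected_lie_group_def)
  obtain \<rho> :: "'g \<Rightarrow> real^'n^'n" where \<rho>: "\<rho> \<in> lie_hom G GL" "inj_on \<rho> (carrier G)"
    using assms(2) unfolding linear_lie_group_def by blast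
  interpret linear_lie G \<rho>
    by unfold_locales (rule lie \<rho>)+
  have "power_map G 2 ` carrier G \<subseteq> topo G closure_of exp_image G"
    using square_in_closure_exp_image[OF conn] by (auto simp: power_map_def numeral_2_eq_2)
  then have 1: "topo G closure_of (power_map G 2 ` carrier G) \<subseteq> topo G closure_of exp_image G"
    by (rule closure_of_minimal) simp
  have 2: "topo G closure_of exp_image G \<subseteq> topo G closure_of (power_map G 2 ` carrier G)"
    by (rule closure_of_mono[OF exp_image_subset_squares[OF is_group]])
  show ?thesis
    unfolding weakly_exponential_def dense_in_def using 1 2 by auto
qed

end
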